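(* Let $\mathcal{C}$ be a cocomplete locally small category, let $\mathbb{J}$ be a small double category and let $U : \mathbb{J} \to \mathbb{S}\mathbf{q}(\mathcal{C})$ be a double functor. Suppose there exists a limit ordinal $\alpha$ such that either (1) for each object $A$ of $\mathbb{J}$, $UA$ is $\alpha$-small in $\mathcal{C}$; or (2) for each object $A$ of $\mathbb{J}$, $UA$ is $(\alpha,M)$-small with respect to some proper co-well-powered factorisation system $(E,M)$ on $\mathcal{C}$. Then the algebraic weak factorisation system cofibrantly generated by $\mathbb{J}$ exists; that is, there is an algebraic weak factorisation system $(L,R)$ on $\mathcal{C}$ together with an isomorphism of double categories $\mathsf{R}\text{-}\mathbb{A}\mathbf{lg} \cong \mathbb{J}^{\pitchfork\!\!\pitchfork}$ over $\mathbb{S}\mathbf{q}(\mathcal{C})$ (i.e. commuting with the forgetful double functors to $\mathbb{S}\mathbf{q}(\mathcal{C})$).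
   Context: **Basic notation.** $\mathcal{C}^{\mathbf 2}$ is the category of arrows of $\mathcal{C}$ (morphisms are commutative squares $(u,v)$, with $u$ between domains and $v$ between codomains). $\mathbb{S}\mathbf{q}(\mathcal{C})$ is the double category with objects those of $\mathcal{C}$, horizontal and vertical arrows the morphisms of $\mathcal{C}$, and squares the commutative squares. Double categories and double functors are strict. **Smallness.** For an ordinal $\alpha$, an $\alpha$-chain is a functor from the poset of ordinals less than $\alpha$ to $\mathcal{C}$. For $\alpha$ a limit ordinal, $A\in\mathcal{C}$ is $\alpha$-small if $\mathcal{C}(A,-)$ preserves colimits of $\alpha$-chains. A factorisation system means an orthogonal factorisation system $(E,M)$; it is proper if each $E$-map is an epi and each $M$-map is a mono, and co-well-powered if each object $X$ admits, up to isomorphism, only a set of morphisms in $E$ with domain $X$. An $(\alpha,M)$-chain is an $\alpha$-chain all of whose connecting maps belong to $M$. $A$ is $(\alpha,M)$-small if $\mathcal{C}(A,-)$ preserves colimits of $(\alpha,M)$-chains. **Algebraic weak factorisation systems.** A functorial factorisation on $\mathcal{C}$ factors each $f:X\to Y$ as $X \xrightarrow{Lf} Ef \xrightarrow{Rf} Y$, functorially in $f\in\mathcal{C}^{\mathbf 2}$ (a square $(u,v):f\to g$ induces $E(u,v):Ef\to Eg$). It yields endofunctors $L,R$ of $\mathcal{C}^{\mathbf 2}$ with natural transformations $\varepsilon_f=(1_X,Rf):Lf\to f$ and $\eta_f=(Lf,1_Y):f\to Rf$. An algebraic weak factorisation system (awfs) $(L,R)$ is a functorial factorisation together with an extension of $(L,\varepsilon)$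 to a comonad $(L,\varepsilon,\Delta)$ and of $(R,\eta)$ to a monad $(R,\eta,\mu)$, necessarily with $\Delta_f=(1_X,\delta_f)$, $\delta_f:Ef\to E(Lf)$ and $\mu_f=(m_f,1_Y)$, $m_f:E(Rf)\to Ef$, such that the squares $(\delta_f,m_f):LRf\to RLf$ are the components of a distributive law of the comonad $L$ over the monad $R$. **The double category $\mathsf{R}\text{-}\mathbb{A}\mathbf{lg}$.** Objects and horizontal arrows are those of $\mathcal{C}$. Vertical arrows $X\to Y$ are $R$-algebras, i.e. pairs $(f:X\to Y,\ p:Ef\to X)$ such that $(p,1_Y):Rf\to f$ is an algebra structure for the monad $R$. Squares are commutative squares which are morphisms of $R$-algebras. The vertical composite of $(f:X\to Y,p)$ followed by $(g:Y\to Z,q)$ is $gf$ with structure map $p\circ E\big(1_X,\ q\circ E(f,1_Z)\big)\circ\delta_{gf}:E(gf)\to X$; vertical identities are $(1_X,R1_X)$. The forgetful double functor to $\mathbb{S}\mathbf{q}(\mathcal{C})$ forgets algebra structures. **The double category $\mathbb{J}^{\pitchfork\!\!\pitchfork}$.** Objects and horizontal arrows are those of $\mathcal{C}$. A vertical arrow $X\to Y$ is a pair $(f,\phi)$ with $f:X\to Y$ in $\mathcal{C}$ and $\phi$ a lifting operation: for each vertical arrow $j:A\to B$ of $\mathbb{J}$ and each commutative square $(u,v):Uj\to f$, a morphism $\phi_j(u,v):UB\to X$ with $\phi_j(u,v)\circ Uj=u$ and $f\circ\phi_j(u,v)=v$, such that: - (horizontal compatibility) for each square $r:i\to j$ of $\mathbb{J}$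 between vertical arrows $i,j$, with image $(Ur_0,Ur_1):Ui\to Uj$, and each $(s,t):Uj\to f$, one has $\phi_j(s,t)\circ Ur_1=\phi_i(s\circ Ur_0,t\circ Ur_1)$; - (vertical compatibility) for each composable pair of vertical arrows $i:A\to B$, $j:B\to C$ of $\mathbb{J}$ and each $(s,t):U(j\circ i)\to f$, one has $\phi_{j\circ i}(s,t)=\phi_j(\phi_i(s,t\circ Uj),t)$. A square $(f,\phi)\to(g,\psi)$ is a commutative square $(a,b):f\to g$ with $a\circ\phi_j(u,v)=\psi_j(au,bv)$ for all $j,u,v$. The vertical composite of $(f,\phi)$ followed by $(g,\psi)$ is $gf$ with lifting operation $(u,v)\mapsto\phi_j(u,\psi_j(fu,v))$; vertical identities are identity morphisms with their unique lifting operation. The forgetful double functor to $\mathbb{S}\mathbf{q}(\mathcal{C})$ forgets lifting operations. *)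

theory Defs
  imports "HOL-Library.FuncSet"
begin

unbundle cardinal_syntax

section \<open>Size\<close>

text \<open>
  The distinction between sets and classes is made relative to a universe, presented by an
  uncountable strongly inaccessible cardinal \<open>\<kappa>\<close>: a set is small if it has fewer than \<open>\<kappa>\<close>
  elements. Every small set is in bijection with a subset of the type \<open>'k\<close> underlying \<open>\<kappa>\<close>,
  so that quantifying over small structures carried by \<open>'k\<close> amounts to quantifying over all
  small structures.
\<close>

definition inaccessible :: "'k rel \<Rightarrow> bool" where
  "inaccessible \<kappa> \<longleftrightarrow>
     Card_order \<kappa> \<and> natLeq <o \<kappa> \<and> regularCard \<kappa> \<and>
     (\<forall>A :: 'k set. |A| <o \<kappa> \<longrightarrow> |Pow A| <o \<kappa>)"

definition small :: "'k rel \<Rightarrow> 'x set \<Rightarrow> bool" where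
  "small \<kappa> X \<longleftrightarrow> |X| <o \<kappa>"

text \<open>
  Ordinals are well-orders on small subsets of \<open>'k\<close>; the elements of \<open>Field \<alpha>\<close> stand for the
  ordinals less than \<open>\<alpha>\<close>. Zero is not a limit ordinal.
\<close>

definition limit_ordinal :: "'k rel \<Rightarrow> 'k rel \<Rightarrow> bool" where
  "limit_ordinal \<kappa> \<alpha> \<longleftrightarrow>
     Well_order \<alpha> \<and> small \<kappa> (Field \<alpha>) \<and> Field \<alpha> \<noteq> {} \<and>
     (\<forall>i\<in>Field \<alpha>. \<exists>j\<in>Field \<alpha>. i \<noteq> j \<and> (i, j) \<in> \<alpha>)"


section \<open>Categories, functors, natural transformations\<close>

record ('o, 'a) cat =
  Obj :: "'o set"
  Arr :: "'a set"
  Dom :: "'a \<Rightarrow> 'o"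
  Cod :: "'a \<Rightarrow> 'o"
  Idt :: "'o \<Rightarrow> 'a"
  Comp :: "'a \<Rightarrow> 'a \<Rightarrow> 'a" (infixr "\<cdot>\<index>" 70)

definition hom :: "('o, 'a) cat \<Rightarrow> 'o \<Rightarrow> 'o \<Rightarrow> 'a set" where
  "hom C A B = {f \<in> Arr C. Dom C f = A \<and> Cod C f = B}"

locale category =
  fixes C :: "('o, 'a) cat" (structure)
  assumes Dom_in: "f \<in> Arr C \<Longrightarrow> Dom C f \<in> Obj C"
    and Cod_in: "f \<in> Arr C \<Longrightarrow> Cod C f \<in> Obj C"
    and Idt_in: "A \<in> Obj C \<Longrightarrow> Idt C A \<in> hom C A A"
    and Comp_in: "f \<in> Arr C \<Longrightarrow> g \<in> Arr C \<Longrightarrow> Cod C f = Dom C g \<Longrightarrow>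
      g \<cdot> f \<in> hom C (Dom C f) (Cod C g)"
    and Comp_Idt_left: "f \<in> Arr C \<Longrightarrow> Idt C (Cod C f) \<cdot> f = f"
    and Comp_Idt_right: "f \<in> Arr C \<Longrightarrow> f \<cdot> Idt C (Dom C f) = f"
    and Comp_assoc: "f \<in> Arr C \<Longrightarrow> g \<in> Arr C \<Longrightarrow> h \<in> Arr C \<Longrightarrow>
      Cod C f = Dom C g \<Longrightarrow> Cod C g = Dom C h \<Longrightarrow> (h \<cdot> g) \<cdot> f = h \<cdot> (g \<cdot> f)"

definition locally_small :: "'k rel \<Rightarrow> ('o, 'a) cat \<Rightarrow> bool" where
  "locally_small \<kappa> C \<longleftrightarrow> (\<forall>A\<in>Obj C. \<forall>B\<in>Obj C. small \<kappa> (hom C A B))"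

definition is_iso :: "('o, 'a) cat \<Rightarrow> 'a \<Rightarrow> bool" where
  "is_iso C f \<longleftrightarrow> f \<in> Arr C \<and>
     (\<exists>g\<in>hom C (Cod C f) (Dom C f).
        g \<cdot>\<^bsub>C\<^esub> f = Idt C (Dom C f) \<and> f \<cdot>\<^bsub>C\<^esub> g = Idt C (Cod C f))"

definition epic :: "('o, 'a) cat \<Rightarrow> 'a \<Rightarrow> bool" where
  "epic C f \<longleftrightarrow> f \<in> Arr C \<and>
     (\<forall>g\<in>Arr C. \<forall>h\<in>Arr C. Dom C g = Cod C f \<and> Dom C h = Cod C f \<and> Cod C g = Cod C h \<and>
        g \<cdot>\<^bsub>C\<^esub> f = h \<cdot>\<^bsub>C\<^esub> f \<longrightarrow> g = h)"

definition monic :: "('o, 'a) cat \<Rightarrow> 'a \<Rightarrow> bool" where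
  "monic C f \<longleftrightarrow> f \<in> Arr C \<and>
     (\<forall>g\<in>Arr C. \<forall>h\<in>Arr C. Cod C g = Dom C f \<and> Cod C h = Dom C f \<and> Dom C g = Dom C h \<and>
        f \<cdot>\<^bsub>C\<^esub> g = f \<cdot>\<^bsub>C\<^esub> h \<longrightarrow> g = h)"

record ('o, 'a, 'p, 'b) ftr =
  FO :: "'o \<Rightarrow> 'p"
  FA :: "'a \<Rightarrow> 'b"

definition is_functor :: "('o, 'a) cat \<Rightarrow> ('p, 'b) cat \<Rightarrow> ('o, 'a, 'p, 'b) ftr \<Rightarrow> bool" where
  "is_functor C D F \<longleftrightarrow>
     (\<forall>A\<in>Obj C. FO F A \<in> Obj D \<and> FA F (Idt C A) = Idt D (FO F A)) \<and>
     (\<forall>f\<in>Arr C. FA F f \<in> hom D (FO F (Dom C f)) (FO F (Cod C f))) \<and>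
     (\<forall>f\<in>Arr C. \<forall>g\<in>Arr C. Cod C f = Dom C g \<longrightarrow> FA F (g \<cdot>\<^bsub>C\<^esub> f) = FA F g \<cdot>\<^bsub>D\<^esub> FA F f)"

definition ftr_id :: "('o, 'a, 'o, 'a) ftr" where
  "ftr_id = \<lparr>FO = id, FA = id\<rparr>"

definition ftr_comp ::
  "('p, 'b, 'q, 'c) ftr \<Rightarrow> ('o, 'a, 'p, 'b) ftr \<Rightarrow> ('o, 'a, 'q, 'c) ftr" where
  "ftr_comp G F = \<lparr>FO = FO G \<circ> FO F, FA = FA G \<circ> FA F\<rparr>"

definition nat_trans ::
  "('o, 'a) cat \<Rightarrow> ('p, 'b) cat \<Rightarrow> ('o, 'a, 'p, 'b) ftr \<Rightarrow> ('o, 'a, 'p, 'b) ftr \<Rightarrow> ('o \<Rightarrow> 'b) \<Rightarrow> bool"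
where
  "nat_trans C D F G \<tau> \<longleftrightarrow>
     (\<forall>A\<in>Obj C. \<tau> A \<in> hom D (FO F A) (FO G A)) \<and>
     (\<forall>f\<in>Arr C. FA G f \<cdot>\<^bsub>D\<^esub> \<tau> (Dom C f) = \<tau> (Cod C f) \<cdot>\<^bsub>D\<^esub> FA F f)"


section \<open>Colimits\<close>

definition cocone ::
  "('i, 'm) cat \<Rightarrow> ('o, 'a) cat \<Rightarrow> ('i, 'm, 'o, 'a) ftr \<Rightarrow> 'o \<Rightarrow> ('i \<Rightarrow> 'a) \<Rightarrow> bool" where
  "cocone I C F X \<iota> \<longleftrightarrow> X \<in> Obj C \<and>
     (\<forall>i\<in>Obj I. \<iota> i \<in> hom C (FO F i) X) \<and>
     (\<forall>m\<in>Arr I. \<iota> (Cod I m) \<cdot>\<^bsub>C\<^esub> FA F m = \<iota> (Dom I m))"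

definition is_colimit ::
  "('i, 'm) cat \<Rightarrow> ('o, 'a) cat \<Rightarrow> ('i, 'm, 'o, 'a) ftr \<Rightarrow> 'o \<Rightarrow> ('i \<Rightarrow> 'a) \<Rightarrow> bool" where
  "is_colimit I C F X \<iota> \<longleftrightarrow> cocone I C F X \<iota> \<and>
     (\<forall>Y \<theta>. cocone I C F Y \<theta> \<longrightarrow> (\<exists>!h. h \<in> hom C X Y \<and> (\<forall>i\<in>Obj I. h \<cdot>\<^bsub>C\<^esub> \<iota> i = \<theta> i)))"

definition cocomplete :: "'k rel \<Rightarrow> ('o, 'a) cat \<Rightarrow> bool" where
  "cocomplete \<kappa> C \<longleftrightarrow>
     (\<forall>(I :: ('k, 'k) cat) F.
        category I \<and> small \<kappa> (Obj I) \<and> small \<kappa> (Arr I) \<and> is_functor I C F \<longrightarrow>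
        (\<exists>X \<iota>. is_colimit I C F X \<iota>))"

definition preserves_colimits_of ::
  "('i, 'm) cat \<Rightarrow> ('o, 'a) cat \<Rightarrow> ('p, 'b) cat \<Rightarrow> ('o, 'a, 'p, 'b) ftr \<Rightarrow>
   ('i, 'm, 'o, 'a) ftr set \<Rightarrow> bool" where
  "preserves_colimits_of I C D G \<F> \<longleftrightarrow>
     (\<forall>F\<in>\<F>. \<forall>X \<iota>. is_colimit I C F X \<iota> \<longrightarrow>
        is_colimit I D (ftr_comp G F) (FO G X) (\<lambda>i. FA G (\<iota> i)))"


section \<open>Smallness of objects\<close>

definition poset_cat :: "'k rel \<Rightarrow> ('k, 'k \<times> 'k) cat" where
  "poset_cat r =
     \<lparr>Obj = Field r, Arr = r, Dom = fst, Cod = snd, Idt = \<lambda>i. (i, i),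
      Comp = \<lambda>q p. (fst p, snd q)\<rparr>"

definition set_cat :: "'k rel \<Rightarrow> ('e set, 'e set \<times> ('e \<Rightarrow> 'e) \<times> 'e set) cat" where
  "set_cat \<kappa> =
     \<lparr>Obj = {X. small \<kappa> X},
      Arr = {(X, f, Y). small \<kappa> X \<and> small \<kappa> Y \<and> f \<in> X \<rightarrow>\<^sub>E Y},
      Dom = \<lambda>(X, f, Y). X,
      Cod = \<lambda>(X, f, Y). Y,
      Idt = \<lambda>X. (X, \<lambda>x\<in>X. x, X),
      Comp = \<lambda>(Y, g, Z) (X, f, Y'). (X, compose X g f, Z)\<rparr>"

text \<open>
  The functor \<open>C(A, -)\<close> takes values in the small sets of elements of \<open>'a + 'k\<close> rather than of
  \<open>'a\<close>: the second summand ensures that, however few elements \<open>'a\<close> has, \<open>set_cat \<kappa>\<close> contains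
  a copy of every small set, and so is equivalent to the category of small sets.
\<close>

definition hom_functor ::
  "('o, 'a) cat \<Rightarrow> 'o \<Rightarrow>
   ('o, 'a, ('a + 'k) set, ('a + 'k) set \<times> ('a + 'k \<Rightarrow> 'a + 'k) \<times> ('a + 'k) set) ftr" where
  "hom_functor C A =
     \<lparr>FO = \<lambda>B. Inl ` hom C A B,
      FA = \<lambda>g. (Inl ` hom C A (Dom C g),
                \<lambda>x\<in>Inl ` hom C A (Dom C g). Inl (g \<cdot>\<^bsub>C\<^esub> projl x),
                Inl ` hom C A (Cod C g))\<rparr>"

definition chains :: "('o, 'a) cat \<Rightarrow> 'k rel \<Rightarrow> ('k, 'k \<times> 'k, 'o, 'a) ftr set" where
  "chains C \<alpha> = {F. is_functor (poset_cat \<alpha>) C F}"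

definition chains_in :: "('o, 'a) cat \<Rightarrow> 'k rel \<Rightarrow> 'a set \<Rightarrow> ('k, 'k \<times> 'k, 'o, 'a) ftr set" where
  "chains_in C \<alpha> M = {F \<in> chains C \<alpha>. \<forall>p\<in>\<alpha>. FA F p \<in> M}"

definition ordinal_small :: "'k rel \<Rightarrow> ('o, 'a) cat \<Rightarrow> 'k rel \<Rightarrow> 'o \<Rightarrow> bool" where
  "ordinal_small \<kappa> C \<alpha> A \<longleftrightarrow>
     preserves_colimits_of (poset_cat \<alpha>) C (set_cat \<kappa>)
       (hom_functor C A :: (_, _, ('a + 'k) set, _) ftr) (chains C \<alpha>)"

definition ordinal_small_wrt ::
  "'k rel \<Rightarrow> ('o, 'a) cat \<Rightarrow> 'k rel \<Rightarrow> 'a set \<Rightarrow> 'o \<Rightarrow> bool" where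
  "ordinal_small_wrt \<kappa> C \<alpha> M A \<longleftrightarrow>
     preserves_colimits_of (poset_cat \<alpha>) C (set_cat \<kappa>)
       (hom_functor C A :: (_, _, ('a + 'k) set, _) ftr) (chains_in C \<alpha> M)"


section \<open>The category of arrows\<close>

text \<open>
  \<open>Sq f g u v\<close> has left boundary \<open>f\<close>, right boundary \<open>g\<close>, top boundary \<open>u\<close> and bottom
  boundary \<open>v\<close>; in the category of arrows it is the morphism \<open>(u, v) : f \<rightarrow> g\<close>.
\<close>

datatype ('v, 'h) sq = Sq (sq_left: 'v) (sq_right: 'v) (sq_top: 'h) (sq_bot: 'h)

definition csquares :: "('o, 'a) cat \<Rightarrow> ('a, 'a) sq set" where
  "csquares C =
     {Sq f g u v | f g u v.
        f \<in> Arr C \<and> g \<in> Arr C \<and>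
        u \<in> hom C (Dom C f) (Dom C g) \<and> v \<in> hom C (Cod C f) (Cod C g) \<and>
        g \<cdot>\<^bsub>C\<^esub> u = v \<cdot>\<^bsub>C\<^esub> f}"

definition arrow_cat :: "('o, 'a) cat \<Rightarrow> ('a, ('a, 'a) sq) cat" where
  "arrow_cat C =
     \<lparr>Obj = Arr C, Arr = csquares C, Dom = sq_left, Cod = sq_right,
      Idt = \<lambda>f. Sq f f (Idt C (Dom C f)) (Idt C (Cod C f)),
      Comp = \<lambda>t s. Sq (sq_left s) (sq_right t)
                      (sq_top t \<cdot>\<^bsub>C\<^esub> sq_top s) (sq_bot t \<cdot>\<^bsub>C\<^esub> sq_bot s)\<rparr>"


section \<open>Factorisation systems\<close>

definition orthogonal :: "('o, 'a) cat \<Rightarrow> 'a \<Rightarrow> 'a \<Rightarrow> bool" where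
  "orthogonal C e m \<longleftrightarrow>
     (\<forall>u v. Sq e m u v \<in> csquares C \<longrightarrow>
        (\<exists>!d. d \<in> hom C (Cod C e) (Dom C m) \<and> d \<cdot>\<^bsub>C\<^esub> e = u \<and> m \<cdot>\<^bsub>C\<^esub> d = v))"

definition factorisation_system :: "('o, 'a) cat \<Rightarrow> 'a set \<Rightarrow> 'a set \<Rightarrow> bool" where
  "factorisation_system C E M \<longleftrightarrow>
     E = {e \<in> Arr C. \<forall>m\<in>M. orthogonal C e m} \<and>
     M = {m \<in> Arr C. \<forall>e\<in>E. orthogonal C e m} \<and>
     (\<forall>f\<in>Arr C. \<exists>e\<in>E. \<exists>m\<in>M. Cod C e = Dom C m \<and> f = m \<cdot>\<^bsub>C\<^esub> e)"

definition proper :: "('o, 'a) cat \<Rightarrow> 'a set \<Rightarrow> 'a set \<Rightarrow> bool" where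
  "proper C E M \<longleftrightarrow> (\<forall>e\<in>E. epic C e) \<and> (\<forall>m\<in>M. monic C m)"

definition co_well_powered :: "'k rel \<Rightarrow> ('o, 'a) cat \<Rightarrow> 'a set \<Rightarrow> bool" where
  "co_well_powered \<kappa> C E \<longleftrightarrow>
     (\<forall>X\<in>Obj C. \<exists>S. S \<subseteq> {e \<in> E. Dom C e = X} \<and> small \<kappa> S \<and>
        (\<forall>e\<in>E. Dom C e = X \<longrightarrow>
           (\<exists>s\<in>S. \<exists>i\<in>hom C (Cod C s) (Cod C e). is_iso C i \<and> i \<cdot>\<^bsub>C\<^esub> s = e)))"


section \<open>Monads, comonads, distributive laws\<close>

definition monad ::
  "('o, 'a) cat \<Rightarrow> ('o, 'a, 'o, 'a) ftr \<Rightarrow> ('o \<Rightarrow> 'a) \<Rightarrow> ('o \<Rightarrow> 'a) \<Rightarrow> bool" where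
  "monad D T \<eta> \<mu> \<longleftrightarrow>
     is_functor D D T \<and> nat_trans D D ftr_id T \<eta> \<and> nat_trans D D (ftr_comp T T) T \<mu> \<and>
     (\<forall>X\<in>Obj D.
        \<mu> X \<cdot>\<^bsub>D\<^esub> \<eta> (FO T X) = Idt D (FO T X) \<and>
        \<mu> X \<cdot>\<^bsub>D\<^esub> FA T (\<eta> X) = Idt D (FO T X) \<and>
        \<mu> X \<cdot>\<^bsub>D\<^esub> \<mu> (FO T X) = \<mu> X \<cdot>\<^bsub>D\<^esub> FA T (\<mu> X))"

definition comonad ::
  "('o, 'a) cat \<Rightarrow> ('o, 'a, 'o, 'a) ftr \<Rightarrow> ('o \<Rightarrow> 'a) \<Rightarrow> ('o \<Rightarrow> 'a) \<Rightarrow> bool" where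
  "comonad D L \<epsilon> \<Delta> \<longleftrightarrow>
     is_functor D D L \<and> nat_trans D D L ftr_id \<epsilon> \<and> nat_trans D D L (ftr_comp L L) \<Delta> \<and>
     (\<forall>X\<in>Obj D.
        \<epsilon> (FO L X) \<cdot>\<^bsub>D\<^esub> \<Delta> X = Idt D (FO L X) \<and>
        FA L (\<epsilon> X) \<cdot>\<^bsub>D\<^esub> \<Delta> X = Idt D (FO L X) \<and>
        \<Delta> (FO L X) \<cdot>\<^bsub>D\<^esub> \<Delta> X = FA L (\<Delta> X) \<cdot>\<^bsub>D\<^esub> \<Delta> X)"

definition distributive_law ::
  "('o, 'a) cat \<Rightarrow> ('o, 'a, 'o, 'a) ftr \<Rightarrow> ('o \<Rightarrow> 'a) \<Rightarrow> ('o \<Rightarrow> 'a) \<Rightarrow>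
   ('o, 'a, 'o, 'a) ftr \<Rightarrow> ('o \<Rightarrow> 'a) \<Rightarrow> ('o \<Rightarrow> 'a) \<Rightarrow> ('o \<Rightarrow> 'a) \<Rightarrow> bool" where
  "distributive_law D L \<epsilon> \<Delta> T \<eta> \<mu> \<xi> \<longleftrightarrow>
     nat_trans D D (ftr_comp L T) (ftr_comp T L) \<xi> \<and>
     (\<forall>X\<in>Obj D.
        \<xi> X \<cdot>\<^bsub>D\<^esub> FA L (\<eta> X) = \<eta> (FO L X) \<and>
        \<xi> X \<cdot>\<^bsub>D\<^esub> FA L (\<mu> X) = \<mu> (FO L X) \<cdot>\<^bsub>D\<^esub> FA T (\<xi> X) \<cdot>\<^bsub>D\<^esub> \<xi> (FO T X) \<and>
        FA T (\<epsilon> X) \<cdot>\<^bsub>D\<^esub> \<xi> X = \<epsilon> (FO T X) \<and>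
        FA T (\<Delta> X) \<cdot>\<^bsub>D\<^esub> \<xi> X = \<xi> (FO L X) \<cdot>\<^bsub>D\<^esub> FA L (\<xi> X) \<cdot>\<^bsub>D\<^esub> \<Delta> (FO T X))"

definition monad_algebra ::
  "('o, 'a) cat \<Rightarrow> ('o, 'a, 'o, 'a) ftr \<Rightarrow> ('o \<Rightarrow> 'a) \<Rightarrow> ('o \<Rightarrow> 'a) \<Rightarrow> 'o \<Rightarrow> 'a \<Rightarrow> bool" where
  "monad_algebra D T \<eta> \<mu> X a \<longleftrightarrow>
     X \<in> Obj D \<and> a \<in> hom D (FO T X) X \<and>
     a \<cdot>\<^bsub>D\<^esub> \<eta> X = Idt D X \<and> a \<cdot>\<^bsub>D\<^esub> \<mu> X = a \<cdot>\<^bsub>D\<^esub> FA T a"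

definition algebra_morphism ::
  "('o, 'a) cat \<Rightarrow> ('o, 'a, 'o, 'a) ftr \<Rightarrow> 'o \<Rightarrow> 'a \<Rightarrow> 'o \<Rightarrow> 'a \<Rightarrow> 'a \<Rightarrow> bool" where
  "algebra_morphism D T X a Y b h \<longleftrightarrow> h \<in> hom D X Y \<and> h \<cdot>\<^bsub>D\<^esub> a = b \<cdot>\<^bsub>D\<^esub> FA T h"


section \<open>Algebraic weak factorisation systems\<close>

text \<open>
  \<open>wL f\<close> and \<open>wR f\<close> are the two factors of \<open>f\<close>, \<open>wE\<close> is the action on squares of the middle
  functor \<open>E\<close>, and \<open>wdelta f\<close>, \<open>wm f\<close> are the nontrivial components of the comultiplication
  and of the multiplication.
\<close>

record 'a awfs_data =
  wL :: "'a \<Rightarrow> 'a"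
  wR :: "'a \<Rightarrow> 'a"
  wE :: "('a, 'a) sq \<Rightarrow> 'a"
  wdelta :: "'a \<Rightarrow> 'a"
  wm :: "'a \<Rightarrow> 'a"

definition mid_obj :: "('o, 'a) cat \<Rightarrow> 'a awfs_data \<Rightarrow> 'a \<Rightarrow> 'o" where
  "mid_obj C W f = Cod C (wL W f)"

definition functorial_factorisation :: "('o, 'a) cat \<Rightarrow> 'a awfs_data \<Rightarrow> bool" where
  "functorial_factorisation C W \<longleftrightarrow>
     (\<forall>f\<in>Arr C. wL W f \<in> hom C (Dom C f) (mid_obj C W f) \<and>
                wR W f \<in> hom C (mid_obj C W f) (Cod C f) \<and>
                wR W f \<cdot>\<^bsub>C\<^esub> wL W f = f) \<and>
     is_functor (arrow_cat C) C \<lparr>FO = mid_obj C W, FA = wE W\<rparr> \<and>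
     (\<forall>s\<in>csquares C.
        wE W s \<cdot>\<^bsub>C\<^esub> wL W (sq_left s) = wL W (sq_right s) \<cdot>\<^bsub>C\<^esub> sq_top s \<and>
        wR W (sq_right s) \<cdot>\<^bsub>C\<^esub> wE W s = sq_bot s \<cdot>\<^bsub>C\<^esub> wR W (sq_left s))"

definition L_ftr :: "'a awfs_data \<Rightarrow> ('a, ('a, 'a) sq, 'a, ('a, 'a) sq) ftr" where
  "L_ftr W =
     \<lparr>FO = wL W,
      FA = \<lambda>s. Sq (wL W (sq_left s)) (wL W (sq_right s)) (sq_top s) (wE W s)\<rparr>"

definition R_ftr :: "'a awfs_data \<Rightarrow> ('a, ('a, 'a) sq, 'a, ('a, 'a) sq) ftr" where
  "R_ftr W =
     \<lparr>FO = wR W,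
      FA = \<lambda>s. Sq (wR W (sq_left s)) (wR W (sq_right s)) (wE W s) (sq_bot s)\<rparr>"

definition L_counit :: "('o, 'a) cat \<Rightarrow> 'a awfs_data \<Rightarrow> 'a \<Rightarrow> ('a, 'a) sq" where
  "L_counit C W f = Sq (wL W f) f (Idt C (Dom C f)) (wR W f)"

definition L_comult :: "('o, 'a) cat \<Rightarrow> 'a awfs_data \<Rightarrow> 'a \<Rightarrow> ('a, 'a) sq" where
  "L_comult C W f = Sq (wL W f) (wL W (wL W f)) (Idt C (Dom C f)) (wdelta W f)"

definition R_unit :: "('o, 'a) cat \<Rightarrow> 'a awfs_data \<Rightarrow> 'a \<Rightarrow> ('a, 'a) sq" where
  "R_unit C W f = Sq f (wR W f) (wL W f) (Idt C (Cod C f))"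

definition R_mult :: "('o, 'a) cat \<Rightarrow> 'a awfs_data \<Rightarrow> 'a \<Rightarrow> ('a, 'a) sq" where
  "R_mult C W f = Sq (wR W (wR W f)) (wR W f) (wm W f) (Idt C (Cod C f))"

definition LR_law :: "'a awfs_data \<Rightarrow> 'a \<Rightarrow> ('a, 'a) sq" where
  "LR_law W f = Sq (wL W (wR W f)) (wR W (wL W f)) (wdelta W f) (wm W f)"

definition awfs :: "('o, 'a) cat \<Rightarrow> 'a awfs_data \<Rightarrow> bool" where
  "awfs C W \<longleftrightarrow>
     functorial_factorisation C W \<and>
     comonad (arrow_cat C) (L_ftr W) (L_counit C W) (L_comult C W) \<and>
     monad (arrow_cat C) (R_ftr W) (R_unit C W) (R_mult C W) \<and>
     distributive_law (arrow_cat C) (L_ftr W) (L_counit C W) (L_comult C W)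
       (R_ftr W) (R_unit C W) (R_mult C W) (LR_law W)"


section \<open>Double categories\<close>

text \<open>
  A strict double category is presented by four categories: objects and horizontal arrows
  (\<open>Hor\<close>), objects and vertical arrows (\<open>Ver\<close>), vertical arrows and squares under horizontal
  composition (\<open>SqH\<close>), horizontal arrows and squares under vertical composition (\<open>SqV\<close>).
  Thus \<open>Dom (SqH D)\<close>, \<open>Cod (SqH D)\<close>, \<open>Dom (SqV D)\<close>, \<open>Cod (SqV D)\<close> give the left, right, top
  and bottom boundaries of a square.
\<close>

record ('o, 'h, 'v, 's) dbl_cat =
  Hor :: "('o, 'h) cat"
  Ver :: "('o, 'v) cat"
  SqH :: "('v, 's) cat"
  SqV :: "('h, 's) cat"

locale double_category =
  fixes D :: "('o, 'h, 'v, 's) dbl_cat"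
  assumes categories: "category (Hor D)" "category (Ver D)" "category (SqH D)" "category (SqV D)"
    and sorts: "Obj (Ver D) = Obj (Hor D)" "Obj (SqH D) = Arr (Ver D)"
      "Obj (SqV D) = Arr (Hor D)" "Arr (SqV D) = Arr (SqH D)"
    and corners: "s \<in> Arr (SqH D) \<Longrightarrow> Dom (Hor D) (Dom (SqV D) s) = Dom (Ver D) (Dom (SqH D) s)"
      "s \<in> Arr (SqH D) \<Longrightarrow> Cod (Hor D) (Dom (SqV D) s) = Dom (Ver D) (Cod (SqH D) s)"
      "s \<in> Arr (SqH D) \<Longrightarrow> Dom (Hor D) (Cod (SqV D) s) = Cod (Ver D) (Dom (SqH D) s)"
      "s \<in> Arr (SqH D) \<Longrightarrow> Cod (Hor D) (Cod (SqV D) s) = Cod (Ver D) (Cod (SqH D) s)"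
    and boundary_SqH_Comp:
      "s \<in> Arr (SqH D) \<Longrightarrow> t \<in> Arr (SqH D) \<Longrightarrow> Cod (SqH D) s = Dom (SqH D) t \<Longrightarrow>
        Dom (SqV D) (t \<cdot>\<^bsub>SqH D\<^esub> s) = Dom (SqV D) t \<cdot>\<^bsub>Hor D\<^esub> Dom (SqV D) s"
      "s \<in> Arr (SqH D) \<Longrightarrow> t \<in> Arr (SqH D) \<Longrightarrow> Cod (SqH D) s = Dom (SqH D) t \<Longrightarrow>
        Cod (SqV D) (t \<cdot>\<^bsub>SqH D\<^esub> s) = Cod (SqV D) t \<cdot>\<^bsub>Hor D\<^esub> Cod (SqV D) s"
    and boundary_SqV_Comp:
      "s \<in> Arr (SqV D) \<Longrightarrow> t \<in> Arr (SqV D) \<Longrightarrow> Cod (SqV D) s = Dom (SqV D) t \<Longrightarrow>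
        Dom (SqH D) (t \<cdot>\<^bsub>SqV D\<^esub> s) = Dom (SqH D) t \<cdot>\<^bsub>Ver D\<^esub> Dom (SqH D) s"
      "s \<in> Arr (SqV D) \<Longrightarrow> t \<in> Arr (SqV D) \<Longrightarrow> Cod (SqV D) s = Dom (SqV D) t \<Longrightarrow>
        Cod (SqH D) (t \<cdot>\<^bsub>SqV D\<^esub> s) = Cod (SqH D) t \<cdot>\<^bsub>Ver D\<^esub> Cod (SqH D) s"
    and boundary_SqH_Idt:
      "x \<in> Arr (Ver D) \<Longrightarrow> Dom (SqV D) (Idt (SqH D) x) = Idt (Hor D) (Dom (Ver D) x)"
      "x \<in> Arr (Ver D) \<Longrightarrow> Cod (SqV D) (Idt (SqH D) x) = Idt (Hor D) (Cod (Ver D) x)"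
    and boundary_SqV_Idt:
      "h \<in> Arr (Hor D) \<Longrightarrow> Dom (SqH D) (Idt (SqV D) h) = Idt (Ver D) (Dom (Hor D) h)"
      "h \<in> Arr (Hor D) \<Longrightarrow> Cod (SqH D) (Idt (SqV D) h) = Idt (Ver D) (Cod (Hor D) h)"
    and Idt_Comp:
      "x \<in> Arr (Ver D) \<Longrightarrow> y \<in> Arr (Ver D) \<Longrightarrow> Cod (Ver D) x = Dom (Ver D) y \<Longrightarrow>
        Idt (SqH D) (y \<cdot>\<^bsub>Ver D\<^esub> x) = Idt (SqH D) y \<cdot>\<^bsub>SqV D\<^esub> Idt (SqH D) x"
      "h \<in> Arr (Hor D) \<Longrightarrow> k \<in> Arr (Hor D) \<Longrightarrow> Cod (Hor D) h = Dom (Hor D) k \<Longrightarrow>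
        Idt (SqV D) (k \<cdot>\<^bsub>Hor D\<^esub> h) = Idt (SqV D) k \<cdot>\<^bsub>SqH D\<^esub> Idt (SqV D) h"
    and Idt_Idt: "A \<in> Obj (Hor D) \<Longrightarrow> Idt (SqH D) (Idt (Ver D) A) = Idt (SqV D) (Idt (Hor D) A)"
    and interchange:
      "s \<in> Arr (SqH D) \<Longrightarrow> t \<in> Arr (SqH D) \<Longrightarrow> s' \<in> Arr (SqH D) \<Longrightarrow> t' \<in> Arr (SqH D) \<Longrightarrow>
        Cod (SqH D) s = Dom (SqH D) t \<Longrightarrow> Cod (SqH D) s' = Dom (SqH D) t' \<Longrightarrow>
        Cod (SqV D) s = Dom (SqV D) s' \<Longrightarrow> Cod (SqV D) t = Dom (SqV D) t' \<Longrightarrow>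
        (t' \<cdot>\<^bsub>SqH D\<^esub> s') \<cdot>\<^bsub>SqV D\<^esub> (t \<cdot>\<^bsub>SqH D\<^esub> s) = (t' \<cdot>\<^bsub>SqV D\<^esub> t) \<cdot>\<^bsub>SqH D\<^esub> (s' \<cdot>\<^bsub>SqV D\<^esub> s)"

definition small_double_category :: "'k rel \<Rightarrow> ('o, 'h, 'v, 's) dbl_cat \<Rightarrow> bool" where
  "small_double_category \<kappa> D \<longleftrightarrow>
     small \<kappa> (Obj (Hor D)) \<and> small \<kappa> (Arr (Hor D)) \<and> small \<kappa> (Arr (Ver D)) \<and>
     small \<kappa> (Arr (SqH D))"

record ('o, 'h, 'v, 's, 'p, 'g, 'w, 't) dbl_ftr =
  DO :: "'o \<Rightarrow> 'p"
  DH :: "'h \<Rightarrow> 'g"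
  DV :: "'v \<Rightarrow> 'w"
  DS :: "'s \<Rightarrow> 't"

definition double_functor ::
  "('o, 'h, 'v, 's) dbl_cat \<Rightarrow> ('p, 'g, 'w, 't) dbl_cat \<Rightarrow>
   ('o, 'h, 'v, 's, 'p, 'g, 'w, 't) dbl_ftr \<Rightarrow> bool" where
  "double_functor D D' F \<longleftrightarrow>
     is_functor (Hor D) (Hor D') \<lparr>FO = DO F, FA = DH F\<rparr> \<and>
     is_functor (Ver D) (Ver D') \<lparr>FO = DO F, FA = DV F\<rparr> \<and>
     is_functor (SqH D) (SqH D') \<lparr>FO = DV F, FA = DS F\<rparr> \<and>
     is_functor (SqV D) (SqV D') \<lparr>FO = DH F, FA = DS F\<rparr>"

definition dbl_id :: "('o, 'h, 'v, 's, 'o, 'h, 'v, 's) dbl_ftr" where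
  "dbl_id = \<lparr>DO = id, DH = id, DV = id, DS = id\<rparr>"

definition dbl_comp ::
  "('p, 'g, 'w, 't, 'q, 'k, 'x, 'y) dbl_ftr \<Rightarrow> ('o, 'h, 'v, 's, 'p, 'g, 'w, 't) dbl_ftr \<Rightarrow>
   ('o, 'h, 'v, 's, 'q, 'k, 'x, 'y) dbl_ftr" where
  "dbl_comp G F =
     \<lparr>DO = DO G \<circ> DO F, DH = DH G \<circ> DH F, DV = DV G \<circ> DV F, DS = DS G \<circ> DS F\<rparr>"

text \<open>Equality of double functors out of \<open>D\<close>: values outside the carriers are irrelevant.\<close>

definition dbl_eq ::
  "('o, 'h, 'v, 's) dbl_cat \<Rightarrow> ('o, 'h, 'v, 's, 'p, 'g, 'w, 't) dbl_ftr \<Rightarrow>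
   ('o, 'h, 'v, 's, 'p, 'g, 'w, 't) dbl_ftr \<Rightarrow> bool" where
  "dbl_eq D F G \<longleftrightarrow>
     (\<forall>A\<in>Obj (Hor D). DO F A = DO G A) \<and> (\<forall>h\<in>Arr (Hor D). DH F h = DH G h) \<and>
     (\<forall>x\<in>Arr (Ver D). DV F x = DV G x) \<and> (\<forall>s\<in>Arr (SqH D). DS F s = DS G s)"

definition double_iso ::
  "('o, 'h, 'v, 's) dbl_cat \<Rightarrow> ('p, 'g, 'w, 't) dbl_cat \<Rightarrow>
   ('o, 'h, 'v, 's, 'p, 'g, 'w, 't) dbl_ftr \<Rightarrow> bool" where
  "double_iso D D' F \<longleftrightarrow>
     double_category D \<and> double_category D' \<and> double_functor D D' F \<and>
     (\<exists>G. double_functor D' D G \<and> dbl_eq D (dbl_comp G F) dbl_id \<and>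
          dbl_eq D' (dbl_comp F G) dbl_id)"


section \<open>Double categories over the double category of squares\<close>

text \<open>
  \<open>dbl_over C V und vid vcomp P\<close> has the objects and horizontal arrows of \<open>C\<close>; its vertical
  arrows are the elements of \<open>V\<close>, each lying over an arrow of \<open>C\<close> via \<open>und\<close>, with vertical
  identities \<open>vid\<close> and vertical composition \<open>vcomp\<close>; its squares are the commutative squares
  \<open>(u, v) : und x \<rightarrow> und y\<close> of \<open>C\<close> for which \<open>P x y u v\<close> holds, composed as in \<open>C\<close>.
\<close>

definition dbl_over ::
  "('o, 'a) cat \<Rightarrow> 'v set \<Rightarrow> ('v \<Rightarrow> 'a) \<Rightarrow> ('o \<Rightarrow> 'v) \<Rightarrow> ('v \<Rightarrow> 'v \<Rightarrow> 'v) \<Rightarrow>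
   ('v \<Rightarrow> 'v \<Rightarrow> 'a \<Rightarrow> 'a \<Rightarrow> bool) \<Rightarrow> ('o, 'a, 'v, ('v, 'a) sq) dbl_cat" where
  "dbl_over C V und vid vcomp P =
     (let S = {Sq x y u v | x y u v.
                 x \<in> V \<and> y \<in> V \<and> Sq (und x) (und y) u v \<in> csquares C \<and> P x y u v}
      in \<lparr>Hor = C,
          Ver = \<lparr>Obj = Obj C, Arr = V, Dom = Dom C \<circ> und, Cod = Cod C \<circ> und,
                 Idt = vid, Comp = vcomp\<rparr>,
          SqH = \<lparr>Obj = V, Arr = S, Dom = sq_left, Cod = sq_right,
                 Idt = \<lambda>x. Sq x x (Idt C (Dom C (und x))) (Idt C (Cod C (und x))),
                 Comp = \<lambda>t s. Sq (sq_left s) (sq_right t)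
                                 (sq_top t \<cdot>\<^bsub>C\<^esub> sq_top s) (sq_bot t \<cdot>\<^bsub>C\<^esub> sq_bot s)\<rparr>,
          SqV = \<lparr>Obj = Arr C, Arr = S, Dom = sq_top, Cod = sq_bot,
                 Idt = \<lambda>u. Sq (vid (Dom C u)) (vid (Cod C u)) u u,
                 Comp = \<lambda>t s. Sq (vcomp (sq_left t) (sq_left s))
                                 (vcomp (sq_right t) (sq_right s))
                                 (sq_top s) (sq_bot t)\<rparr>\<rparr>)"

definition Sq_dbl :: "('o, 'a) cat \<Rightarrow> ('o, 'a, 'a, ('a, 'a) sq) dbl_cat" where
  "Sq_dbl C = dbl_over C (Arr C) id (Idt C) (Comp C) (\<lambda>x y u v. True)"

text \<open>
  The forgetful double functor, for double categories whose vertical arrows are pairs of an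
  arrow and additional structure on it.
\<close>

definition forget_dbl :: "('o, 'h, 'h \<times> 'x, ('h \<times> 'x, 'h) sq, 'o, 'h, 'h, ('h, 'h) sq) dbl_ftr"
where
  "forget_dbl = \<lparr>DO = id, DH = id, DV = fst, DS = map_sq fst id\<rparr>"


section \<open>The double category of algebras\<close>

definition R_algs :: "('o, 'a) cat \<Rightarrow> 'a awfs_data \<Rightarrow> ('a \<times> 'a) set" where
  "R_algs C W =
     {(f, p). f \<in> Arr C \<and>
        monad_algebra (arrow_cat C) (R_ftr W) (R_unit C W) (R_mult C W)
          f (Sq (wR W f) f p (Idt C (Cod C f)))}"

definition R_alg_square ::
  "('o, 'a) cat \<Rightarrow> 'a awfs_data \<Rightarrow> 'a \<times> 'a \<Rightarrow> 'a \<times> 'a \<Rightarrow> 'a \<Rightarrow> 'a \<Rightarrow> bool" where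
  "R_alg_square C W = (\<lambda>(f, p) (g, q) u v.
     algebra_morphism (arrow_cat C) (R_ftr W)
       f (Sq (wR W f) f p (Idt C (Cod C f)))
       g (Sq (wR W g) g q (Idt C (Cod C g)))
       (Sq f g u v))"

definition R_alg_id :: "('o, 'a) cat \<Rightarrow> 'a awfs_data \<Rightarrow> 'o \<Rightarrow> 'a \<times> 'a" where
  "R_alg_id C W A = (Idt C A, wR W (Idt C A))"

definition R_alg_comp :: "('o, 'a) cat \<Rightarrow> 'a awfs_data \<Rightarrow> 'a \<times> 'a \<Rightarrow> 'a \<times> 'a \<Rightarrow> 'a \<times> 'a" where
  "R_alg_comp C W = (\<lambda>(g, q) (f, p).
     let gf = g \<cdot>\<^bsub>C\<^esub> f;
         k = q \<cdot>\<^bsub>C\<^esub> wE W (Sq gf g f (Idt C (Cod C g)))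
     in (gf, p \<cdot>\<^bsub>C\<^esub> wE W (Sq (wL W gf) f (Idt C (Dom C f)) k) \<cdot>\<^bsub>C\<^esub> wdelta W gf))"

definition R_Alg :: "('o, 'a) cat \<Rightarrow> 'a awfs_data \<Rightarrow> ('o, 'a, 'a \<times> 'a, ('a \<times> 'a, 'a) sq) dbl_cat"
where
  "R_Alg C W =
     dbl_over C (R_algs C W) fst (R_alg_id C W) (R_alg_comp C W) (R_alg_square C W)"


section \<open>The double category of arrows with lifting operations\<close>

text \<open>
  A lifting operation on \<open>f\<close> is a function \<open>\<phi>\<close> with \<open>\<phi> j u v\<close> the chosen lift for the square
  \<open>(u, v) : U j \<rightarrow> f\<close>. It is required to be \<open>undefined\<close> on all other arguments, so that
  lifting operations with the same values on squares are equal.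
\<close>

definition lift_problem ::
  "('o, 'a) cat \<Rightarrow> ('p, 'g, 'w, 't) dbl_cat \<Rightarrow> ('p, 'g, 'w, 't, 'o, 'a, 'a, ('a, 'a) sq) dbl_ftr \<Rightarrow>
   'a \<Rightarrow> 'w \<Rightarrow> 'a \<Rightarrow> 'a \<Rightarrow> bool" where
  "lift_problem C J U f j u v \<longleftrightarrow> j \<in> Arr (Ver J) \<and> Sq (DV U j) f u v \<in> csquares C"

definition lift_restrict ::
  "('o, 'a) cat \<Rightarrow> ('p, 'g, 'w, 't) dbl_cat \<Rightarrow> ('p, 'g, 'w, 't, 'o, 'a, 'a, ('a, 'a) sq) dbl_ftr \<Rightarrow>
   'a \<Rightarrow> ('w \<Rightarrow> 'a \<Rightarrow> 'a \<Rightarrow> 'a) \<Rightarrow> 'w \<Rightarrow> 'a \<Rightarrow> 'a \<Rightarrow> 'a" where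
  "lift_restrict C J U f \<phi> =
     (\<lambda>j u v. if lift_problem C J U f j u v then \<phi> j u v else undefined)"

definition lifting_operation ::
  "('o, 'a) cat \<Rightarrow> ('p, 'g, 'w, 't) dbl_cat \<Rightarrow> ('p, 'g, 'w, 't, 'o, 'a, 'a, ('a, 'a) sq) dbl_ftr \<Rightarrow>
   'a \<Rightarrow> ('w \<Rightarrow> 'a \<Rightarrow> 'a \<Rightarrow> 'a) \<Rightarrow> bool" where
  "lifting_operation C J U f \<phi> \<longleftrightarrow>
     \<phi> = lift_restrict C J U f \<phi> \<and>
     (\<forall>j u v. lift_problem C J U f j u v \<longrightarrow>
        \<phi> j u v \<in> hom C (DO U (Cod (Ver J) j)) (Dom C f) \<and>
        \<phi> j u v \<cdot>\<^bsub>C\<^esub> DV U j = u \<and> f \<cdot>\<^bsub>C\<^esub> \<phi> j u v = v) \<and>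
     (\<forall>r\<in>Arr (SqH J). \<forall>s t. lift_problem C J U f (Cod (SqH J) r) s t \<longrightarrow>
        \<phi> (Cod (SqH J) r) s t \<cdot>\<^bsub>C\<^esub> DH U (Cod (SqV J) r) =
        \<phi> (Dom (SqH J) r) (s \<cdot>\<^bsub>C\<^esub> DH U (Dom (SqV J) r)) (t \<cdot>\<^bsub>C\<^esub> DH U (Cod (SqV J) r))) \<and>
     (\<forall>i\<in>Arr (Ver J). \<forall>j\<in>Arr (Ver J). Cod (Ver J) i = Dom (Ver J) j \<longrightarrow>
        (\<forall>s t. lift_problem C J U f (j \<cdot>\<^bsub>Ver J\<^esub> i) s t \<longrightarrow>
           \<phi> (j \<cdot>\<^bsub>Ver J\<^esub> i) s t = \<phi> j (\<phi> i s (t \<cdot>\<^bsub>C\<^esub> DV U j)) t))"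

definition lift_square ::
  "('o, 'a) cat \<Rightarrow> ('p, 'g, 'w, 't) dbl_cat \<Rightarrow> ('p, 'g, 'w, 't, 'o, 'a, 'a, ('a, 'a) sq) dbl_ftr \<Rightarrow>
   'a \<times> ('w \<Rightarrow> 'a \<Rightarrow> 'a \<Rightarrow> 'a) \<Rightarrow> 'a \<times> ('w \<Rightarrow> 'a \<Rightarrow> 'a \<Rightarrow> 'a) \<Rightarrow> 'a \<Rightarrow> 'a \<Rightarrow> bool" where
  "lift_square C J U = (\<lambda>(f, \<phi>) (g, \<psi>) a b.
     \<forall>j u v. lift_problem C J U f j u v \<longrightarrow>
       a \<cdot>\<^bsub>C\<^esub> \<phi> j u v = \<psi> j (a \<cdot>\<^bsub>C\<^esub> u) (b \<cdot>\<^bsub>C\<^esub> v))"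

text \<open>The unique solution of a lifting problem \<open>(u, v)\<close> against an identity is \<open>v\<close>.\<close>

definition lift_id ::
  "('o, 'a) cat \<Rightarrow> ('p, 'g, 'w, 't) dbl_cat \<Rightarrow> ('p, 'g, 'w, 't, 'o, 'a, 'a, ('a, 'a) sq) dbl_ftr \<Rightarrow>
   'o \<Rightarrow> 'a \<times> ('w \<Rightarrow> 'a \<Rightarrow> 'a \<Rightarrow> 'a)" where
  "lift_id C J U A = (Idt C A, lift_restrict C J U (Idt C A) (\<lambda>j u v. v))"

definition lift_comp ::
  "('o, 'a) cat \<Rightarrow> ('p, 'g, 'w, 't) dbl_cat \<Rightarrow> ('p, 'g, 'w, 't, 'o, 'a, 'a, ('a, 'a) sq) dbl_ftr \<Rightarrow>
   'a \<times> ('w \<Rightarrow> 'a \<Rightarrow> 'a \<Rightarrow> 'a) \<Rightarrow> 'a \<times> ('w \<Rightarrow> 'a \<Rightarrow> 'a \<Rightarrow> 'a) \<Rightarrow> 'a \<times> ('w \<Rightarrow> 'a \<Rightarrow> 'a \<Rightarrow> 'a)" where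
  "lift_comp C J U = (\<lambda>(g, \<psi>) (f, \<phi>).
     (g \<cdot>\<^bsub>C\<^esub> f, lift_restrict C J U (g \<cdot>\<^bsub>C\<^esub> f) (\<lambda>j u v. \<phi> j u (\<psi> j (f \<cdot>\<^bsub>C\<^esub> u) v))))"

definition Lift_dbl ::
  "('o, 'a) cat \<Rightarrow> ('p, 'g, 'w, 't) dbl_cat \<Rightarrow> ('p, 'g, 'w, 't, 'o, 'a, 'a, ('a, 'a) sq) dbl_ftr \<Rightarrow>
   ('o, 'a, 'a \<times> ('w \<Rightarrow> 'a \<Rightarrow> 'a \<Rightarrow> 'a), ('a \<times> ('w \<Rightarrow> 'a \<Rightarrow> 'a \<Rightarrow> 'a), 'a) sq) dbl_cat" where
  "Lift_dbl C J U =
     dbl_over C {(f, \<phi>). f \<in> Arr C \<and> lifting_operation C J U f \<phi>} fst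
       (lift_id C J U) (lift_comp C J U) (lift_square C J U)"

end

theory Submission
  imports Defs
begin

text \<open>
  An awfs is determined by its free algebras: if every arrow has a free lifting operation over the
  same codomain, then \<open>L\<close> is the unit, \<open>R\<close> the underlying arrow of the free object, the
  comultiplication comes from the vertical composite of two free objects, and all axioms of an awfs
  and the identification of \<open>R\<close>-algebras with lifting operations follow from uniqueness in the
  universal property, the latter because lifting operations descend along split coequalisers.

  The free lifting operation on \<open>f\<close> is the limit of a transfinite sequence of objects over the
  codomain of \<open>f\<close>. The \<open>n\<close>-th one is presented by generators and relations: it receives all
  earlier ones, together with a filler for each lifting problem in an earlier one, subject to the
  compatibilities of a lifting operation. In each case of the theorem the domains are small relative
  to chains in \<open>M\<close> for a factorisation system \<open>(E, M)\<close> whose \<open>E\<close>-maps are epic (take the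
  isomorphisms for \<open>E\<close> in the first case). Co-well-poweredness makes the \<open>E\<close>-parts of the maps out
  of each stage eventually constant, so a suitable subsequence is interleaved with a chain in \<open>M\<close>;
  at its limit every lifting problem already occurs at an earlier stage.
\<close>

section \<open>Double categories of structured vertical arrows\<close>

text \<open>The connecting maps between stages need not lie in \<open>M\<close>, so the smallness
  hypothesis says nothing about the sequence of stages itself. It applies only to a chain in
  \<open>M\<close> with the same colimit, and producing that chain is the obstacle in the second
  case. The sequence is indexed by \<kappa> rather than \<alpha> because stabilisation needs room:
  by regularity of \<kappa>, a small set of \<open>E\<close>-parts cannot all stop occurring without
  a common bound, and any \<alpha>-indexed selection of stages is bounded.

  Vertical compatibility fixes the shape of the presentation. The filler for the first of two
  composable arrows becomes the top of a problem for the second, and that problem exists only at a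
  later stage. Hence fillers are attached for problems in all earlier stages, relations may link two
  earlier stages, and convergence is sought at an index with no immediate predecessor. As every
  stage is presented in the same way from all its predecessors, successors and limits are treated
  alike.

  The passage from free lifting operations to algebras is Beck's monadicity theorem, made concrete
  over a fixed codomain.\<close>

context category begin

lemma Comp_arr [simp]:
  assumes "f \<in> Arr C" "g \<in> Arr C" "Cod C f = Dom C g"
  shows "g \<cdot> f \<in> Arr C" "Dom C (g \<cdot> f) = Dom C f" "Cod C (g \<cdot> f) = Cod C g"
  using Comp_in[OF assms] by (auto simp: hom_def)

lemma Idt_arr [simp]:
  assumes "A \<in> Obj C"
  shows "Idt C A \<in> Arr C" "Dom C (Idt C A) = A" "Cod C (Idt C A) = A"
  using Idt_in[OF assms] by (auto simp: hom_def)

lemma Dom_obj [simp]: "f \<in> Arr C \<Longrightarrow> Dom C f \<in> Obj C"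
  by (rule Dom_in)

lemma Cod_obj [simp]: "f \<in> Arr C \<Longrightarrow> Cod C f \<in> Obj C"
  by (rule Cod_in)

lemma Idt_left [simp]: "f \<in> Arr C \<Longrightarrow> Cod C f = A \<Longrightarrow> Idt C A \<cdot> f = f"
  using Comp_Idt_left by auto

lemma Idt_right [simp]: "f \<in> Arr C \<Longrightarrow> Dom C f = A \<Longrightarrow> f \<cdot> Idt C A = f"
  using Comp_Idt_right by auto

lemma Comp_reassoc:
  "f \<in> Arr C \<Longrightarrow> g \<in> Arr C \<Longrightarrow> h \<in> Arr C \<Longrightarrow> Cod C f = Dom C g \<Longrightarrow> Cod C g = Dom C h \<Longrightarrow>
    h \<cdot> g = k \<Longrightarrow> h \<cdot> (g \<cdot> f) = k \<cdot> f"
  using Comp_assoc by auto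

text \<open>With the two directions exchanged, which is what its \<open>symmetric\<close> uses do,
  the same equation pastes squares vertically.\<close>

lemma paste_horizontal:
  assumes "g \<cdot> u = v \<cdot> f" "h \<cdot> u' = v' \<cdot> g"
    and "f \<in> Arr C" "g \<in> Arr C" "h \<in> Arr C" "u \<in> Arr C" "v \<in> Arr C" "u' \<in> Arr C" "v' \<in> Arr C"
    and "Cod C f = Dom C v" "Cod C u = Dom C g" "Cod C u = Dom C u'" "Cod C g = Dom C v'"
    "Cod C v = Dom C v'" "Cod C u' = Dom C h"
  shows "h \<cdot> u' \<cdot> u = (v' \<cdot> v) \<cdot> f"
proof -
  have "h \<cdot> u' \<cdot> u = (v' \<cdot> g) \<cdot> u" using assms Comp_assoc[of u u' h] by simp
  also have "\<dots> = v' \<cdot> (v \<cdot> f)" using assms Comp_assoc[of u g v'] by simp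
  also have "\<dots> = (v' \<cdot> v) \<cdot> f" using assms Comp_assoc[of f v v'] by simp
  finally show ?thesis .
qed

end

lemma csquares_iff:
  "Sq f g u v \<in> csquares C \<longleftrightarrow>
     f \<in> Arr C \<and> g \<in> Arr C \<and> u \<in> Arr C \<and> v \<in> Arr C \<and>
     Dom C u = Dom C f \<and> Cod C u = Dom C g \<and> Dom C v = Cod C f \<and> Cod C v = Cod C g \<and>
     g \<cdot>\<^bsub>C\<^esub> u = v \<cdot>\<^bsub>C\<^esub> f"
  by (auto simp: csquares_def hom_def)

text \<open>\<open>R_Alg\<close> and \<open>Lift_dbl\<close> are both instances of
  \<open>dbl_over\<close>, so the double category axioms are reduced once to the data that vary:
  vertical arrows composing strictly over \<open>C\<close>, and a predicate on commutative squares
  closed under both pastings and containing both kinds of identities. A square is determined by its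
  boundary, so interchange and the remaining laws for squares follow.\<close>

locale vertical_structure = category C
  for C :: "('o, 'a) cat" (structure) +
  fixes V :: "'v set" and und :: "'v \<Rightarrow> 'a" and vid :: "'o \<Rightarrow> 'v"
    and vcomp :: "'v \<Rightarrow> 'v \<Rightarrow> 'v" and P :: "'v \<Rightarrow> 'v \<Rightarrow> 'a \<Rightarrow> 'a \<Rightarrow> bool"
  assumes und_arr [simp]: "x \<in> V \<Longrightarrow> und x \<in> Arr C"
    and vid_V [simp]: "A \<in> Obj C \<Longrightarrow> vid A \<in> V"
    and und_vid [simp]: "A \<in> Obj C \<Longrightarrow> und (vid A) = Idt C A"
    and vcomp_V [simp]: "x \<in> V \<Longrightarrow> y \<in> V \<Longrightarrow> Cod C (und x) = Dom C (und y) \<Longrightarrow> vcomp y x \<in> V"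
    and und_vcomp [simp]: "x \<in> V \<Longrightarrow> y \<in> V \<Longrightarrow> Cod C (und x) = Dom C (und y) \<Longrightarrow>
      und (vcomp y x) = und y \<cdot> und x"
    and vcomp_vid_left [simp]: "x \<in> V \<Longrightarrow> Cod C (und x) = A \<Longrightarrow> vcomp (vid A) x = x"
    and vcomp_vid_right [simp]: "x \<in> V \<Longrightarrow> Dom C (und x) = A \<Longrightarrow> vcomp x (vid A) = x"
    and vcomp_assoc: "x \<in> V \<Longrightarrow> y \<in> V \<Longrightarrow> z \<in> V \<Longrightarrow> Cod C (und x) = Dom C (und y) \<Longrightarrow>
      Cod C (und y) = Dom C (und z) \<Longrightarrow> vcomp (vcomp z y) x = vcomp z (vcomp y x)"
    and P_hid: "x \<in> V \<Longrightarrow> P x x (Idt C (Dom C (und x))) (Idt C (Cod C (und x)))"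
    and P_hcomp: "x \<in> V \<Longrightarrow> y \<in> V \<Longrightarrow> z \<in> V \<Longrightarrow>
      Sq (und x) (und y) u v \<in> csquares C \<Longrightarrow> Sq (und y) (und z) u' v' \<in> csquares C \<Longrightarrow>
      P x y u v \<Longrightarrow> P y z u' v' \<Longrightarrow> P x z (u' \<cdot> u) (v' \<cdot> v)"
    and P_vid: "u \<in> Arr C \<Longrightarrow> P (vid (Dom C u)) (vid (Cod C u)) u u"
    and P_vcomp: "x \<in> V \<Longrightarrow> y \<in> V \<Longrightarrow> x' \<in> V \<Longrightarrow> y' \<in> V \<Longrightarrow>
      Cod C (und x) = Dom C (und y) \<Longrightarrow> Cod C (und x') = Dom C (und y') \<Longrightarrow>
      Sq (und x) (und x') u v \<in> csquares C \<Longrightarrow> Sq (und y) (und y') v w \<in> csquares C \<Longrightarrow>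
      P x x' u v \<Longrightarrow> P y y' v w \<Longrightarrow> P (vcomp y x) (vcomp y' x') u w"
begin

definition mor :: "'v \<Rightarrow> 'v \<Rightarrow> 'a \<Rightarrow> 'a \<Rightarrow> bool" where
  "mor x y u v \<longleftrightarrow> x \<in> V \<and> y \<in> V \<and> Sq (und x) (und y) u v \<in> csquares C \<and> P x y u v"

lemma mor_iff:
  "mor x y u v \<longleftrightarrow> x \<in> V \<and> y \<in> V \<and> u \<in> Arr C \<and> v \<in> Arr C \<and> Dom C u = Dom C (und x) \<and>
     Cod C u = Dom C (und y) \<and> Dom C v = Cod C (und x) \<and> Cod C v = Cod C (und y) \<and>
     und y \<cdot> u = v \<cdot> und x \<and> P x y u v"
  by (auto simp: mor_def csquares_iff)

lemma mor_square:
  assumes "mor x y u v"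
  shows "x \<in> V" "y \<in> V" "u \<in> Arr C" "v \<in> Arr C" "Dom C u = Dom C (und x)"
     "Cod C u = Dom C (und y)" "Dom C v = Cod C (und x)" "Cod C v = Cod C (und y)"
     "und y \<cdot> u = v \<cdot> und x"
  using assms by (auto simp: mor_iff)

lemma mor_id:
  "x \<in> V \<Longrightarrow> Dom C (und x) = A \<Longrightarrow> Cod C (und x) = B \<Longrightarrow> mor x x (Idt C A) (Idt C B)"
  by (auto simp: mor_iff P_hid)

lemma mor_hcomp:
  assumes "mor x y u v" "mor y z u' v'"
  shows "mor x z (u' \<cdot> u) (v' \<cdot> v)"
proof -
  note a = mor_square[OF assms(1)] and b = mor_square[OF assms(2)]
  have "und z \<cdot> u' \<cdot> u = (v' \<cdot> v) \<cdot> und x"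
    using a b by (intro paste_horizontal[of "und y"]) auto
  moreover have "P x z (u' \<cdot> u) (v' \<cdot> v)"
    using P_hcomp[of x y z u v u' v'] assms by (simp add: mor_def)
  ultimately show ?thesis using a b by (simp add: mor_iff)
qed

lemma mor_vid: "u \<in> Arr C \<Longrightarrow> Dom C u = A \<Longrightarrow> Cod C u = B \<Longrightarrow> mor (vid A) (vid B) u u"
  using P_vid by (auto simp: mor_iff)

lemma mor_vcomp:
  assumes "mor x x' u v" "mor y y' v w"
    and "Cod C (und x) = Dom C (und y)" "Cod C (und x') = Dom C (und y')"
  shows "mor (vcomp y x) (vcomp y' x') u w"
proof -
  note a = mor_square[OF assms(1)] and b = mor_square[OF assms(2)]
  have "(und y' \<cdot> und x') \<cdot> u = w \<cdot> und y \<cdot> und x"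
    using a b assms(3,4) by (intro paste_horizontal[of v, symmetric]) auto
  moreover have "P (vcomp y x) (vcomp y' x') u w"
    using P_vcomp[of x y x' y' u v w] assms by (simp add: mor_def)
  ultimately show ?thesis using a b assms(3,4) by (simp add: mor_iff)
qed

abbreviation (input) "D \<equiv> dbl_over C V und vid vcomp P"

lemma D_simps:
  "Hor D = C" "Obj (Ver D) = Obj C" "Arr (Ver D) = V" "Dom (Ver D) = Dom C \<circ> und"
  "Cod (Ver D) = Cod C \<circ> und" "Idt (Ver D) = vid" "Comp (Ver D) = vcomp"
  "Obj (SqH D) = V" "Dom (SqH D) = sq_left" "Cod (SqH D) = sq_right"
  "Idt (SqH D) x = Sq x x (Idt C (Dom C (und x))) (Idt C (Cod C (und x)))"
  "Comp (SqH D) t s = Sq (sq_left s) (sq_right t) (sq_top t \<cdot> sq_top s) (sq_bot t \<cdot> sq_bot s)"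
  "Obj (SqV D) = Arr C" "Dom (SqV D) = sq_top" "Cod (SqV D) = sq_bot"
  "Idt (SqV D) u = Sq (vid (Dom C u)) (vid (Cod C u)) u u"
  "Comp (SqV D) t s = Sq (vcomp (sq_left t) (sq_left s)) (vcomp (sq_right t) (sq_right s))
     (sq_top s) (sq_bot t)"
  "s \<in> Arr (SqH D) \<longleftrightarrow> mor (sq_left s) (sq_right s) (sq_top s) (sq_bot s)"
  "s \<in> Arr (SqV D) \<longleftrightarrow> mor (sq_left s) (sq_right s) (sq_top s) (sq_bot s)"
  by (cases s; auto simp: dbl_over_def Let_def mor_def)+

lemma double_category_D: "double_category D"
proof (rule double_category.intro)
  show "category (Hor D)" by (simp add: D_simps category_axioms)
  show "category (Ver D)"
    by unfold_locales (auto simp: D_simps hom_def vcomp_assoc)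
  show "category (SqH D)"
  proof (unfold_locales, goal_cases)
    case (3 x) then show ?case by (simp add: D_simps hom_def mor_id)
  next
    case (4 f g) then show ?case by (auto simp: D_simps hom_def intro: mor_hcomp)
  qed (auto simp: D_simps mor_iff Comp_assoc)
  show "category (SqV D)"
  proof (unfold_locales, goal_cases)
    case (3 u) then show ?case by (simp add: D_simps hom_def mor_vid)
  next
    case (4 f g) then show ?case
      by (simp add: D_simps hom_def) (metis mor_square(5-8) mor_vcomp)
  next
    case (7 f g h)
    then have "mor (sq_left f) (sq_right f) (sq_top f) (sq_bot f)"
      "mor (sq_left g) (sq_right g) (sq_top g) (sq_bot g)"
      "mor (sq_left h) (sq_right h) (sq_top h) (sq_bot h)" by (simp_all add: D_simps)
    note this[THEN mor_square(1)] this[THEN mor_square(2)] this[THEN mor_square(5)]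
      this[THEN mor_square(6)] this[THEN mor_square(7)] this[THEN mor_square(8)]
    with 7(4,5) show ?case by (simp add: D_simps vcomp_assoc)
  next
    case (5 f)
    then have "mor (sq_left f) (sq_right f) (sq_top f) (sq_bot f)" by (simp_all add: D_simps)
    from this[THEN mor_square(1)] this[THEN mor_square(2)] this[THEN mor_square(7)]
      this[THEN mor_square(8)] show ?case by (simp add: D_simps)
  next
    case (6 f)
    then have "mor (sq_left f) (sq_right f) (sq_top f) (sq_bot f)" by (simp_all add: D_simps)
    from this[THEN mor_square(1)] this[THEN mor_square(2)] this[THEN mor_square(5)]
      this[THEN mor_square(6)] show ?case by (simp add: D_simps)
  qed (auto simp: D_simps mor_iff)
qed (auto simp: D_simps mor_iff)

end

text \<open>Each law is an equation in \<open>V'\<close>, which may be checked after the injection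
  \<open>F\<close>, or an instance of \<open>P'\<close>, which \<open>F\<close> turns into one of
  \<open>P\<close>. Associativity of the vertical composition of algebras will be inherited in this
  way instead of being computed from its formula.\<close>

lemma vertical_structure_transport:
  fixes C :: "('o, 'a) cat"
  assumes vs: "vertical_structure C V und vid vcomp P"
    and F: "bij_betw F V' V"
    and und': "\<And>x. x \<in> V' \<Longrightarrow> und (F x) = und' x"
    and vid': "\<And>A. A \<in> Obj C \<Longrightarrow> vid' A \<in> V' \<and> F (vid' A) = vid A"
    and vcomp': "\<And>x y. x \<in> V' \<Longrightarrow> y \<in> V' \<Longrightarrow> Cod C (und' x) = Dom C (und' y) \<Longrightarrow>
      vcomp' y x \<in> V' \<and> F (vcomp' y x) = vcomp (F y) (F x)"
    and P': "\<And>x y u v. x \<in> V' \<Longrightarrow> y \<in> V' \<Longrightarrow> Sq (und' x) (und' y) u v \<in> csquares C \<Longrightarrow>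
      P' x y u v \<longleftrightarrow> P (F x) (F y) u v"
  shows "vertical_structure C V' und' vid' vcomp' P'"
proof -
  interpret V: vertical_structure C V und vid vcomp P by (rule vs)
  have FV: "F x \<in> V" if "x \<in> V'" for x using that F by (auto simp: bij_betw_def)
  have inj: "x = y" if "x \<in> V'" "y \<in> V'" "F x = F y" for x y
    using that F by (auto simp: bij_betw_def inj_on_def)
  note vidV' = vid'[THEN conjunct1] and Fvid = vid'[THEN conjunct2]
    and vcompV' = vcomp'[THEN conjunct1] and Fvcomp = vcomp'[THEN conjunct2]
  have und_arr': "und' x \<in> Arr C" if "x \<in> V'" for x
    using that FV und' V.und_arr by metis
  have und_vid': "und' (vid' A) = Idt C A" if "A \<in> Obj C" for A
    using that vid' und' V.und_vid by metis
  have und_vcomp': "und' (vcomp' y x) = und' y \<cdot>\<^bsub>C\<^esub> und' x"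
    if "x \<in> V'" "y \<in> V'" "Cod C (und' x) = Dom C (und' y)" for x y
    using that vcomp' und' V.und_vcomp FV by metis
  show ?thesis
  proof
    fix x A assume "x \<in> V'" "Cod C (und' x) = A"
    then show "vcomp' (vid' A) x = x"
      by (intro inj) (auto simp: Fvcomp Fvid vidV' vcompV' und' FV und_vid' und_arr')
  next
    fix x A assume "x \<in> V'" "Dom C (und' x) = A"
    then show "vcomp' x (vid' A) = x"
      by (intro inj) (auto simp: Fvcomp Fvid vidV' vcompV' und' FV und_vid' und_arr')
  next
    fix x y z
    assume "x \<in> V'" "y \<in> V'" "z \<in> V'" "Cod C (und' x) = Dom C (und' y)"
      "Cod C (und' y) = Dom C (und' z)"
    then show "vcomp' (vcomp' z y) x = vcomp' z (vcomp' y x)"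
      by (intro inj)
        (auto simp: Fvcomp vcompV' und' FV und_vcomp' und_arr' V.vcomp_assoc)
  next
    fix x assume x: "x \<in> V'"
    then have "Sq (und' x) (und' x) (Idt C (Dom C (und' x))) (Idt C (Cod C (und' x))) \<in> csquares C"
      by (simp add: csquares_iff und_arr')
    then show "P' x x (Idt C (Dom C (und' x))) (Idt C (Cod C (und' x)))"
      using V.P_hid[OF FV[OF x]] x by (simp add: P' und')
  next
    fix x y z u v u' v'
    assume *: "x \<in> V'" "y \<in> V'" "z \<in> V'" "Sq (und' x) (und' y) u v \<in> csquares C"
      "Sq (und' y) (und' z) u' v' \<in> csquares C" "P' x y u v" "P' y z u' v'"
    then have "Sq (und' x) (und' z) (u' \<cdot>\<^bsub>C\<^esub> u) (v' \<cdot>\<^bsub>C\<^esub> v) \<in> csquares C"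
      by (simp add: csquares_iff V.paste_horizontal[of "und' y"])
    then show "P' x z (u' \<cdot>\<^bsub>C\<^esub> u) (v' \<cdot>\<^bsub>C\<^esub> v)"
      using * V.P_hcomp[of "F x" "F y" "F z" u v u' v'] by (simp add: P' und' FV)
  next
    fix u assume "u \<in> Arr C"
    then show "P' (vid' (Dom C u)) (vid' (Cod C u)) u u"
      using V.P_vid[of u] by (simp add: P' vidV' Fvid und_vid' csquares_iff)
  next
    fix x y x' y' u v w
    assume *: "x \<in> V'" "y \<in> V'" "x' \<in> V'" "y' \<in> V'"
      "Cod C (und' x) = Dom C (und' y)" "Cod C (und' x') = Dom C (und' y')"
      "Sq (und' x) (und' x') u v \<in> csquares C" "Sq (und' y) (und' y') v w \<in> csquares C"
      "P' x x' u v" "P' y y' v w"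
    then have "Sq (und' y \<cdot>\<^bsub>C\<^esub> und' x) (und' y' \<cdot>\<^bsub>C\<^esub> und' x') u w \<in> csquares C"
      by (simp add: csquares_iff V.paste_horizontal[of v, symmetric])
    then show "P' (vcomp' y x) (vcomp' y' x') u w"
      using * V.P_vcomp[of "F x" "F y" "F x'" "F y'" u v w]
      by (simp add: P' und' FV vcompV' Fvcomp und_vcomp')
  qed (use und_arr' und_vid' und_vcomp' vidV' vcompV' in auto)
qed

text \<open>The inverse double functor acts by the inverse of \<open>F\<close> on vertical arrows.
  It preserves squares because \<open>P'\<close> and \<open>P\<close> are assumed equivalent along
  \<open>F\<close>, not merely related by an implication.\<close>

lemma double_iso_transport:
  fixes C :: "('o, 'a) cat"
  assumes vs: "vertical_structure C V und vid vcomp P"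
    and F: "bij_betw F V' V"
    and und': "\<And>x. x \<in> V' \<Longrightarrow> und (F x) = und' x"
    and vid': "\<And>A. A \<in> Obj C \<Longrightarrow> vid' A \<in> V' \<and> F (vid' A) = vid A"
    and vcomp': "\<And>x y. x \<in> V' \<Longrightarrow> y \<in> V' \<Longrightarrow> Cod C (und' x) = Dom C (und' y) \<Longrightarrow>
      vcomp' y x \<in> V' \<and> F (vcomp' y x) = vcomp (F y) (F x)"
    and P': "\<And>x y u v. x \<in> V' \<Longrightarrow> y \<in> V' \<Longrightarrow> Sq (und' x) (und' y) u v \<in> csquares C \<Longrightarrow>
      P' x y u v \<longleftrightarrow> P (F x) (F y) u v"
  shows "double_iso (dbl_over C V' und' vid' vcomp' P') (dbl_over C V und vid vcomp P)
    \<lparr>DO = id, DH = id, DV = F, DS = map_sq F id\<rparr>"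
proof -
  interpret V: vertical_structure C V und vid vcomp P by (rule vs)
  interpret V': vertical_structure C V' und' vid' vcomp' P'
    by (rule vertical_structure_transport[OF assms])
  define G where "G = inv_into V' F"
  have FV: "F x \<in> V" if "x \<in> V'" for x using that F by (auto simp: bij_betw_def)
  have GV: "G x \<in> V'" if "x \<in> V" for x
    unfolding G_def using that F by (metis bij_betw_def inv_into_into)
  have GF [simp]: "G (F x) = x" if "x \<in> V'" for x
    unfolding G_def using that F by (metis bij_betw_inv_into_left)
  have FG [simp]: "F (G x) = x" if "x \<in> V" for x
    unfolding G_def using that F by (metis bij_betw_inv_into_right)
  have undG: "und' (G x) = und x" if "x \<in> V" for x using that und' GV FG by metis
  have Gvid: "G (vid A) = vid' A" if "A \<in> Obj C" for A using vid'[OF that] GF by metis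
  have Gvcomp: "G (vcomp y x) = vcomp' (G y) (G x)"
    if "x \<in> V" "y \<in> V" "Cod C (und x) = Dom C (und y)" for x y
    using vcomp'[of "G x" "G y"] that GV undG GF FG by metis
  have mor': "V'.mor x y u v \<longleftrightarrow> V.mor (F x) (F y) u v" if "x \<in> V'" "y \<in> V'" for x y u v
    using that by (auto simp: V.mor_def V'.mor_def FV und' P')
  have morF: "V.mor (F x) (F y) u v" if "V'.mor x y u v" for x y u v
    using mor' that V'.mor_square(1,2) by blast
  have morG: "V'.mor (G x) (G y) u v" if "V.mor x y u v" for x y u v
    using that mor'[of "G x" "G y"] by (simp add: GV V.mor_square(1,2))
  have mor_GF_sq: "Sq (G (F (sq_left s))) (G (F (sq_right s))) (sq_top s) (sq_bot s) = s"
    if "V'.mor (sq_left s) (sq_right s) (sq_top s) (sq_bot s)" for s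
    using that by (simp add: V'.mor_iff)
  have mor_FG_sq: "Sq (F (G (sq_left s))) (F (G (sq_right s))) (sq_top s) (sq_bot s) = s"
    if "V.mor (sq_left s) (sq_right s) (sq_top s) (sq_bot s)" for s
    using that by (simp add: V.mor_iff)
  note [simp] = V.D_simps V'.D_simps sq.map_sel
  have map_Sq: "map_sq h id s = Sq (h (sq_left s)) (h (sq_right s)) (sq_top s) (sq_bot s)" for h s
    by (cases s) simp
  have "double_functor (dbl_over C V' und' vid' vcomp' P') (dbl_over C V und vid vcomp P)
    \<lparr>DO = id, DH = id, DV = F, DS = map_sq F id\<rparr>"
    unfolding double_functor_def is_functor_def
    by (auto simp: hom_def FV und' vid' vcomp' morF map_Sq)
      (metis V'.mor_square vcomp')+
  moreover have "double_functor (dbl_over C V und vid vcomp P) (dbl_over C V' und' vid' vcomp' P')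
    \<lparr>DO = id, DH = id, DV = G, DS = map_sq G id\<rparr>"
    unfolding double_functor_def is_functor_def
    by (auto simp: hom_def GV undG Gvid Gvcomp morG map_Sq)
      (metis V.mor_square Gvcomp)+
  moreover have "dbl_eq (dbl_over C V' und' vid' vcomp' P')
      (dbl_comp \<lparr>DO = id, DH = id, DV = G, DS = map_sq G id\<rparr>
        \<lparr>DO = id, DH = id, DV = F, DS = map_sq F id\<rparr>) dbl_id"
    by (simp add: dbl_eq_def dbl_comp_def dbl_id_def map_Sq mor_GF_sq)
  moreover have "dbl_eq (dbl_over C V und vid vcomp P)
      (dbl_comp \<lparr>DO = id, DH = id, DV = F, DS = map_sq F id\<rparr>
        \<lparr>DO = id, DH = id, DV = G, DS = map_sq G id\<rparr>) dbl_id"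
    by (simp add: dbl_eq_def dbl_comp_def dbl_id_def map_Sq mor_FG_sq)
  ultimately show ?thesis
    unfolding double_iso_def using V.double_category_D V'.double_category_D by blast
qed

section \<open>Free structured arrows yield an algebraic weak factorisation system\<close>

text \<open>These are the hypotheses of Beck's monadicity theorem over a fixed codomain:
  \<open>free\<close> with unit \<open>L\<close> is a left adjoint, \<open>P_discrete\<close> says
  that structures on one arrow related by the identity square coincide, and the two split conditions
  let structure descend along split epimorphisms and split coequalisers. \<open>P_und\<close> serves
  the comonad: it allows either factor of a vertical composite to be collapsed to an identity, as
  the counit laws require.\<close>

locale free_vertical = vertical_structure C V und vid vcomp P
  for C :: "('o, 'a) cat" (structure) and V :: "'v set" and und vid vcomp P +
  fixes free :: "'a \<Rightarrow> 'v" and L :: "'a \<Rightarrow> 'a"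
  assumes P_und: "x \<in> V \<Longrightarrow> P x (vid (Cod C (und x))) (und x) (Idt C (Cod C (und x)))"
    and P_discrete: "x \<in> V \<Longrightarrow> y \<in> V \<Longrightarrow> und x = und y \<Longrightarrow>
      P x y (Idt C (Dom C (und x))) (Idt C (Cod C (und x))) \<Longrightarrow> x = y"
    and P_split: "mor x y p (Idt C (Cod C (und y))) \<Longrightarrow> s \<in> Arr C \<Longrightarrow> Cod C s = Dom C p \<Longrightarrow> p \<cdot> s = Idt C (Cod C p) \<Longrightarrow>
      mor x z (u \<cdot> p) v \<Longrightarrow> u \<in> Arr C \<Longrightarrow> Dom C u = Cod C p \<Longrightarrow> mor y z u v"
    and P_split_coequaliser: "mor z' z k (Idt C (Cod C f)) \<Longrightarrow> mor z' z l (Idt C (Cod C f)) \<Longrightarrow> f \<in> Arr C \<Longrightarrow>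
      p \<in> Arr C \<Longrightarrow> s \<in> Arr C \<Longrightarrow> t \<in> Arr C \<Longrightarrow>
      Dom C p = Dom C (und z) \<Longrightarrow> Cod C p = Dom C f \<Longrightarrow> Dom C s = Dom C f \<Longrightarrow> Cod C s = Dom C p \<Longrightarrow>
      Dom C t = Dom C (und z) \<Longrightarrow> Cod C t = Dom C (und z') \<Longrightarrow>
      p \<cdot> k = p \<cdot> l \<Longrightarrow> k \<cdot> t = Idt C (Dom C (und z)) \<Longrightarrow> l \<cdot> t = s \<cdot> p \<Longrightarrow>
      p \<cdot> s = Idt C (Dom C f) \<Longrightarrow> f \<cdot> p = und z \<Longrightarrow>
      \<exists>x\<in>V. und x = f \<and> mor z x p (Idt C (Cod C f))"
    and free_V [simp]: "f \<in> Arr C \<Longrightarrow> free f \<in> V"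
    and Cod_und_free [simp]: "f \<in> Arr C \<Longrightarrow> Cod C (und (free f)) = Cod C f"
    and L_arr [simp]: "f \<in> Arr C \<Longrightarrow> L f \<in> Arr C" "f \<in> Arr C \<Longrightarrow> Dom C (L f) = Dom C f"
      "f \<in> Arr C \<Longrightarrow> Cod C (L f) = Dom C (und (free f))"
    and und_free_L [simp]: "f \<in> Arr C \<Longrightarrow> und (free f) \<cdot> L f = f"
    and free_universal: "x \<in> V \<Longrightarrow> Sq f (und x) a b \<in> csquares C \<Longrightarrow>
      \<exists>!h. mor (free f) x h b \<and> h \<cdot> L f = a"
begin

abbreviation "R f \<equiv> und (free f)"

text \<open>The transpose of the square \<open>(a, b)\<close> from \<open>f\<close> to
  \<open>und x\<close> under the free-forgetful adjunction; \<open>E\<close>, \<open>delta\<close>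
  and \<open>mult\<close> are its instances.\<close>

definition ext :: "'a \<Rightarrow> 'v \<Rightarrow> 'a \<Rightarrow> 'a \<Rightarrow> 'a" where
  "ext f x a b = (THE h. mor (free f) x h b \<and> h \<cdot> L f = a)"

definition E :: "'a \<Rightarrow> 'a \<Rightarrow> 'a \<Rightarrow> 'a \<Rightarrow> 'a" where
  "E f g a b = ext f (free g) (L g \<cdot> a) b"

text \<open>The target lies over \<open>R f\<close> after \<open>R (L f)\<close>. The transposed
  square commutes because \<open>R (L f)\<close> cancels \<open>L (L f)\<close> to
  \<open>L f\<close>, which \<open>R f\<close> then turns into \<open>f\<close>.\<close>

definition delta :: "'a \<Rightarrow> 'a" where
  "delta f = ext f (vcomp (free f) (free (L f))) (L (L f)) (Idt C (Cod C f))"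

definition mult :: "'a \<Rightarrow> 'a" where
  "mult f = ext (R f) (free f) (Idt C (Dom C (R f))) (Idt C (Cod C f))"

definition W :: "'a awfs_data" where
  "W = \<lparr>wL = L, wR = R, wE = (\<lambda>s. E (sq_left s) (sq_right s) (sq_top s) (sq_bot s)),
        wdelta = delta, wm = mult\<rparr>"

section \<open>Transposes of squares and the structure maps they induce\<close>

lemma ext_mor:
  assumes "x \<in> V" "Sq f (und x) a b \<in> csquares C"
  shows "mor (free f) x (ext f x a b) b" "ext f x a b \<cdot> L f = a"
  using theI'[OF free_universal[OF assms]] unfolding ext_def by auto

text \<open>The one pattern behind the functor, comonad, monad and distributivity equations below:
  both sides are morphisms out of a free structured arrow over the same base map, so it suffices
  that they agree on the unit.\<close>

lemma ext_eqI:
  assumes "f \<in> Arr C" "mor (free f) x h b" "mor (free f) x h' b" "h \<cdot> L f = h' \<cdot> L f"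
  shows "h = h'"
proof -
  note a = mor_square[OF assms(2)]
  have "und x \<cdot> h \<cdot> L f = b \<cdot> f"
    using a assms(1) Comp_assoc[of "L f" h "und x"] Comp_assoc[of "L f" "R f" b] by simp
  then have "Sq f (und x) (h \<cdot> L f) b \<in> csquares C" using a assms(1) by (simp add: csquares_iff)
  from free_universal[OF a(2) this] assms show ?thesis by auto
qed

lemma E_mor:
  assumes "Sq f g a b \<in> csquares C"
  shows "mor (free f) (free g) (E f g a b) b" "E f g a b \<cdot> L f = L g \<cdot> a"
    "E f g a b \<in> Arr C" "Dom C (E f g a b) = Dom C (R f)" "Cod C (E f g a b) = Dom C (R g)"
    "R g \<cdot> E f g a b = b \<cdot> R f"
proof -
  have "Sq f (R g) (L g \<cdot> a) b \<in> csquares C"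
    using assms Comp_assoc[of a "L g" "R g", symmetric] by (simp add: csquares_iff)
  moreover have "g \<in> Arr C" using assms by (simp add: csquares_iff)
  ultimately show *: "mor (free f) (free g) (E f g a b) b" "E f g a b \<cdot> L f = L g \<cdot> a"
    unfolding E_def by (intro ext_mor; simp)+
  show "E f g a b \<in> Arr C" "Dom C (E f g a b) = Dom C (R f)" "Cod C (E f g a b) = Dom C (R g)"
    "R g \<cdot> E f g a b = b \<cdot> R f"
    using mor_square[OF *(1)] by auto
qed

lemma delta_mor:
  assumes "f \<in> Arr C"
  shows "mor (free f) (vcomp (free f) (free (L f))) (delta f) (Idt C (Cod C f))"
    "delta f \<cdot> L f = L (L f)"
    and delta_arr [simp]: "delta f \<in> Arr C" "Dom C (delta f) = Dom C (R f)"
      "Cod C (delta f) = Dom C (R (L f))"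
proof -
  have V: "vcomp (free f) (free (L f)) \<in> V" using assms by simp
  have sq: "Sq f (und (vcomp (free f) (free (L f)))) (L (L f)) (Idt C (Cod C f)) \<in> csquares C"
    using assms by (simp add: csquares_iff Comp_assoc)
  show *: "mor (free f) (vcomp (free f) (free (L f))) (delta f) (Idt C (Cod C f))"
    "delta f \<cdot> L f = L (L f)"
    unfolding delta_def using ext_mor[OF V sq] by auto
  show "delta f \<in> Arr C" "Dom C (delta f) = Dom C (R f)" "Cod C (delta f) = Dom C (R (L f))"
    using mor_square[OF *(1)] assms by auto
qed

lemma mult_mor:
  assumes "f \<in> Arr C"
  shows "mor (free (R f)) (free f) (mult f) (Idt C (Cod C f))"
    "mult f \<cdot> L (R f) = Idt C (Dom C (R f))"
    and mult_arr [simp]: "mult f \<in> Arr C" "Dom C (mult f) = Dom C (R (R f))"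
      "Cod C (mult f) = Dom C (R f)"
    and R_mult: "R f \<cdot> mult f = R (R f)"
proof -
  have sq: "Sq (R f) (und (free f)) (Idt C (Dom C (R f))) (Idt C (Cod C f)) \<in> csquares C"
    using assms by (simp add: csquares_iff)
  show *: "mor (free (R f)) (free f) (mult f) (Idt C (Cod C f))"
    "mult f \<cdot> L (R f) = Idt C (Dom C (R f))"
    unfolding mult_def using ext_mor[OF _ sq] assms by auto
  show "mult f \<in> Arr C" "Dom C (mult f) = Dom C (R (R f))"
      "Cod C (mult f) = Dom C (R f)" "R f \<cdot> mult f = R (R f)"
    using mor_square[OF *(1)] assms by auto
qed

section \<open>Functoriality of the middle object and the comonad laws\<close>

lemma E_id: "f \<in> Arr C \<Longrightarrow> E f f (Idt C (Dom C f)) (Idt C (Cod C f)) = Idt C (Dom C (R f))"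
  by (rule ext_eqI[OF _ E_mor(1)]) (auto simp: csquares_iff E_mor mor_id)

lemma E_comp:
  assumes "Sq f g a b \<in> csquares C" "Sq g h c d \<in> csquares C"
  shows "E f h (c \<cdot> a) (d \<cdot> b) = E g h c d \<cdot> E f g a b"
proof (rule ext_eqI)
  have sq: "Sq f h (c \<cdot> a) (d \<cdot> b) \<in> csquares C"
    using assms by (simp add: csquares_iff paste_horizontal[of g])
  have arr: "f \<in> Arr C" "g \<in> Arr C" "h \<in> Arr C" "a \<in> Arr C" "c \<in> Arr C" "Dom C c = Dom C g"
    "Cod C a = Dom C g" "Cod C c = Dom C h" "Dom C a = Dom C f"
    using assms by (auto simp: csquares_iff)
  note e = E_mor[OF sq] E_mor[OF assms(1)] E_mor[OF assms(2)]
  show "f \<in> Arr C" "mor (free f) (free h) (E f h (c \<cdot> a) (d \<cdot> b)) (d \<cdot> b)" by fact+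
  show "mor (free f) (free h) (E g h c d \<cdot> E f g a b) (d \<cdot> b)"
    by (rule mor_hcomp[OF e(7) e(13)])
  have "(E g h c d \<cdot> E f g a b) \<cdot> L f = E g h c d \<cdot> L g \<cdot> a"
    using e arr by (simp add: Comp_assoc)
  also have "\<dots> = (L h \<cdot> c) \<cdot> a"
    using e arr Comp_assoc[of a "L g" "E g h c d"] by simp
  also have "\<dots> = E f h (c \<cdot> a) (d \<cdot> b) \<cdot> L f"
    using e arr by (simp add: Comp_assoc)
  finally show "E f h (c \<cdot> a) (d \<cdot> b) \<cdot> L f = (E g h c d \<cdot> E f g a b) \<cdot> L f" by simp
qed

lemma mor_und:
  assumes "x \<in> V" "Cod C (und x) = B"
  shows "mor x (vid B) (und x) (Idt C B)"
  using assms P_und[of x] by (auto simp: mor_iff)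

lemma delta_natural:
  assumes "Sq f g a b \<in> csquares C"
  shows "E (L f) (L g) a (E f g a b) \<cdot> delta f = delta g \<cdot> E f g a b"
proof (rule ext_eqI)
  have arr: "f \<in> Arr C" "g \<in> Arr C" "a \<in> Arr C" "b \<in> Arr C"
    "Cod C a = Dom C g" "Dom C a = Dom C f" "Dom C b = Cod C f" "Cod C b = Cod C g"
    using assms by (auto simp: csquares_iff)
  note e = E_mor[OF assms]
  have "Sq (L f) (L g) a (E f g a b) \<in> csquares C" using arr e by (simp add: csquares_iff)
  note e' = E_mor[OF this]
  have "mor (vcomp (free f) (free (L f))) (vcomp (free g) (free (L g)))
      (E (L f) (L g) a (E f g a b)) b"
    by (rule mor_vcomp[OF e'(1) e(1)]) (simp_all add: arr)
  from mor_hcomp[OF delta_mor(1) this]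
  show "mor (free f) (vcomp (free g) (free (L g))) (E (L f) (L g) a (E f g a b) \<cdot> delta f) b"
    using arr by simp
  from mor_hcomp[OF e(1) delta_mor(1)]
  show "mor (free f) (vcomp (free g) (free (L g))) (delta g \<cdot> E f g a b) b"
    using arr by simp
  have "(E (L f) (L g) a (E f g a b) \<cdot> delta f) \<cdot> L f = L (L g) \<cdot> a"
    using arr e' by (simp add: Comp_assoc delta_mor)
  also have "\<dots> = delta g \<cdot> L g \<cdot> a"
    using arr Comp_reassoc[OF _ _ _ _ _ delta_mor(2), of a g] by simp
  also have "\<dots> = (delta g \<cdot> E f g a b) \<cdot> L f" using arr e by (simp add: Comp_assoc)
  finally show "(E (L f) (L g) a (E f g a b) \<cdot> delta f) \<cdot> L f = (delta g \<cdot> E f g a b) \<cdot> L f" .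
qed (use assms in \<open>simp add: csquares_iff\<close>)

text \<open>Collapsing the factor \<open>free (L f)\<close> to a vertical identity turns the target
  of \<open>delta f\<close> into \<open>free f\<close>. The composite is therefore an endomorphism
  of \<open>free f\<close> that fixes the unit.\<close>

lemma R_L_delta: "f \<in> Arr C \<Longrightarrow> R (L f) \<cdot> delta f = Idt C (Dom C (R f))"
proof (rule ext_eqI)
  assume f: "f \<in> Arr C"
  have "mor (vcomp (free f) (free (L f))) (vcomp (free f) (vid (Cod C (L f)))) (R (L f))
      (Idt C (Cod C f))"
    by (rule mor_vcomp[OF mor_und mor_id]) (use f in simp_all)
  from mor_hcomp[OF delta_mor(1) this]
  show "mor (free f) (free f) (R (L f) \<cdot> delta f) (Idt C (Cod C f))" using f by simp
  show "mor (free f) (free f) (Idt C (Dom C (R f))) (Idt C (Cod C f))" using f by (simp add: mor_id)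
  show "(R (L f) \<cdot> delta f) \<cdot> L f = Idt C (Dom C (R f)) \<cdot> L f"
    using f by (simp add: Comp_assoc delta_mor)
qed

text \<open>Here the other factor is collapsed: a morphism from \<open>free (L f)\<close> to
  \<open>free f\<close> over \<open>R f\<close> is pasted with the square that collapses
  \<open>free f\<close> to an identity.\<close>

lemma E_R_delta:
  assumes f: "f \<in> Arr C"
  shows "E (L f) f (Idt C (Dom C f)) (R f) \<cdot> delta f = Idt C (Dom C (R f))"
proof (rule ext_eqI)
  have "Sq (L f) f (Idt C (Dom C f)) (R f) \<in> csquares C" using f by (simp add: csquares_iff)
  note e = E_mor[OF this]
  have "mor (vcomp (free f) (free (L f))) (vcomp (vid (Cod C f)) (free f))
      (E (L f) f (Idt C (Dom C f)) (R f)) (Idt C (Cod C f))"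
    by (rule mor_vcomp[OF e(1) mor_und]) (use f in simp_all)
  from mor_hcomp[OF delta_mor(1) this]
  show "mor (free f) (free f) (E (L f) f (Idt C (Dom C f)) (R f) \<cdot> delta f) (Idt C (Cod C f))"
    using f by simp
  show "mor (free f) (free f) (Idt C (Dom C (R f))) (Idt C (Cod C f))" using f by (simp add: mor_id)
  show "(E (L f) f (Idt C (Dom C f)) (R f) \<cdot> delta f) \<cdot> L f = Idt C (Dom C (R f)) \<cdot> L f"
    using f e by (simp add: Comp_assoc delta_mor)
qed (rule f)

text \<open>Both sides are morphisms into the vertical composite of three free objects;
  associativity of \<open>vcomp\<close> identifies the two bracketings that arise.\<close>

lemma delta_coassoc:
  assumes f: "f \<in> Arr C"
  shows "delta (L f) \<cdot> delta f = E (L f) (L (L f)) (Idt C (Dom C f)) (delta f) \<cdot> delta f"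
proof (rule ext_eqI)
  let ?x = "vcomp (free f) (vcomp (free (L f)) (free (L (L f))))"
  have "Sq (L f) (L (L f)) (Idt C (Dom C f)) (delta f) \<in> csquares C"
    using f by (simp add: csquares_iff delta_mor)
  note e = E_mor[OF this]
  have "mor (vcomp (free f) (free (L f))) ?x (delta (L f)) (Idt C (Cod C f))"
    by (rule mor_vcomp[OF delta_mor(1) mor_id]) (use f in simp_all)
  from mor_hcomp[OF delta_mor(1) this]
  show "mor (free f) ?x (delta (L f) \<cdot> delta f) (Idt C (Cod C f))"
    using f by simp
  have "mor (vcomp (free f) (free (L f))) (vcomp (vcomp (free f) (free (L f))) (free (L (L f))))
     (E (L f) (L (L f)) (Idt C (Dom C f)) (delta f)) (Idt C (Cod C f))"
    by (rule mor_vcomp[OF e(1) delta_mor(1)]) (use f in simp_all)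
  from mor_hcomp[OF delta_mor(1) this]
  show "mor (free f) ?x (E (L f) (L (L f)) (Idt C (Dom C f)) (delta f) \<cdot> delta f) (Idt C (Cod C f))"
    using f by (simp add: vcomp_assoc)
  show "(delta (L f) \<cdot> delta f) \<cdot> L f =
      (E (L f) (L (L f)) (Idt C (Dom C f)) (delta f) \<cdot> delta f) \<cdot> L f"
    using f e by (simp add: Comp_assoc delta_mor)
qed (rule f)

section \<open>The monad laws and the interaction of multiplication with comultiplication\<close>

lemma mult_natural:
  assumes "Sq f g a b \<in> csquares C"
  shows "E f g a b \<cdot> mult f = mult g \<cdot> E (R f) (R g) (E f g a b) b"
proof (rule ext_eqI)
  have arr: "f \<in> Arr C" "g \<in> Arr C" "a \<in> Arr C" "b \<in> Arr C"
    "Cod C a = Dom C g" "Dom C a = Dom C f" "Dom C b = Cod C f" "Cod C b = Cod C g"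
    using assms by (auto simp: csquares_iff)
  note e = E_mor[OF assms]
  have "Sq (R f) (R g) (E f g a b) b \<in> csquares C" using arr e by (simp add: csquares_iff)
  note e' = E_mor[OF this]
  show "R f \<in> Arr C" using arr by simp
  from mor_hcomp[OF mult_mor(1) e(1)]
  show "mor (free (R f)) (free g) (E f g a b \<cdot> mult f) b" using arr by simp
  from mor_hcomp[OF e'(1) mult_mor(1)]
  show "mor (free (R f)) (free g) (mult g \<cdot> E (R f) (R g) (E f g a b) b) b" using arr by simp
  have "(E f g a b \<cdot> mult f) \<cdot> L (R f) = (mult g \<cdot> L (R g)) \<cdot> E f g a b"
    using arr e mult_mor[of f] mult_mor[of g] by (simp add: Comp_assoc)
  also have "\<dots> = (mult g \<cdot> E (R f) (R g) (E f g a b) b) \<cdot> L (R f)"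
    using arr e e' by (simp add: Comp_assoc)
  finally show "(E f g a b \<cdot> mult f) \<cdot> L (R f) = (mult g \<cdot> E (R f) (R g) (E f g a b) b) \<cdot> L (R f)" .
qed

lemma mult_E_L:
  assumes f: "f \<in> Arr C"
  shows "mult f \<cdot> E f (R f) (L f) (Idt C (Cod C f)) = Idt C (Dom C (R f))"
proof (rule ext_eqI)
  have "Sq f (R f) (L f) (Idt C (Cod C f)) \<in> csquares C" using f by (simp add: csquares_iff)
  note e = E_mor[OF this]
  from mor_hcomp[OF e(1) mult_mor(1)]
  show "mor (free f) (free f) (mult f \<cdot> E f (R f) (L f) (Idt C (Cod C f))) (Idt C (Cod C f))"
    using f by simp
  show "mor (free f) (free f) (Idt C (Dom C (R f))) (Idt C (Cod C f))" using f by (simp add: mor_id)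
  have "(mult f \<cdot> E f (R f) (L f) (Idt C (Cod C f))) \<cdot> L f = (mult f \<cdot> L (R f)) \<cdot> L f"
    using f e by (simp add: Comp_assoc)
  then show "(mult f \<cdot> E f (R f) (L f) (Idt C (Cod C f))) \<cdot> L f = Idt C (Dom C (R f)) \<cdot> L f"
    using f by (simp add: mult_mor)
qed (rule f)

lemma mult_assoc:
  assumes f: "f \<in> Arr C"
  shows "mult f \<cdot> mult (R f) = mult f \<cdot> E (R (R f)) (R f) (mult f) (Idt C (Cod C f))"
proof -
  have "Sq (R (R f)) (R f) (mult f) (Idt C (Cod C f)) \<in> csquares C"
    using f by (simp add: csquares_iff R_mult)
  note e = E_mor[OF this]
  show ?thesis
  proof (rule ext_eqI)
    show "R (R f) \<in> Arr C" using f by simp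
    from mor_hcomp[OF mult_mor(1) mult_mor(1)]
    show "mor (free (R (R f))) (free f) (mult f \<cdot> mult (R f)) (Idt C (Cod C f))"
      using f by simp
    from mor_hcomp[OF e(1) mult_mor(1)]
    show "mor (free (R (R f))) (free f)
      (mult f \<cdot> E (R (R f)) (R f) (mult f) (Idt C (Cod C f))) (Idt C (Cod C f))"
      using f by simp
    have "(mult f \<cdot> E (R (R f)) (R f) (mult f) (Idt C (Cod C f))) \<cdot> L (R (R f)) =
        (mult f \<cdot> L (R f)) \<cdot> mult f"
      using f e by (simp add: Comp_assoc)
    also have "\<dots> = (mult f \<cdot> mult (R f)) \<cdot> L (R (R f))"
      using f mult_mor[of f] mult_mor[of "R f"] by (simp add: Comp_assoc)
    finally show "(mult f \<cdot> mult (R f)) \<cdot> L (R (R f)) =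
      (mult f \<cdot> E (R (R f)) (R f) (mult f) (Idt C (Cod C f))) \<cdot> L (R (R f))" by simp
  qed
qed

lemma law_square:
  assumes f: "f \<in> Arr C"
  shows "Sq (L (R f)) (R (L f)) (delta f) (mult f) \<in> csquares C"
  using f by (simp add: csquares_iff R_L_delta mult_mor)

text \<open>This equation is the top component of the compatibility of the distributive law with the
  multiplication, and at the same time the bottom component of its compatibility with the
  comultiplication. The other components of the two axioms are associativity and
  coassociativity.\<close>

lemma delta_mult:
  assumes f: "f \<in> Arr C"
  shows "delta f \<cdot> mult f =
    mult (L f) \<cdot> E (L (R f)) (R (L f)) (delta f) (mult f) \<cdot> delta (R f)"
proof (rule ext_eqI)
  note e = E_mor[OF law_square[OF f]]
  let ?x = "vcomp (free f) (free (L f))"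
  show "R f \<in> Arr C" using f by simp
  from mor_hcomp[OF mult_mor(1) delta_mor(1)]
  show "mor (free (R f)) ?x (delta f \<cdot> mult f) (Idt C (Cod C f))"
    using f by simp
  have 1: "mor (vcomp (free (R f)) (free (L (R f)))) (vcomp (free f) (free (R (L f))))
      (E (L (R f)) (R (L f)) (delta f) (mult f)) (Idt C (Cod C f))"
    by (rule mor_vcomp[OF e(1) mult_mor(1)]) (use f in simp_all)
  have 2: "mor (vcomp (free f) (free (R (L f)))) ?x (mult (L f)) (Idt C (Cod C f))"
    by (rule mor_vcomp[OF mult_mor(1) mor_id]) (use f in simp_all)
  from mor_hcomp[OF mor_hcomp[OF delta_mor(1) 1] 2]
  show "mor (free (R f)) ?x
    (mult (L f) \<cdot> E (L (R f)) (R (L f)) (delta f) (mult f) \<cdot> delta (R f)) (Idt C (Cod C f))"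
    using f by simp
  have "(mult (L f) \<cdot> E (L (R f)) (R (L f)) (delta f) (mult f) \<cdot> delta (R f)) \<cdot> L (R f) =
      mult (L f) \<cdot> (E (L (R f)) (R (L f)) (delta f) (mult f) \<cdot> L (L (R f)))"
    using f e by (simp add: Comp_assoc delta_mor)
  also have "\<dots> = (mult (L f) \<cdot> L (R (L f))) \<cdot> delta f"
    using f e by (simp add: Comp_assoc)
  also have "\<dots> = (delta f \<cdot> mult f) \<cdot> L (R f)"
    using f mult_mor[of f] mult_mor[of "L f"] by (simp add: Comp_assoc)
  finally show "(delta f \<cdot> mult f) \<cdot> L (R f) =
    (mult (L f) \<cdot> E (L (R f)) (R (L f)) (delta f) (mult f) \<cdot> delta (R f)) \<cdot> L (R f)" by simp
qed

end

section \<open>Assembling the algebraic weak factorisation system\<close>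

context free_vertical begin

lemma W_simps [simp]:
  "wL W = L" "wR W = R" "wE W (Sq f g a b) = E f g a b" "wdelta W = delta" "wm W = mult"
  by (simp_all add: W_def)

lemma mid_obj_W: "f \<in> Arr C \<Longrightarrow> mid_obj C W f = Dom C (R f)"
  by (simp add: mid_obj_def)

lemma arrow_cat_simps:
  "Obj (arrow_cat C) = Arr C" "Arr (arrow_cat C) = csquares C"
  "Dom (arrow_cat C) = sq_left" "Cod (arrow_cat C) = sq_right"
  "Idt (arrow_cat C) f = Sq f f (Idt C (Dom C f)) (Idt C (Cod C f))"
  "Comp (arrow_cat C) t s = Sq (sq_left s) (sq_right t) (sq_top t \<cdot> sq_top s) (sq_bot t \<cdot> sq_bot s)"
  by (simp_all add: arrow_cat_def)

lemma all_csquares: "(\<forall>s\<in>csquares C. Q s) \<longleftrightarrow> (\<forall>f g u v. Sq f g u v \<in> csquares C \<longrightarrow> Q (Sq f g u v))"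
  by (metis sq.exhaust)

lemma functorial_factorisation_W: "functorial_factorisation C W"
  unfolding functorial_factorisation_def is_functor_def
proof (intro conjI)
  show "\<forall>f\<in>Arr C. wL W f \<in> hom C (Dom C f) (mid_obj C W f) \<and>
    wR W f \<in> hom C (mid_obj C W f) (Cod C f) \<and> wR W f \<cdot> wL W f = f"
    by (simp add: hom_def mid_obj_W)
  show "\<forall>A\<in>Obj (arrow_cat C). FO \<lparr>FO = mid_obj C W, FA = wE W\<rparr> A \<in> Obj C \<and>
    FA \<lparr>FO = mid_obj C W, FA = wE W\<rparr> (Idt (arrow_cat C) A) =
    Idt C (FO \<lparr>FO = mid_obj C W, FA = wE W\<rparr> A)"
    by (simp add: arrow_cat_simps mid_obj_W E_id)
  show "\<forall>f\<in>Arr (arrow_cat C). FA \<lparr>FO = mid_obj C W, FA = wE W\<rparr> f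
     \<in> hom C (FO \<lparr>FO = mid_obj C W, FA = wE W\<rparr> (Dom (arrow_cat C) f))
        (FO \<lparr>FO = mid_obj C W, FA = wE W\<rparr> (Cod (arrow_cat C) f))"
    by (auto simp: arrow_cat_simps all_csquares hom_def E_mor mid_obj_W csquares_iff)
  show "\<forall>f\<in>Arr (arrow_cat C). \<forall>g\<in>Arr (arrow_cat C). Cod (arrow_cat C) f = Dom (arrow_cat C) g \<longrightarrow>
      FA \<lparr>FO = mid_obj C W, FA = wE W\<rparr> (g \<cdot>\<^bsub>arrow_cat C\<^esub> f) =
      FA \<lparr>FO = mid_obj C W, FA = wE W\<rparr> g \<cdot> FA \<lparr>FO = mid_obj C W, FA = wE W\<rparr> f"
    by (auto simp: arrow_cat_simps all_csquares E_comp)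
  show "\<forall>s\<in>csquares C. wE W s \<cdot> wL W (sq_left s) = wL W (sq_right s) \<cdot> sq_top s \<and>
    wR W (sq_right s) \<cdot> wE W s = sq_bot s \<cdot> wR W (sq_left s)"
    by (auto simp: all_csquares E_mor)
qed

lemma csquares_arr:
  assumes "Sq f g a b \<in> csquares C"
  shows "f \<in> Arr C" "g \<in> Arr C" "a \<in> Arr C" "b \<in> Arr C" "Dom C a = Dom C f" "Cod C a = Dom C g"
    "Dom C b = Cod C f" "Cod C b = Cod C g" "g \<cdot> a = b \<cdot> f"
  using assms by (auto simp: csquares_iff)

lemma L_ftr_W: "FO (L_ftr W) = L" "FA (L_ftr W) (Sq f g a b) = Sq (L f) (L g) a (E f g a b)"
  and R_ftr_W: "FO (R_ftr W) = R" "FA (R_ftr W) (Sq f g a b) = Sq (R f) (R g) (E f g a b) b"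
  by (simp_all add: L_ftr_def R_ftr_def)

lemma is_functor_L: "is_functor (arrow_cat C) (arrow_cat C) (L_ftr W)"
  unfolding is_functor_def
  by (auto simp: arrow_cat_simps all_csquares L_ftr_W hom_def E_comp E_id csquares_arr E_mor
      intro!: csquares_iff[THEN iffD2])

lemma is_functor_R: "is_functor (arrow_cat C) (arrow_cat C) (R_ftr W)"
  unfolding is_functor_def
  by (auto simp: arrow_cat_simps all_csquares R_ftr_W hom_def E_comp E_id csquares_arr E_mor
      intro!: csquares_iff[THEN iffD2])

lemmas fun_simps = arrow_cat_simps all_csquares L_ftr_W R_ftr_W hom_def ftr_id_def ftr_comp_def
  L_counit_def L_comult_def R_unit_def R_mult_def LR_law_def

lemma comonad_L: "comonad (arrow_cat C) (L_ftr W) (L_counit C W) (L_comult C W)"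
  unfolding comonad_def
proof (intro conjI is_functor_L)
  show "nat_trans (arrow_cat C) (arrow_cat C) (L_ftr W) ftr_id (L_counit C W)"
    unfolding nat_trans_def
    by (auto simp: fun_simps csquares_arr E_mor intro!: csquares_iff[THEN iffD2])
  show "nat_trans (arrow_cat C) (arrow_cat C) (L_ftr W) (ftr_comp (L_ftr W) (L_ftr W))
    (L_comult C W)"
    unfolding nat_trans_def
    by (auto simp: fun_simps csquares_arr E_mor delta_mor delta_natural
        intro!: csquares_iff[THEN iffD2])
qed (auto simp: fun_simps E_R_delta R_L_delta delta_coassoc)

lemma mult_square: "f \<in> Arr C \<Longrightarrow> Sq (R (R f)) (R f) (mult f) (Idt C (Cod C f)) \<in> csquares C"
  by (simp add: csquares_iff R_mult)

lemma monad_R: "monad (arrow_cat C) (R_ftr W) (R_unit C W) (R_mult C W)"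
  unfolding monad_def
proof (intro conjI is_functor_R)
  show "nat_trans (arrow_cat C) (arrow_cat C) ftr_id (R_ftr W) (R_unit C W)"
    unfolding nat_trans_def
    by (auto simp: fun_simps csquares_arr E_mor intro!: csquares_iff[THEN iffD2])
  show "nat_trans (arrow_cat C) (arrow_cat C) (ftr_comp (R_ftr W) (R_ftr W)) (R_ftr W)
    (R_mult C W)"
    unfolding nat_trans_def
    by (auto simp: fun_simps csquares_arr E_mor R_mult mult_natural
        intro!: csquares_iff[THEN iffD2])
qed (auto simp: fun_simps mult_mor mult_E_L mult_assoc)

lemma distributive_law_W:
  "distributive_law (arrow_cat C) (L_ftr W) (L_counit C W) (L_comult C W)
     (R_ftr W) (R_unit C W) (R_mult C W) (LR_law W)"
  unfolding distributive_law_def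
proof (intro conjI)
  show "nat_trans (arrow_cat C) (arrow_cat C) (ftr_comp (L_ftr W) (R_ftr W))
     (ftr_comp (R_ftr W) (L_ftr W)) (LR_law W)"
    unfolding nat_trans_def
    by (auto simp: fun_simps csquares_arr law_square delta_natural mult_natural)
qed (auto simp: fun_simps mult_mor mult_E_L mult_assoc E_R_delta delta_mor delta_mult
    delta_coassoc R_mult E_mor(3-5)[OF mult_square])

lemma awfs_W: "awfs C W"
  unfolding awfs_def
  using functorial_factorisation_W comonad_L monad_R distributive_law_W by blast

section \<open>Structured arrows as algebras for the monad\<close>

lemma R_algs_iff:
  "(f, p) \<in> R_algs C W \<longleftrightarrow> f \<in> Arr C \<and> p \<in> Arr C \<and> Dom C p = Dom C (R f) \<and> Cod C p = Dom C f \<and>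
     f \<cdot> p = R f \<and> p \<cdot> L f = Idt C (Dom C f) \<and>
     p \<cdot> mult f = p \<cdot> E (R f) f p (Idt C (Cod C f))"
  by (auto simp: R_algs_def monad_algebra_def fun_simps csquares_iff)

text \<open>The counit of the adjunction, obtained by transposing the identity square. Sending
  \<open>x\<close> to \<open>(und x, str x)\<close> is the comparison functor of monadicity; the
  lemmas that follow show it bijective on vertical arrows and compatible with squares, identities
  and composites.\<close>

definition str :: "'v \<Rightarrow> 'a" where
  "str x = ext (und x) x (Idt C (Dom C (und x))) (Idt C (Cod C (und x)))"

lemma str_mor:
  assumes "x \<in> V"
  shows "mor (free (und x)) x (str x) (Idt C (Cod C (und x)))"
    "str x \<cdot> L (und x) = Idt C (Dom C (und x))"
    and str_arr [simp]: "str x \<in> Arr C" "Dom C (str x) = Dom C (R (und x))"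
      "Cod C (str x) = Dom C (und x)" "und x \<cdot> str x = R (und x)"
proof -
  have sq: "Sq (und x) (und x) (Idt C (Dom C (und x))) (Idt C (Cod C (und x))) \<in> csquares C"
    using assms by (simp add: csquares_iff)
  show *: "mor (free (und x)) x (str x) (Idt C (Cod C (und x)))"
    "str x \<cdot> L (und x) = Idt C (Dom C (und x))"
    unfolding str_def using ext_mor[OF assms sq] by auto
  show "str x \<in> Arr C" "Dom C (str x) = Dom C (R (und x))"
      "Cod C (str x) = Dom C (und x)" "und x \<cdot> str x = R (und x)"
    using mor_square[OF *(1)] assms by auto
qed

lemma str_square: "x \<in> V \<Longrightarrow>
  Sq (R (und x)) (und x) (str x) (Idt C (Cod C (und x))) \<in> csquares C"
  by (simp add: csquares_iff)

lemma str_R_algs: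
  assumes x: "x \<in> V"
  shows "(und x, str x) \<in> R_algs C W"
proof -
  let ?f = "und x"
  note e = E_mor[OF str_square[OF x]]
  have "str x \<cdot> mult ?f = str x \<cdot> E (R ?f) ?f (str x) (Idt C (Cod C ?f))"
  proof (rule ext_eqI)
    show "R ?f \<in> Arr C" using x by simp
    from mor_hcomp[OF mult_mor(1) str_mor(1)]
    show "mor (free (R ?f)) x (str x \<cdot> mult ?f) (Idt C (Cod C ?f))" using x by simp
    from mor_hcomp[OF e(1) str_mor(1)]
    show "mor (free (R ?f)) x (str x \<cdot> E (R ?f) ?f (str x) (Idt C (Cod C ?f))) (Idt C (Cod C ?f))"
      using x by simp
    have "(str x \<cdot> E (R ?f) ?f (str x) (Idt C (Cod C ?f))) \<cdot> L (R ?f) = (str x \<cdot> L ?f) \<cdot> str x"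
      using x e by (simp add: Comp_assoc)
    then show "(str x \<cdot> mult ?f) \<cdot> L (R ?f) =
      (str x \<cdot> E (R ?f) ?f (str x) (Idt C (Cod C ?f))) \<cdot> L (R ?f)"
      using x by (simp add: Comp_assoc str_mor mult_mor)
  qed
  then show ?thesis using x by (simp add: R_algs_iff str_mor)
qed

lemma str_eqI:
  assumes "x \<in> V" "mor (free (und x)) x p (Idt C (Cod C (und x)))"
    "p \<cdot> L (und x) = Idt C (Dom C (und x))"
  shows "str x = p"
  by (rule ext_eqI[OF _ str_mor(1) assms(2)]) (use assms str_mor in auto)

text \<open>For the converse, \<open>str x\<close> is split epic with section
  \<open>L (und x)\<close>, so by \<open>P_split\<close> a map out of \<open>x\<close> is a morphism
  as soon as its composite with \<open>str x\<close> is. The equation identifies that composite with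
  one already known to be a morphism.\<close>

lemma mor_iff_str:
  assumes "x \<in> V" "y \<in> V" "Sq (und x) (und y) u v \<in> csquares C"
  shows "P x y u v \<longleftrightarrow> u \<cdot> str x = str y \<cdot> E (und x) (und y) u v"
proof
  note e = E_mor[OF assms(3)] and arr = csquares_arr[OF assms(3)]
  have 2: "mor (free (und x)) y (str y \<cdot> E (und x) (und y) u v) v"
    using mor_hcomp[OF e(1) str_mor(1)] assms arr by simp
  {
    assume "P x y u v"
    then have m: "mor x y u v" using assms by (simp add: mor_def)
    show "u \<cdot> str x = str y \<cdot> E (und x) (und y) u v"
    proof (rule ext_eqI[OF _ _ 2])
      show "mor (free (und x)) y (u \<cdot> str x) v"
        using mor_hcomp[OF str_mor(1) m] assms arr by simp
      have "(str y \<cdot> E (und x) (und y) u v) \<cdot> L (und x) = (str y \<cdot> L (und y)) \<cdot> u"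
        using assms arr e by (simp add: Comp_assoc)
      then show "(u \<cdot> str x) \<cdot> L (und x) = (str y \<cdot> E (und x) (und y) u v) \<cdot> L (und x)"
        using assms arr by (simp add: Comp_assoc str_mor)
    qed (use assms in simp)
  next
    assume "u \<cdot> str x = str y \<cdot> E (und x) (und y) u v"
    then have "mor (free (und x)) y (u \<cdot> str x) v" using 2 by simp
    from P_split[OF str_mor(1) _ _ _ this, of "L (und x)"] have "mor x y u v"
      using assms arr by (simp add: str_mor)
    then show "P x y u v" by (simp add: mor_def)
  }
qed

lemma str_inj:
  assumes "x \<in> V" "y \<in> V" "und x = und y" "str x = str y"
  shows "x = y"
proof (rule P_discrete[OF assms(1-3)])
  have "Sq (und x) (und y) (Idt C (Dom C (und x))) (Idt C (Cod C (und x))) \<in> csquares C"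
    using assms by (simp add: csquares_iff)
  from mor_iff_str[OF assms(1,2) this] show "P x y (Idt C (Dom C (und x))) (Idt C (Cod C (und x)))"
    using assms str_mor(2,3)[of y] E_id[of "und y"] str_arr[of y] by simp
qed

text \<open>Beck's canonical presentation of an algebra: \<open>p\<close> coequalises
  \<open>mult f\<close> and the image of \<open>p\<close> under \<open>E\<close>, and the units
  \<open>L f\<close> and \<open>L (R f)\<close> split this fork. The structure \<open>free f\<close>
  therefore descends along \<open>p\<close> to a structure on \<open>f\<close>.\<close>

lemma str_surj:
  assumes "(f, p) \<in> R_algs C W"
  shows "\<exists>x\<in>V. und x = f \<and> str x = p"
proof -
  from assms have a: "f \<in> Arr C" "p \<in> Arr C" "Dom C p = Dom C (R f)" "Cod C p = Dom C f"
     "f \<cdot> p = R f" "p \<cdot> L f = Idt C (Dom C f)"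
     "p \<cdot> mult f = p \<cdot> E (R f) f p (Idt C (Cod C f))" by (auto simp: R_algs_iff)
  have "Sq (R f) f p (Idt C (Cod C f)) \<in> csquares C" using a by (simp add: csquares_iff)
  note e = E_mor[OF this]
  have "\<exists>x\<in>V. und x = f \<and> mor (free f) x p (Idt C (Cod C f))"
    by (rule P_split_coequaliser[OF mult_mor(1) e(1), where s = "L f" and t = "L (R f)" and p = p])
      (use a e in \<open>simp_all add: mult_mor\<close>)
  then show ?thesis using str_eqI a by metis
qed

lemma str_vid: "A \<in> Obj C \<Longrightarrow> str (vid A) = R (Idt C A)"
  using str_arr(4)[of "vid A"] str_arr(1,3)[of "vid A"] by simp

text \<open>Read from right to left, the formula is a path of morphisms: \<open>delta\<close> goes
  from the free object on the composite to the vertical composite of two free objects, the middle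
  map carries this to \<open>y\<close> composed with \<open>free f\<close>, and \<open>str x\<close>
  replaces \<open>free f\<close> by \<open>x\<close>. The path restricts to the identity along the
  unit, which characterises the structure map of \<open>vcomp y x\<close>.\<close>

lemma str_vcomp:
  assumes "x \<in> V" "y \<in> V" "Cod C (und x) = Dom C (und y)"
  defines "f \<equiv> und x" and "g \<equiv> und y"
  defines "k \<equiv> str y \<cdot> E (g \<cdot> f) g f (Idt C (Cod C g))"
  shows "str (vcomp y x) = str x \<cdot> E (L (g \<cdot> f)) f (Idt C (Dom C f)) k \<cdot> delta (g \<cdot> f)"
proof -
  have fg: "f \<in> Arr C" "g \<in> Arr C" "Cod C f = Dom C g" "f = und x" "g = und y" "x \<in> V" "y \<in> V"
    using assms by auto
  have "Sq (g \<cdot> f) g f (Idt C (Cod C g)) \<in> csquares C" using fg by (simp add: csquares_iff)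
  note e1 = E_mor[OF this]
  have k: "mor (free (g \<cdot> f)) y k (Idt C (Cod C g))"
    unfolding k_def using mor_hcomp[OF e1(1), OF str_mor(1)[OF assms(2), folded g_def]] fg by simp
  have "k \<cdot> L (g \<cdot> f) = str y \<cdot> L g \<cdot> f"
    unfolding k_def using fg e1 by (simp add: Comp_assoc)
  also have "\<dots> = (str y \<cdot> L g) \<cdot> f" using fg by (simp add: Comp_assoc)
  also have "\<dots> = f" using fg by (simp add: str_mor)
  finally have kL: "k \<cdot> L (g \<cdot> f) = f" .
  then have "Sq (L (g \<cdot> f)) f (Idt C (Dom C f)) k \<in> csquares C"
    using fg mor_square[OF k] by (simp add: csquares_iff)
  note e2 = E_mor[OF this]
  show ?thesis
  proof (rule str_eqI)
    have 1: "mor (vcomp (free (g \<cdot> f)) (free (L (g \<cdot> f)))) (vcomp y (free f))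
       (E (L (g \<cdot> f)) f (Idt C (Dom C f)) k) (Idt C (Cod C g))"
      by (rule mor_vcomp[OF e2(1) k]) (use fg in simp_all)
    have "mor (vcomp y (free (und x))) (vcomp y x) (str x) (Idt C (Cod C g))"
      by (rule mor_vcomp[OF str_mor(1) mor_id]) (use fg in auto)
    from mor_hcomp[OF mor_hcomp[OF delta_mor(1) 1] this[folded f_def]]
    show "mor (free (und (vcomp y x))) (vcomp y x)
     (str x \<cdot> E (L (g \<cdot> f)) f (Idt C (Dom C f)) k \<cdot> delta (g \<cdot> f)) (Idt C (Cod C (und (vcomp y x))))"
      using fg by simp
    have "(str x \<cdot> E (L (g \<cdot> f)) f (Idt C (Dom C f)) k \<cdot> delta (g \<cdot> f)) \<cdot> L (g \<cdot> f) =
       str x \<cdot> E (L (g \<cdot> f)) f (Idt C (Dom C f)) k \<cdot> L (L (g \<cdot> f))"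
      using fg e2 by (simp add: Comp_assoc delta_mor)
    also have "\<dots> = str x \<cdot> L f" using fg e2 by simp
    also have "\<dots> = Idt C (Dom C f)" using fg by (simp add: str_mor)
    finally show "(str x \<cdot> E (L (g \<cdot> f)) f (Idt C (Dom C f)) k \<cdot> delta (g \<cdot> f)) \<cdot> L (und (vcomp y x)) =
      Idt C (Dom C (und (vcomp y x)))" using fg by simp
  qed (use assms in simp)
qed

lemma double_iso_R_Alg:
  "\<exists>F. double_iso (R_Alg C W) (dbl_over C V und vid vcomp P)
      \<lparr>DO = id, DH = id, DV = F, DS = map_sq F id\<rparr> \<and>
    (\<forall>y\<in>R_algs C W. und (F y) = fst y)"
proof -
  define K where "K x = (und x, str x)" for x
  define F where "F = inv_into V K"
  have bij: "bij_betw K V (R_algs C W)"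
    unfolding bij_betw_def inj_on_def K_def
    using str_inj str_R_algs str_surj by fastforce
  have F: "bij_betw F (R_algs C W) V" unfolding F_def by (rule bij_betw_inv_into[OF bij])
  have FV: "F y \<in> V" and KF: "und (F y) = fst y" "str (F y) = snd y" if "y \<in> R_algs C W" for y
  proof -
    show "F y \<in> V" using F that by (auto simp: bij_betw_def)
    have "K (F y) = y" unfolding F_def using bij that by (meson bij_betw_inv_into_right)
    from arg_cong[OF this, of fst] arg_cong[OF this, of snd]
    show "und (F y) = fst y" "str (F y) = snd y" by (simp_all add: K_def)
  qed
  have FK: "F (und x, str x) = x" if "x \<in> V" for x
    using bij_betw_inv_into_left[OF bij that] by (simp add: F_def K_def)
  have "double_iso (R_Alg C W) (dbl_over C V und vid vcomp P)
      \<lparr>DO = id, DH = id, DV = F, DS = map_sq F id\<rparr>"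
    unfolding R_Alg_def
  proof (rule double_iso_transport[OF vertical_structure_axioms F])
    fix A assume A: "A \<in> Obj C"
    then have "(und (vid A), str (vid A)) \<in> R_algs C W" by (intro str_R_algs) simp
    then show "R_alg_id C W A \<in> R_algs C W \<and> F (R_alg_id C W A) = vid A"
      using A FK[of "vid A"] by (simp add: R_alg_id_def str_vid)
  next
    fix x y assume xy: "x \<in> R_algs C W" "y \<in> R_algs C W" "Cod C (fst x) = Dom C (fst y)"
    have *: "R_alg_comp C W y x = (und (vcomp (F y) (F x)), str (vcomp (F y) (F x)))"
      using xy by (cases x, cases y) (simp add: R_alg_comp_def Let_def str_vcomp FV KF)
    have "vcomp (F y) (F x) \<in> V" using xy by (simp add: FV KF)
    then show "R_alg_comp C W y x \<in> R_algs C W \<and> F (R_alg_comp C W y x) = vcomp (F y) (F x)"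
      by (simp add: * FK str_R_algs)
  next
    fix x y u v
    assume xy: "x \<in> R_algs C W" "y \<in> R_algs C W" "Sq (fst x) (fst y) u v \<in> csquares C"
    have "R_alg_square C W x y u v \<longleftrightarrow> u \<cdot> snd x = snd y \<cdot> E (fst x) (fst y) u v"
      using xy csquares_arr[OF xy(3)]
      by (cases x, cases y) (auto simp: R_alg_square_def algebra_morphism_def fun_simps)
    also have "\<dots> \<longleftrightarrow> P (F x) (F y) u v"
      using xy by (subst mor_iff_str) (auto simp: FV KF)
    finally show "R_alg_square C W x y u v \<longleftrightarrow> P (F x) (F y) u v" .
  qed (simp add: KF)
  then show ?thesis using KF by blast
qed

end

section \<open>Lifting operations\<close>

locale lifting_shape = category C + J: double_category J
  for C :: "('o, 'a) cat" (structure) and J :: "('p, 'g, 'w, 't) dbl_cat" +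
  fixes U :: "('p, 'g, 'w, 't, 'o, 'a, 'a, ('a, 'a) sq) dbl_ftr"
  assumes double_functor_U: "double_functor J (Sq_dbl C) U"
begin

lemma U_ver [simp]:
  assumes "j \<in> Arr (Ver J)"
  shows "DV U j \<in> Arr C" "DO U (Dom (Ver J) j) = Dom C (DV U j)" "DO U (Cod (Ver J) j) = Cod C (DV U j)"
  using double_functor_U assms
  by (auto simp: double_functor_def is_functor_def Sq_dbl_def dbl_over_def Let_def hom_def)

lemma U_vcomp [simp]:
  assumes "i \<in> Arr (Ver J)" "j \<in> Arr (Ver J)" "Cod (Ver J) i = Dom (Ver J) j"
  shows "DV U (j \<cdot>\<^bsub>Ver J\<^esub> i) = DV U j \<cdot> DV U i" "Cod C (DV U i) = Dom C (DV U j)"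
proof -
  show "DV U (j \<cdot>\<^bsub>Ver J\<^esub> i) = DV U j \<cdot> DV U i"
    using double_functor_U assms
    by (auto simp: double_functor_def is_functor_def Sq_dbl_def dbl_over_def Let_def hom_def)
  show "Cod C (DV U i) = Dom C (DV U j)" using assms U_ver by metis
qed

lemma Ver_comp [simp]:
  assumes "i \<in> Arr (Ver J)" "j \<in> Arr (Ver J)" "Cod (Ver J) i = Dom (Ver J) j"
  shows "j \<cdot>\<^bsub>Ver J\<^esub> i \<in> Arr (Ver J)"
  using category.Comp_in[OF J.categories(2) assms] by (simp add: hom_def)

lemma SqH_boundary [simp]:
  assumes "r \<in> Arr (SqH J)"
  shows "Dom (SqH J) r \<in> Arr (Ver J)" "Cod (SqH J) r \<in> Arr (Ver J)"
  using category.Dom_in[OF J.categories(3) assms] category.Cod_in[OF J.categories(3) assms]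
  by (simp_all add: J.sorts)

lemma U_square:
  assumes "r \<in> Arr (SqH J)"
  shows "Sq (DV U (Dom (SqH J) r)) (DV U (Cod (SqH J) r))
    (DH U (Dom (SqV J) r)) (DH U (Cod (SqV J) r)) \<in> csquares C"
proof -
  let ?D = "Sq_dbl C"
  have "is_functor (SqH J) (SqH ?D) \<lparr>FO = DV U, FA = DS U\<rparr>"
    "is_functor (SqV J) (SqV ?D) \<lparr>FO = DH U, FA = DS U\<rparr>"
    using double_functor_U by (auto simp: double_functor_def)
  then have "DS U r \<in> hom (SqH ?D) (DV U (Dom (SqH J) r)) (DV U (Cod (SqH J) r))"
    "DS U r \<in> hom (SqV ?D) (DH U (Dom (SqV J) r)) (DH U (Cod (SqV J) r))"
    using assms by (auto simp: is_functor_def J.sorts)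
  then show ?thesis
    by (cases "DS U r") (auto simp: Sq_dbl_def dbl_over_def Let_def hom_def)
qed

lemma U_square_arr [simp]:
  assumes "r \<in> Arr (SqH J)"
  shows "DH U (Dom (SqV J) r) \<in> Arr C" "DH U (Cod (SqV J) r) \<in> Arr C"
    "Dom C (DH U (Dom (SqV J) r)) = Dom C (DV U (Dom (SqH J) r))"
    "Cod C (DH U (Dom (SqV J) r)) = Dom C (DV U (Cod (SqH J) r))"
    "Dom C (DH U (Cod (SqV J) r)) = Cod C (DV U (Dom (SqH J) r))"
    "Cod C (DH U (Cod (SqV J) r)) = Cod C (DV U (Cod (SqH J) r))"
  and U_square_commutes:
    "DV U (Cod (SqH J) r) \<cdot> DH U (Dom (SqV J) r) = DH U (Cod (SqV J) r) \<cdot> DV U (Dom (SqH J) r)"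
  using U_square[OF assms] by (auto simp: csquares_iff)

abbreviation "problem f j u v \<equiv> lift_problem C J U f j u v"

lemma problem_iff: "problem f j u v \<longleftrightarrow>
    j \<in> Arr (Ver J) \<and> f \<in> Arr C \<and> u \<in> Arr C \<and> v \<in> Arr C \<and>
    Dom C u = Dom C (DV U j) \<and> Cod C u = Dom C f \<and> Dom C v = Cod C (DV U j) \<and> Cod C v = Cod C f \<and>
    f \<cdot> u = v \<cdot> DV U j"
  by (auto simp: lift_problem_def csquares_iff)

lemma problemD:
  assumes "problem f j u v"
  shows "j \<in> Arr (Ver J)" "f \<in> Arr C" "u \<in> Arr C" "v \<in> Arr C"
    "Dom C u = Dom C (DV U j)" "Cod C u = Dom C f" "Dom C v = Cod C (DV U j)" "Cod C v = Cod C f"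
    "f \<cdot> u = v \<cdot> DV U j"
  using assms by (auto simp: problem_iff)

lemma problem_square:
  assumes "r \<in> Arr (SqH J)" "problem f (Cod (SqH J) r) s t"
  shows "problem f (Dom (SqH J) r) (s \<cdot> DH U (Dom (SqV J) r)) (t \<cdot> DH U (Cod (SqV J) r))"
proof -
  note p = problemD[OF assms(2)]
  have "f \<cdot> s \<cdot> DH U (Dom (SqV J) r) = (t \<cdot> DH U (Cod (SqV J) r)) \<cdot> DV U (Dom (SqH J) r)"
    by (rule paste_horizontal[OF U_square_commutes p(9)]) (use assms p in simp_all)
  then show ?thesis using p assms by (simp add: problem_iff)
qed

lemma problem_map:
  assumes "problem f j u v" "Sq f g a b \<in> csquares C"
  shows "problem g j (a \<cdot> u) (b \<cdot> v)"
proof -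
  have "g \<cdot> a \<cdot> u = (b \<cdot> v) \<cdot> DV U j"
    by (rule paste_horizontal[of f]) (use assms in \<open>auto simp: problem_iff csquares_iff\<close>)
  then show ?thesis using assms by (simp add: problem_iff csquares_iff)
qed

text \<open>This is \<open>lifting_operation\<close> without the normalisation outside lifting
  problems, so that operations given by a formula, as for composites and quotients, can be verified
  before being restricted.\<close>

definition lifts :: "'a \<Rightarrow> ('w \<Rightarrow> 'a \<Rightarrow> 'a \<Rightarrow> 'a) \<Rightarrow> bool" where
  "lifts f \<phi> \<longleftrightarrow> f \<in> Arr C \<and>
     (\<forall>j u v. problem f j u v \<longrightarrow>
        \<phi> j u v \<in> Arr C \<and> Dom C (\<phi> j u v) = Cod C (DV U j) \<and> Cod C (\<phi> j u v) = Dom C f \<and>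
        \<phi> j u v \<cdot> DV U j = u \<and> f \<cdot> \<phi> j u v = v) \<and>
     (\<forall>r\<in>Arr (SqH J). \<forall>s t. problem f (Cod (SqH J) r) s t \<longrightarrow>
        \<phi> (Cod (SqH J) r) s t \<cdot> DH U (Cod (SqV J) r) =
        \<phi> (Dom (SqH J) r) (s \<cdot> DH U (Dom (SqV J) r)) (t \<cdot> DH U (Cod (SqV J) r))) \<and>
     (\<forall>i\<in>Arr (Ver J). \<forall>j\<in>Arr (Ver J). Cod (Ver J) i = Dom (Ver J) j \<longrightarrow>
        (\<forall>s t. problem f (j \<cdot>\<^bsub>Ver J\<^esub> i) s t \<longrightarrow>
           \<phi> (j \<cdot>\<^bsub>Ver J\<^esub> i) s t = \<phi> j (\<phi> i s (t \<cdot> DV U j)) t))"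

lemma lifting_operation_iff:
  "f \<in> Arr C \<and> lifting_operation C J U f \<phi> \<longleftrightarrow> \<phi> = lift_restrict C J U f \<phi> \<and> lifts f \<phi>"
  unfolding lifting_operation_def lifts_def hom_def
  by (auto simp: problem_iff)

lemma lifts_problem:
  assumes "lifts f \<phi>" "problem f j u v"
  shows "\<phi> j u v \<in> Arr C" "Dom C (\<phi> j u v) = Cod C (DV U j)" "Cod C (\<phi> j u v) = Dom C f"
    "\<phi> j u v \<cdot> DV U j = u" "f \<cdot> \<phi> j u v = v"
  using assms by (auto simp: lifts_def)

lemma lifts_horizontal:
  "lifts f \<phi> \<Longrightarrow> r \<in> Arr (SqH J) \<Longrightarrow> problem f (Cod (SqH J) r) s t \<Longrightarrow>
    \<phi> (Cod (SqH J) r) s t \<cdot> DH U (Cod (SqV J) r) =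
    \<phi> (Dom (SqH J) r) (s \<cdot> DH U (Dom (SqV J) r)) (t \<cdot> DH U (Cod (SqV J) r))"
  by (auto simp: lifts_def)

lemma lifts_vertical:
  "lifts f \<phi> \<Longrightarrow> i \<in> Arr (Ver J) \<Longrightarrow> j \<in> Arr (Ver J) \<Longrightarrow> Cod (Ver J) i = Dom (Ver J) j \<Longrightarrow>
    problem f (j \<cdot>\<^bsub>Ver J\<^esub> i) s t \<Longrightarrow> \<phi> (j \<cdot>\<^bsub>Ver J\<^esub> i) s t = \<phi> j (\<phi> i s (t \<cdot> DV U j)) t"
  by (auto simp: lifts_def)

lemma problem_vertical_upper:
  assumes "i \<in> Arr (Ver J)" "j \<in> Arr (Ver J)" "Cod (Ver J) i = Dom (Ver J) j"
    "problem f (j \<cdot>\<^bsub>Ver J\<^esub> i) s t"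
  shows "problem f i s (t \<cdot> DV U j)"
  using assms by (auto simp: problem_iff Comp_assoc)

lemma problem_vertical_lower:
  assumes "lifts f \<phi>" "i \<in> Arr (Ver J)" "j \<in> Arr (Ver J)" "Cod (Ver J) i = Dom (Ver J) j"
    "problem f (j \<cdot>\<^bsub>Ver J\<^esub> i) s t"
  shows "problem f j (\<phi> i s (t \<cdot> DV U j)) t"
  using lifts_problem[OF assms(1) problem_vertical_upper[OF assms(2-5)]] assms(2-5)
  by (auto simp: problem_iff)

text \<open>Agreement on lifting problems is enough because every argument occurring in the
  compatibility conditions, nested ones included, is again a lifting problem.\<close>

lemma lifts_cong:
  assumes l: "lifts f \<phi>" and eq: "\<And>j u v. problem f j u v \<Longrightarrow> \<phi> j u v = \<psi> j u v"
  shows "lifts f \<psi>"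
  unfolding lifts_def
proof (intro conjI allI ballI impI)
  show "f \<in> Arr C" using l by (simp add: lifts_def)
next
  fix r s t assume "r \<in> Arr (SqH J)" "problem f (Cod (SqH J) r) s t"
  then show "\<psi> (Cod (SqH J) r) s t \<cdot> DH U (Cod (SqV J) r) =
       \<psi> (Dom (SqH J) r) (s \<cdot> DH U (Dom (SqV J) r)) (t \<cdot> DH U (Cod (SqV J) r))"
    using lifts_horizontal[OF l] eq problem_square by metis
next
  fix i j s t
  assume *: "i \<in> Arr (Ver J)" "j \<in> Arr (Ver J)" "Cod (Ver J) i = Dom (Ver J) j"
    "problem f (j \<cdot>\<^bsub>Ver J\<^esub> i) s t"
  show "\<psi> (j \<cdot>\<^bsub>Ver J\<^esub> i) s t = \<psi> j (\<psi> i s (t \<cdot> DV U j)) t"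
    using lifts_vertical[OF l *] eq[OF *(4)] eq[OF problem_vertical_upper[OF *]]
      eq[OF problem_vertical_lower[OF l *]] by simp
qed (use lifts_problem[OF l] eq in auto)

definition liftV :: "('a \<times> ('w \<Rightarrow> 'a \<Rightarrow> 'a \<Rightarrow> 'a)) set" where
  "liftV = {(f, \<phi>). f \<in> Arr C \<and> lifting_operation C J U f \<phi>}"

lemma liftV_iff: "(f, \<phi>) \<in> liftV \<longleftrightarrow> \<phi> = lift_restrict C J U f \<phi> \<and> lifts f \<phi>"
  unfolding liftV_def using lifting_operation_iff by simp

lemma liftV_lifts: "(f, \<phi>) \<in> liftV \<Longrightarrow> lifts f \<phi>"
  by (simp add: liftV_iff)

lemma restrict_problem [simp]: "problem f j u v \<Longrightarrow> lift_restrict C J U f \<phi> j u v = \<phi> j u v"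
  by (simp add: lift_restrict_def)

lemma restrict_liftV: "lifts f \<phi> \<Longrightarrow> (f, lift_restrict C J U f \<phi>) \<in> liftV"
  unfolding liftV_iff by (auto intro: lifts_cong simp: lift_restrict_def fun_eq_iff)

lemma liftV_eqI:
  assumes "(f, \<phi>) \<in> liftV" "(f, \<psi>) \<in> liftV" "\<And>j u v. problem f j u v \<Longrightarrow> \<phi> j u v = \<psi> j u v"
  shows "\<phi> = \<psi>"
proof -
  have "\<phi> j u v = \<psi> j u v" for j u v
    using assms unfolding liftV_iff by (metis lift_restrict_def)
  then show ?thesis by (intro ext)
qed

section \<open>Vertical composition of lifting operations\<close>

lemma problem_comp:
  assumes "f \<in> Arr C" "g \<in> Arr C" "Cod C f = Dom C g" "problem (g \<cdot> f) j u v"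
  shows "problem g j (f \<cdot> u) v"
  using assms by (auto simp: problem_iff Comp_assoc)

lemma problem_comp_upper:
  assumes "f \<in> Arr C" "g \<in> Arr C" "Cod C f = Dom C g" "problem (g \<cdot> f) j u v" "lifts g \<psi>"
  shows "problem f j u (\<psi> j (f \<cdot> u) v)"
  using lifts_problem[OF assms(5) problem_comp[OF assms(1-4)]] assms(1-4)
  by (auto simp: problem_iff)

lemma lifts_id: "A \<in> Obj C \<Longrightarrow> lifts (Idt C A) (\<lambda>j u v. v)"
  unfolding lifts_def using problemD(4-9)[of "Idt C A"] problemD(3,6)[of "Idt C A"] by simp

lemma lifts_comp:
  assumes f: "lifts f \<phi>" and g: "lifts g \<psi>" and fg: "Cod C f = Dom C g"
  shows "lifts (g \<cdot> f) (\<lambda>j u v. \<phi> j u (\<psi> j (f \<cdot> u) v))"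
proof -
  have fA: "f \<in> Arr C" "g \<in> Arr C" using f g by (auto simp: lifts_def)
  note a = fA fg
  show ?thesis
    unfolding lifts_def
  proof (intro conjI allI ballI impI)
    show "g \<cdot> f \<in> Arr C" using a by simp
  next
    fix j u v assume p: "problem (g \<cdot> f) j u v"
    note q = problem_comp[OF a p] and q' = problem_comp_upper[OF a p g]
    note l = lifts_problem[OF g q] lifts_problem[OF f q']
    show "\<phi> j u (\<psi> j (f \<cdot> u) v) \<in> Arr C" "Dom C (\<phi> j u (\<psi> j (f \<cdot> u) v)) = Cod C (DV U j)"
      "Cod C (\<phi> j u (\<psi> j (f \<cdot> u) v)) = Dom C (g \<cdot> f)"
      "\<phi> j u (\<psi> j (f \<cdot> u) v) \<cdot> DV U j = u" using l a by auto
    show "(g \<cdot> f) \<cdot> \<phi> j u (\<psi> j (f \<cdot> u) v) = v" using l a by (simp add: Comp_assoc)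
  next
    fix r s t assume r: "r \<in> Arr (SqH J)" and p: "problem (g \<cdot> f) (Cod (SqH J) r) s t"
    note q = problem_comp[OF a p] and q' = problem_comp_upper[OF a p g]
    show "\<phi> (Cod (SqH J) r) s (\<psi> (Cod (SqH J) r) (f \<cdot> s) t) \<cdot> DH U (Cod (SqV J) r) =
       \<phi> (Dom (SqH J) r) (s \<cdot> DH U (Dom (SqV J) r))
        (\<psi> (Dom (SqH J) r) (f \<cdot> s \<cdot> DH U (Dom (SqV J) r)) (t \<cdot> DH U (Cod (SqV J) r)))"
      using lifts_horizontal[OF f r q'] lifts_horizontal[OF g r q] a r problemD[OF p]
      by (simp add: Comp_assoc)
  next
    fix i j s t
    assume *: "i \<in> Arr (Ver J)" "j \<in> Arr (Ver J)" "Cod (Ver J) i = Dom (Ver J) j"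
      and p: "problem (g \<cdot> f) (j \<cdot>\<^bsub>Ver J\<^esub> i) s t"
    note q = problem_comp[OF a p] and q' = problem_comp_upper[OF a p g]
    note pi = problem_vertical_upper[OF * p]
    note qi = problem_comp[OF a pi] and qi' = problem_comp_upper[OF a pi g]
    have "\<psi> (j \<cdot>\<^bsub>Ver J\<^esub> i) (f \<cdot> s) t = \<psi> j (\<psi> i (f \<cdot> s) (t \<cdot> DV U j)) t"
      by (rule lifts_vertical[OF g * q])
    \<comment> \<open>Restricted along \<open>DV U j\<close>, the lift for the composite arrow
      against \<open>g\<close> is the lift for \<open>i\<close>. Hence the bottom of the inner
      problem against \<open>f\<close> is the one prescribed by the composite operation.\<close>
    moreover have "\<psi> j (\<psi> i (f \<cdot> s) (t \<cdot> DV U j)) t \<cdot> DV U j = \<psi> i (f \<cdot> s) (t \<cdot> DV U j)"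
      by (rule lifts_problem(4)[OF g problem_vertical_lower[OF g * q]])
    ultimately show "\<phi> (j \<cdot>\<^bsub>Ver J\<^esub> i) s (\<psi> (j \<cdot>\<^bsub>Ver J\<^esub> i) (f \<cdot> s) t) =
       \<phi> j (\<phi> i s (\<psi> i (f \<cdot> s) (t \<cdot> DV U j)))
        (\<psi> j (f \<cdot> \<phi> i s (\<psi> i (f \<cdot> s) (t \<cdot> DV U j))) t)"
      using lifts_vertical[OF f * q'] lifts_problem[OF f qi'] by simp
  qed
qed

lemma lift_vcomp_V:
  assumes "x \<in> liftV" "y \<in> liftV" "Cod C (fst x) = Dom C (fst y)"
  shows "lift_comp C J U y x \<in> liftV"
  using assms restrict_liftV[OF lifts_comp[OF liftV_lifts liftV_lifts, of "fst x" "snd x" "fst y" "snd y"]]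
  by (auto simp: lift_comp_def split: prod.splits)

lemma liftV_arr: "x \<in> liftV \<Longrightarrow> fst x \<in> Arr C"
  by (auto simp: liftV_def)

lemma snd_lift_comp: "problem (fst y \<cdot> fst x) j u v \<Longrightarrow>
    snd (lift_comp C J U y x) j u v = snd x j u (snd y j (fst x \<cdot> u) v)"
  by (auto simp: lift_comp_def split: prod.splits)

lemma fst_lift_comp: "fst (lift_comp C J U y x) = fst y \<cdot> fst x"
  by (auto simp: lift_comp_def split: prod.splits)

lemma lift_id_V: "A \<in> Obj C \<Longrightarrow> lift_id C J U A \<in> liftV"
  by (auto simp: lift_id_def intro: restrict_liftV lifts_id)

lemma fst_lift_id: "fst (lift_id C J U A) = Idt C A"
  by (simp add: lift_id_def)

lemma snd_lift_id: "problem (Idt C A) j u v \<Longrightarrow> snd (lift_id C J U A) j u v = v"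
  by (simp add: lift_id_def)

lemma liftV_eqI':
  assumes "x \<in> liftV" "y \<in> liftV" "fst x = fst y"
    "\<And>j u v. problem (fst x) j u v \<Longrightarrow> snd x j u v = snd y j u v"
  shows "x = y"
  using assms liftV_eqI[of "fst x" "snd x" "snd y"] by (metis prod.collapse)

lemma liftV_lifts': "x \<in> liftV \<Longrightarrow> lifts (fst x) (snd x)"
  by (metis liftV_lifts prod.collapse)

lemma lift_square_iff':
  "lift_square C J U x y a b \<longleftrightarrow>
    (\<forall>j u v. problem (fst x) j u v \<longrightarrow> a \<cdot> snd x j u v = snd y j (a \<cdot> u) (b \<cdot> v))"
  by (simp add: lift_square_def split: prod.splits)

lemma vertical_structure_lift:
  "vertical_structure C liftV fst (lift_id C J U) (lift_comp C J U) (lift_square C J U)"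
proof
  fix x A assume x: "x \<in> liftV" "Cod C (fst x) = A"
  have id: "lift_id C J U A \<in> liftV" using x(2) Cod_obj[OF liftV_arr[OF x(1)]] by (intro lift_id_V) simp
  show "lift_comp C J U (lift_id C J U A) x = x"
  proof (rule liftV_eqI')
    show "lift_comp C J U (lift_id C J U A) x \<in> liftV"
      by (rule lift_vcomp_V[OF x(1) id]) (use x liftV_arr[OF x(1)] in \<open>auto simp: fst_lift_id\<close>)
    show *: "fst (lift_comp C J U (lift_id C J U A) x) = fst x"
      using x liftV_arr[OF x(1)] by (simp add: fst_lift_id fst_lift_comp)
    fix j u v assume "problem (fst (lift_comp C J U (lift_id C J U A) x)) j u v"
    then have p: "problem (fst (lift_id C J U A) \<cdot> fst x) j u v" by (simp add: fst_lift_comp)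
    have "problem (fst (lift_id C J U A)) j (fst x \<cdot> u) v"
      by (rule problem_comp[OF _ _ _ p]) (use x liftV_arr[OF x(1)] in \<open>auto simp: fst_lift_id\<close>)
    then show "snd (lift_comp C J U (lift_id C J U A) x) j u v = snd x j u v"
      using p by (simp add: snd_lift_comp snd_lift_id fst_lift_id)
  qed (rule x)
next
  fix x A assume x: "x \<in> liftV" "Dom C (fst x) = A"
  have id: "lift_id C J U A \<in> liftV" using x(2) Dom_obj[OF liftV_arr[OF x(1)]] by (intro lift_id_V) simp
  show "lift_comp C J U x (lift_id C J U A) = x"
  proof (rule liftV_eqI')
    show "lift_comp C J U x (lift_id C J U A) \<in> liftV"
      by (rule lift_vcomp_V[OF id x(1)]) (use x liftV_arr[OF x(1)] in \<open>auto simp: fst_lift_id\<close>)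
    show *: "fst (lift_comp C J U x (lift_id C J U A)) = fst x"
      using x liftV_arr[OF x(1)] by (simp add: fst_lift_id fst_lift_comp)
    fix j u v assume "problem (fst (lift_comp C J U x (lift_id C J U A))) j u v"
    then have p: "problem (fst x \<cdot> fst (lift_id C J U A)) j u v" by (simp add: fst_lift_comp)
    then have p': "problem (fst x) j u v"
      using * by (simp add: fst_lift_comp)
    note l = lifts_problem[OF liftV_lifts'[OF x(1)] p']
    have "problem (Idt C A) j u (snd x j u v)"
      using l problemD[OF p'] x by (auto simp: problem_iff liftV_arr)
    then show "snd (lift_comp C J U x (lift_id C J U A)) j u v = snd x j u v"
      using p problemD[OF p'] x by (simp add: snd_lift_comp snd_lift_id fst_lift_id)
  qed (rule x)
next
  fix x y z assume *: "x \<in> liftV" "y \<in> liftV" "z \<in> liftV"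
    and c: "Cod C (fst x) = Dom C (fst y)" "Cod C (fst y) = Dom C (fst z)"
  note a = *[THEN liftV_arr]
  show "lift_comp C J U (lift_comp C J U z y) x = lift_comp C J U z (lift_comp C J U y x)"
  proof (rule liftV_eqI')
    show "lift_comp C J U (lift_comp C J U z y) x \<in> liftV"
      "lift_comp C J U z (lift_comp C J U y x) \<in> liftV"
      by (intro lift_vcomp_V *; simp add: fst_lift_comp a c)+
    show "fst (lift_comp C J U (lift_comp C J U z y) x) =
      fst (lift_comp C J U z (lift_comp C J U y x))"
      using a c by (simp add: fst_lift_comp Comp_assoc)
    fix j u v
    assume "problem (fst (lift_comp C J U (lift_comp C J U z y) x)) j u v"
    then have p: "problem ((fst z \<cdot> fst y) \<cdot> fst x) j u v"
      "problem (fst z \<cdot> (fst y \<cdot> fst x)) j u v"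
      using a c by (simp_all add: fst_lift_comp Comp_assoc)
    have p2: "problem (fst z \<cdot> fst y) j (fst x \<cdot> u) v"
      by (rule problem_comp[OF _ _ _ p(1)]) (use a c in auto)
    have p3: "problem (fst y \<cdot> fst x) j u (snd z j ((fst y \<cdot> fst x) \<cdot> u) v)"
      by (rule problem_comp_upper[OF _ _ _ p(2)]) (use a c * liftV_lifts' in auto)
    show "snd (lift_comp C J U (lift_comp C J U z y) x) j u v =
       snd (lift_comp C J U z (lift_comp C J U y x)) j u v"
      using p p2 p3 a c problemD[OF p(1)] by (simp add: snd_lift_comp fst_lift_comp Comp_assoc)
  qed
next
  fix x assume x: "x \<in> liftV"
  show "lift_square C J U x x (Idt C (Dom C (fst x))) (Idt C (Cod C (fst x)))"
    unfolding lift_square_iff'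
    using lifts_problem[OF liftV_lifts'[OF x]] by (auto simp: problem_iff)
next
  fix x y z u v u' v'
  assume *: "x \<in> liftV" "y \<in> liftV" "z \<in> liftV" "Sq (fst x) (fst y) u v \<in> csquares C"
    "Sq (fst y) (fst z) u' v' \<in> csquares C" "lift_square C J U x y u v" "lift_square C J U y z u' v'"
  show "lift_square C J U x z (u' \<cdot> u) (v' \<cdot> v)"
    unfolding lift_square_iff'
  proof (intro allI impI)
    fix j s t assume p: "problem (fst x) j s t"
    have "u' \<cdot> u \<cdot> snd x j s t = snd z j (u' \<cdot> u \<cdot> s) (v' \<cdot> v \<cdot> t)"
      using *(6,7) p problem_map[OF p *(4)] by (simp add: lift_square_iff')
    then show "(u' \<cdot> u) \<cdot> snd x j s t = snd z j ((u' \<cdot> u) \<cdot> s) ((v' \<cdot> v) \<cdot> t)"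
      using * p lifts_problem[OF liftV_lifts'[OF *(1)] p]
      by (simp add: csquares_iff problem_iff Comp_assoc)
  qed
next
  fix u assume u: "u \<in> Arr C"
  show "lift_square C J U (lift_id C J U (Dom C u)) (lift_id C J U (Cod C u)) u u"
    unfolding lift_square_iff'
  proof (intro allI impI)
    fix j s t assume "problem (fst (lift_id C J U (Dom C u))) j s t"
    then have p: "problem (Idt C (Dom C u)) j s t" by (simp add: fst_lift_id)
    have "problem (Idt C (Cod C u)) j (u \<cdot> s) (u \<cdot> t)"
      by (rule problem_map[OF p]) (use u in \<open>simp add: csquares_iff\<close>)
    then show "u \<cdot> snd (lift_id C J U (Dom C u)) j s t = snd (lift_id C J U (Cod C u)) j (u \<cdot> s) (u \<cdot> t)"
      using p by (simp add: snd_lift_id)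
  qed
next
  fix x y x' y' u v w
  assume *: "x \<in> liftV" "y \<in> liftV" "x' \<in> liftV" "y' \<in> liftV"
    "Cod C (fst x) = Dom C (fst y)" "Cod C (fst x') = Dom C (fst y')"
    "Sq (fst x) (fst x') u v \<in> csquares C" "Sq (fst y) (fst y') v w \<in> csquares C"
    "lift_square C J U x x' u v" "lift_square C J U y y' v w"
  note a = *(1-4)[THEN liftV_arr]
  have sq: "Sq (fst y \<cdot> fst x) (fst y' \<cdot> fst x') u w \<in> csquares C"
    using *(5-8) by (simp add: csquares_iff paste_horizontal[of v, symmetric])
  show "lift_square C J U (lift_comp C J U y x) (lift_comp C J U y' x') u w"
    unfolding lift_square_iff'
  proof (intro allI impI)
    fix j s t assume "problem (fst (lift_comp C J U y x)) j s t"
    then have p: "problem (fst y \<cdot> fst x) j s t" by (simp add: fst_lift_comp)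
    note q = problem_comp[OF a(1,2) *(5) p]
      and q' = problem_comp_upper[OF a(1,2) *(5) p liftV_lifts'[OF *(2)]]
    have eq: "v \<cdot> fst x \<cdot> s = fst x' \<cdot> u \<cdot> s"
    proof -
      have c: "u \<in> Arr C" "v \<in> Arr C" "Dom C v = Cod C (fst x)" "Dom C u = Dom C (fst x)"
        "Cod C u = Dom C (fst x')" "fst x' \<cdot> u = v \<cdot> fst x"
        using *(7) by (auto simp: csquares_iff)
      have "Cod C s = Dom C (fst x)" "s \<in> Arr C" using problemD[OF p] a *(5) by auto
      with Comp_assoc[of s u "fst x'"] Comp_assoc[of s "fst x" v] c(1-5) a show ?thesis
        unfolding c(6) by simp
    qed
    have "u \<cdot> snd x j s (snd y j (fst x \<cdot> s) t) =
        snd x' j (u \<cdot> s) (snd y' j (fst x' \<cdot> u \<cdot> s) (w \<cdot> t))"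
      using *(9,10) q q' eq by (simp add: lift_square_iff')
    then show "u \<cdot> snd (lift_comp C J U y x) j s t =
       snd (lift_comp C J U y' x') j (u \<cdot> s) (w \<cdot> t)"
      using p problem_map[OF p sq] by (simp add: snd_lift_comp)
  qed
qed (auto simp: liftV_arr lift_id_V fst_lift_id fst_lift_comp lift_vcomp_V)

sublocale lift: vertical_structure C liftV fst "lift_id C J U" "lift_comp C J U" "lift_square C J U"
  by (rule vertical_structure_lift)

section \<open>Rigidity and descent of lifting operations\<close>

lemma lift_square_und:
  assumes "x \<in> liftV"
  shows "lift_square C J U x (lift_id C J U (Cod C (fst x))) (fst x) (Idt C (Cod C (fst x)))"
  unfolding lift_square_iff'
proof (intro allI impI)
  fix j u v assume p: "problem (fst x) j u v"
  have "problem (Idt C (Cod C (fst x))) j (fst x \<cdot> u) (Idt C (Cod C (fst x)) \<cdot> v)"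
    by (rule problem_map[OF p]) (use assms in \<open>simp add: csquares_iff\<close>)
  then show "fst x \<cdot> snd x j u v =
    snd (lift_id C J U (Cod C (fst x))) j (fst x \<cdot> u) (Idt C (Cod C (fst x)) \<cdot> v)"
    using lifts_problem[OF liftV_lifts'[OF assms] p] problemD[OF p] by (simp add: snd_lift_id)
qed

lemma lift_discrete:
  assumes "x \<in> liftV" "y \<in> liftV" "fst x = fst y"
    "lift_square C J U x y (Idt C (Dom C (fst x))) (Idt C (Cod C (fst x)))"
  shows "x = y"
proof (rule liftV_eqI'[OF assms(1-3)])
  fix j u v assume p: "problem (fst x) j u v"
  then show "snd x j u v = snd y j u v"
    using assms(4) lifts_problem[OF liftV_lifts'[OF assms(1)] p] problemD[OF p]
    unfolding lift_square_iff' by force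
qed

text \<open>Lifts in \<open>y\<close> are computed in \<open>x\<close>: the section \<open>s\<close>
  moves a problem against \<open>y\<close> to one against \<open>x\<close>, and the morphism
  \<open>p\<close> carries the resulting lift back.\<close>

lemma lift_split:
  assumes m: "lift.mor x y p (Idt C (Cod C (fst y)))" and s: "s \<in> Arr C" "Cod C s = Dom C p"
    "p \<cdot> s = Idt C (Cod C p)" and m': "lift.mor x z (u \<cdot> p) v" and u: "u \<in> Arr C" "Dom C u = Cod C p"
  shows "lift.mor y z u v"
proof -
  note a = lift.mor_square[OF m] and b = lift.mor_square[OF m']
  have yA: "fst y \<in> Arr C" "fst x \<in> Arr C" "fst z \<in> Arr C" using a b by auto
  have x: "fst y \<cdot> p = fst x" "Cod C (fst x) = Cod C (fst y)" using a yA by auto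
  have Ds: "Dom C s = Dom C (fst y)"
    using arg_cong[OF s(3), of "Dom C"] s(1,2) a(3,6) yA(1) by simp
  have sec: "fst x \<cdot> s = fst y"
    using a s yA Ds x(1) Comp_assoc[of s p "fst y"] by simp
  have "(fst z \<cdot> (u \<cdot> p)) \<cdot> s = (v \<cdot> fst x) \<cdot> s" using b by simp
  moreover have "(fst z \<cdot> (u \<cdot> p)) \<cdot> s = fst z \<cdot> u"
    using a(1-8) b(1-8) s u yA Ds by (simp add: Comp_assoc)
  moreover have "(v \<cdot> fst x) \<cdot> s = v \<cdot> fst y"
    using a b s yA sec by (simp add: Comp_assoc)
  ultimately have sq: "fst z \<cdot> u = v \<cdot> fst y" by simp
  have "lift_square C J U y z u v"
    unfolding lift_square_iff'
  proof (intro allI impI)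
    fix j i t assume p: "problem (fst y) j i t"
    note P = problemD[OF p]
    have q: "problem (fst x) j (s \<cdot> i) t"
      using P s a yA x Ds Comp_reassoc[OF _ _ _ _ _ sec, of i] by (simp add: problem_iff)
    note l = lifts_problem[OF liftV_lifts'[OF a(1)] q]
    have psi: "p \<cdot> s \<cdot> i = i" using P s a Ds Comp_reassoc[OF _ _ _ _ _ s(3), of i] by simp
    have 1: "p \<cdot> snd x j (s \<cdot> i) t = snd y j i t"
      using m q P psi by (simp add: lift.mor_def lift_square_iff')
    have "u \<cdot> snd y j i t = (u \<cdot> p) \<cdot> snd x j (s \<cdot> i) t"
      using l a u by (simp add: Comp_assoc 1[symmetric])
    also have "\<dots> = snd z j ((u \<cdot> p) \<cdot> s \<cdot> i) (v \<cdot> t)"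
      using m' q by (simp add: lift.mor_def lift_square_iff')
    also have "(u \<cdot> p) \<cdot> s \<cdot> i = u \<cdot> i"
      using P s a u Ds psi by (simp add: Comp_assoc)
    finally show "u \<cdot> snd y j i t = snd z j (u \<cdot> i) (v \<cdot> t)" .
  qed
  then show ?thesis using a b u s sq x yA by (simp add: lift.mor_iff)
qed

text \<open>The lift of \<open>(u, v)\<close> against \<open>f\<close> has to be the image under
  \<open>p\<close> of the lift of \<open>(s u, v)\<close> in \<open>z\<close>. That this formula
  satisfies vertical compatibility, and that \<open>p\<close> becomes a morphism, both require that
  replacing a top map \<open>w\<close> by \<open>s p w\<close> does not change the image of the lift
  under \<open>p\<close>.\<close>

lemma lift_split_coequaliser:
  assumes k: "lift.mor z' z k (Idt C (Cod C f))" and l: "lift.mor z' z l (Idt C (Cod C f))"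
    and arr: "f \<in> Arr C" "p \<in> Arr C" "s \<in> Arr C" "t \<in> Arr C"
      "Dom C p = Dom C (fst z)" "Cod C p = Dom C f" "Dom C s = Dom C f" "Cod C s = Dom C p"
      "Dom C t = Dom C (fst z)" "Cod C t = Dom C (fst z')"
    and eq: "p \<cdot> k = p \<cdot> l" "k \<cdot> t = Idt C (Dom C (fst z))" "l \<cdot> t = s \<cdot> p"
      "p \<cdot> s = Idt C (Dom C f)" "f \<cdot> p = fst z"
  shows "\<exists>x\<in>liftV. fst x = f \<and> lift.mor z x p (Idt C (Cod C f))"
proof -
  note a = lift.mor_square[OF k] and b = lift.mor_square[OF l]
  have zA: "fst z \<in> Arr C" "fst z' \<in> Arr C" using a by auto
  have Cz: "Cod C (fst z) = Cod C f" using arg_cong[OF eq(5), of "Cod C"] arr by simp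
  have Cz': "Cod C (fst z') = Cod C f" using a(7) arr by simp
  have zk: "fst z \<cdot> k = fst z'" using a zA arr Cz' by simp
  note lz = liftV_lifts'[OF a(2)] and lz' = liftV_lifts'[OF a(1)]
  have zt: "fst z' \<cdot> t = fst z"
    using zk arr a zA eq(2) Comp_assoc[of t k "fst z"] by simp
  have zs: "fst z \<cdot> s = f"
    using arr eq(4,5) Comp_assoc[of s p f] by simp
  \<comment> \<open>The map \<open>t\<close> moves the problem to \<open>z'\<close>; from there
    \<open>k\<close> returns the top \<open>w\<close> and \<open>l\<close> returns
    \<open>s p w\<close>. Both preserve lifts, and their composites with \<open>p\<close> are
    equal.\<close>
  have key: "p \<cdot> snd z j (s \<cdot> p \<cdot> w) v = p \<cdot> snd z j w v" if q: "problem (fst z) j w v" for j w v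
  proof -
    note Q = problemD[OF q]
    have q': "problem (fst z') j (t \<cdot> w) v"
      using Q arr zA Cz Cz' Comp_reassoc[OF _ _ _ _ _ zt, of w] by (simp add: problem_iff)
    note L = lifts_problem[OF lz' q']
    have "k \<cdot> t \<cdot> w = w" "l \<cdot> t \<cdot> w = s \<cdot> p \<cdot> w"
      using Comp_reassoc[OF _ _ _ _ _ eq(2), of w] Comp_reassoc[OF _ _ _ _ _ eq(3), of w]
        Q arr a b zA by (simp_all add: Comp_assoc)
    then have "k \<cdot> snd z' j (t \<cdot> w) v = snd z j w v" "l \<cdot> snd z' j (t \<cdot> w) v = snd z j (s \<cdot> p \<cdot> w) v"
      using k l q' Q Cz by (simp_all add: lift.mor_def lift_square_iff')
    moreover have "p \<cdot> k \<cdot> snd z' j (t \<cdot> w) v = p \<cdot> l \<cdot> snd z' j (t \<cdot> w) v"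
      using L a b arr Comp_assoc[of "snd z' j (t \<cdot> w) v" k p]
        Comp_assoc[of "snd z' j (t \<cdot> w) v" l p] eq(1) by simp
    ultimately show ?thesis by simp
  qed
  define \<psi> where "\<psi> j u v = p \<cdot> snd z j (s \<cdot> u) v" for j u v
  have pr: "problem (fst z) j (s \<cdot> u) v" if q: "problem f j u v" for j u v
    using problemD[OF q] arr zA Cz Comp_reassoc[OF _ _ _ _ _ zs, of u] by (simp add: problem_iff)
  have "lifts f \<psi>"
    unfolding lifts_def
  proof (intro conjI allI ballI impI)
    fix j u v assume q: "problem f j u v"
    note Q = problemD[OF q] and L = lifts_problem[OF lz pr[OF q]]
    show "\<psi> j u v \<in> Arr C" "Dom C (\<psi> j u v) = Cod C (DV U j)" "Cod C (\<psi> j u v) = Dom C f"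
      unfolding \<psi>_def using L arr by auto
    have "\<psi> j u v \<cdot> DV U j = p \<cdot> s \<cdot> u"
      unfolding \<psi>_def using L arr Q by (simp add: Comp_assoc)
    then show "\<psi> j u v \<cdot> DV U j = u"
      using Comp_reassoc[OF _ _ _ _ _ eq(4), of u] Q arr by simp
    show "f \<cdot> \<psi> j u v = v"
      unfolding \<psi>_def using L arr Comp_reassoc[OF _ _ _ _ _ eq(5), of "snd z j (s \<cdot> u) v"] by simp
  next
    fix r u v assume r: "r \<in> Arr (SqH J)" and q: "problem f (Cod (SqH J) r) u v"
    note Q = problemD[OF q] and L = lifts_problem[OF lz pr[OF q]]
    show "\<psi> (Cod (SqH J) r) u v \<cdot> DH U (Cod (SqV J) r) =
       \<psi> (Dom (SqH J) r) (u \<cdot> DH U (Dom (SqV J) r)) (v \<cdot> DH U (Cod (SqV J) r))"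
      unfolding \<psi>_def using lifts_horizontal[OF lz r pr[OF q]] Q L arr r
      by (simp add: Comp_assoc)
  next
    fix i j u v
    assume *: "i \<in> Arr (Ver J)" "j \<in> Arr (Ver J)" "Cod (Ver J) i = Dom (Ver J) j"
      and q: "problem f (j \<cdot>\<^bsub>Ver J\<^esub> i) u v"
    note pq = pr[OF q]
    show "\<psi> (j \<cdot>\<^bsub>Ver J\<^esub> i) u v = \<psi> j (\<psi> i u (v \<cdot> DV U j)) v"
      unfolding \<psi>_def lifts_vertical[OF lz * pq]
      by (rule key[symmetric], rule problem_vertical_lower[OF lz * pq])
  qed (rule arr)
  then have V: "(f, lift_restrict C J U f \<psi>) \<in> liftV" by (rule restrict_liftV)
  have sq: "Sq (fst z) f p (Idt C (Cod C f)) \<in> csquares C"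
    using arr zA Cz eq(5) by (simp add: csquares_iff)
  have "lift_square C J U z (f, lift_restrict C J U f \<psi>) p (Idt C (Cod C f))"
    unfolding lift_square_iff'
  proof (intro allI impI)
    fix j w v assume q: "problem (fst z) j w v"
    note Q = problemD[OF q]
    have "p \<cdot> snd z j w v = \<psi> j (p \<cdot> w) v" using key[OF q] by (simp add: \<psi>_def)
    then show "p \<cdot> snd z j w v =
      snd (f, lift_restrict C J U f \<psi>) j (p \<cdot> w) (Idt C (Cod C f) \<cdot> v)"
      using problem_map[OF q sq] Q Cz by simp
  qed
  then have "lift.mor z (f, lift_restrict C J U f \<psi>) p (Idt C (Cod C f))"
    using V a(2) sq by (simp add: lift.mor_def)
  then show ?thesis using V by force
qed

end

section \<open>Small colimits and presentations\<close>

lemma small_subset: "small \<kappa> X \<Longrightarrow> Y \<subseteq> X \<Longrightarrow> small \<kappa> Y"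
  unfolding small_def using card_of_mono1 ordLeq_ordLess_trans by blast

lemma small_image: "small \<kappa> X \<Longrightarrow> small \<kappa> (h ` X)"
  unfolding small_def using card_of_image ordLeq_ordLess_trans by blast

locale universe =
  fixes \<kappa> :: "'k rel"
  assumes inaccessible: "inaccessible \<kappa>"
begin

lemma Card_order: "Card_order \<kappa>" and natLeq_less: "natLeq <o \<kappa>" and regular: "regularCard \<kappa>"
  using inaccessible by (auto simp: inaccessible_def)

lemma Cinfinite: "Cinfinite \<kappa>"
  using natLeq_less Card_order natLeq_Cinfinite
  by (metis cinfinite_mono ordLess_imp_ordLeq)

lemma infinite_Field: "\<not> finite (Field \<kappa>)"
  using Cinfinite by (simp add: cinfinite_def)

lemma small_finite: "finite X \<Longrightarrow> small \<kappa> X"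
  unfolding small_def using natLeq_less finite_iff_ordLess_natLeq ordLess_transitive by blast

lemma small_UN: "small \<kappa> I \<Longrightarrow> (\<And>i. i \<in> I \<Longrightarrow> small \<kappa> (A i)) \<Longrightarrow> small \<kappa> (\<Union>i\<in>I. A i)"
  unfolding small_def
  using card_of_UNION_ordLess_infinite_Field_regularCard[OF regular Cinfinite] by blast

lemma small_Un: "small \<kappa> X \<Longrightarrow> small \<kappa> Y \<Longrightarrow> small \<kappa> (X \<union> Y)"
  unfolding small_def using card_of_Un_ordLess_infinite_Field[OF infinite_Field Card_order] by blast

lemma small_Sigma:
  assumes "small \<kappa> X" "\<And>x. x \<in> X \<Longrightarrow> small \<kappa> (Y x)"
  shows "small \<kappa> (Sigma X Y)"
proof -
  have *: "Sigma X Y = (\<Union>x\<in>X. Pair x ` Y x)" by auto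
  show ?thesis unfolding * by (intro small_UN small_image assms)
qed

lemma small_embed:
  assumes "small \<kappa> X"
  obtains e :: "'x \<Rightarrow> 'k" where "inj_on e (X :: 'x set)"
proof -
  have "|X| \<le>o |Field \<kappa>|"
    using assms card_of_Field_ordIso[OF Card_order] unfolding small_def
    by (meson ordIso_symmetric ordLess_imp_ordLeq ordLeq_ordIso_trans)
  then show ?thesis using that by (auto simp: card_of_ordLeq[symmetric])
qed

end

lemma (in category) functor_arr:
  assumes "is_functor I C F"
  shows "i \<in> Obj I \<Longrightarrow> FO F i \<in> Obj C" "i \<in> Obj I \<Longrightarrow> FA F (Idt I i) = Idt C (FO F i)"
    "m \<in> Arr I \<Longrightarrow> FA F m \<in> Arr C" "m \<in> Arr I \<Longrightarrow> Dom C (FA F m) = FO F (Dom I m)"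
    "m \<in> Arr I \<Longrightarrow> Cod C (FA F m) = FO F (Cod I m)"
    "m \<in> Arr I \<Longrightarrow> m' \<in> Arr I \<Longrightarrow> Cod I m = Dom I m' \<Longrightarrow> FA F (m' \<cdot>\<^bsub>I\<^esub> m) = FA F m' \<cdot> FA F m"
  using assms by (auto simp: is_functor_def hom_def)

locale cocomplete_category = category C + universe \<kappa>
  for C :: "('o, 'a) cat" (structure) and \<kappa> :: "'k rel" +
  assumes locally_small: "locally_small \<kappa> C" and cocomplete: "cocomplete \<kappa> C"
begin

lemma small_hom: "small \<kappa> (hom C A B)"
proof (cases "A \<in> Obj C \<and> B \<in> Obj C")
  case True
  then show ?thesis using locally_small by (simp add: locally_small_def)
next
  case False
  then have "hom C A B = {}" by (auto simp: hom_def)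
  then show ?thesis by (simp add: small_finite)
qed

text \<open>Cocompleteness is stated for index categories carried by \<open>'k\<close>. A small
  category on other types is renamed along injections of its objects and arrows into
  \<open>'k\<close>, which exist because it is small.\<close>

lemma small_colimit:
  fixes I :: "('i, 'm) cat"
  assumes I: "category I" and sO: "small \<kappa> (Obj I)" and sA: "small \<kappa> (Arr I)"
    and F: "is_functor I C F"
  shows "\<exists>X \<iota>. is_colimit I C F X \<iota>"
proof -
  interpret I: category I by (rule I)
  obtain e where e: "inj_on (e :: 'i \<Rightarrow> 'k) (Obj I)" using small_embed[OF sO] .
  obtain d where d: "inj_on (d :: 'm \<Rightarrow> 'k) (Arr I)" using small_embed[OF sA] .
  define e' where "e' = inv_into (Obj I) e"
  define d' where "d' = inv_into (Arr I) d"
  have e'e [simp]: "e' (e i) = i" if "i \<in> Obj I" for i using e that by (simp add: e'_def)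
  have d'd [simp]: "d' (d i) = i" if "i \<in> Arr I" for i using d that by (simp add: d'_def)
  define K :: "('k, 'k) cat" where
    "K = \<lparr>Obj = e ` Obj I, Arr = d ` Arr I, Dom = (\<lambda>m. e (Dom I (d' m))), Cod = (\<lambda>m. e (Cod I (d' m))),
      Idt = (\<lambda>i. d (Idt I (e' i))), Comp = (\<lambda>m' m. d (d' m' \<cdot>\<^bsub>I\<^esub> d' m))\<rparr>"
  define G where "G = \<lparr>FO = FO F \<circ> e', FA = FA F \<circ> d'\<rparr>"
  have eq: "e i = e i' \<longleftrightarrow> i = i'" if "i \<in> Obj I" "i' \<in> Obj I" for i i'
    using e that by (auto simp: inj_on_def)
  have "category K"
    by unfold_locales (auto simp: K_def hom_def eq I.Comp_assoc)
  moreover have "is_functor K C G"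
    unfolding is_functor_def K_def G_def
    by (auto simp: hom_def functor_arr[OF F] eq)
  moreover have "small \<kappa> (Obj K)" "small \<kappa> (Arr K)" using sO sA by (simp_all add: K_def small_image)
  ultimately obtain X \<iota> where X: "is_colimit K C G X \<iota>"
    using cocomplete unfolding cocomplete_def by blast
  have co: "cocone K C G Y \<theta> \<longleftrightarrow> cocone I C F Y (\<lambda>i. \<theta> (e i))" for Y \<theta>
    unfolding cocone_def K_def G_def by auto
  have "is_colimit I C F X (\<lambda>i. \<iota> (e i))"
    unfolding is_colimit_def
  proof (intro conjI allI impI)
    show "cocone I C F X (\<lambda>i. \<iota> (e i))" using X co by (simp add: is_colimit_def)
    fix Y \<theta> assume "cocone I C F Y \<theta>"
    then have "cocone I C F Y (\<lambda>i. (\<theta> \<circ> e') (e i))" by (simp add: cocone_def)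
    then have "cocone K C G Y (\<theta> \<circ> e')" using co by blast
    then have "\<exists>!h. h \<in> hom C X Y \<and> (\<forall>i\<in>Obj K. h \<cdot> \<iota> i = (\<theta> \<circ> e') i)"
      using X unfolding is_colimit_def by blast
    then show "\<exists>!h. h \<in> hom C X Y \<and> (\<forall>i\<in>Obj I. h \<cdot> \<iota> (e i) = \<theta> i)"
      by (simp add: K_def)
  qed
  then show ?thesis by blast
qed

section \<open>Objects given by generators and relations\<close>

definition model :: "'x set \<Rightarrow> ('x \<Rightarrow> 'o) \<Rightarrow> ('x \<times> 'a \<times> 'x \<times> 'a) set \<Rightarrow> 'o \<Rightarrow> ('x \<Rightarrow> 'a) \<Rightarrow> bool" where
  "model X G Q Z \<tau> \<longleftrightarrow> Z \<in> Obj C \<and>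
     (\<forall>x\<in>X. \<tau> x \<in> Arr C \<and> Dom C (\<tau> x) = G x \<and> Cod C (\<tau> x) = Z) \<and>
     (\<forall>(x, a, y, b)\<in>Q. \<tau> x \<cdot> a = \<tau> y \<cdot> b)"

definition presented :: "'x set \<Rightarrow> ('x \<Rightarrow> 'o) \<Rightarrow> ('x \<times> 'a \<times> 'x \<times> 'a) set \<Rightarrow> 'o \<Rightarrow> ('x \<Rightarrow> 'a) \<Rightarrow> bool" where
  "presented X G Q Z \<theta> \<longleftrightarrow> model X G Q Z \<theta> \<and>
     (\<forall>Y \<tau>. model X G Q Y \<tau> \<longrightarrow> (\<exists>!h. h \<in> hom C Z Y \<and> (\<forall>x\<in>X. h \<cdot> \<theta> x = \<tau> x)))"

text \<open>
  Generators and relations: the index category has the generators and the relations as objects,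
  and as non-identity arrows the two legs of each relation, tagged by a boolean.
\<close>

lemma presented_exists:
  fixes X :: "'x set"
  assumes sX: "small \<kappa> X" and sQ: "small \<kappa> Q" and G: "\<And>x. x \<in> X \<Longrightarrow> G x \<in> Obj C"
    and Q: "\<And>x a y b. (x, a, y, b) \<in> Q \<Longrightarrow> x \<in> X \<and> y \<in> X \<and> a \<in> Arr C \<and> b \<in> Arr C \<and>
       Dom C a = Dom C b \<and> Cod C a = G x \<and> Cod C b = G y"
  shows "\<exists>Z \<theta>. presented X G Q Z \<theta>"
proof -
  \<comment> \<open>Non-identity arrows run only from relations to generators, so in every
    composable pair at least one arrow is an identity, and \<open>Comp\<close> returns the other
    one.\<close>
  define I :: "('x + ('x \<times> 'a \<times> 'x \<times> 'a),
      ('x + ('x \<times> 'a \<times> 'x \<times> 'a)) + ('x \<times> 'a \<times> 'x \<times> 'a) \<times> bool) cat" where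
    "I = \<lparr>Obj = Inl ` X \<union> Inr ` Q, Arr = Inl ` (Inl ` X \<union> Inr ` Q) \<union> Inr ` (Q \<times> UNIV),
       Dom = case_sum id (\<lambda>p. Inr (fst p)),
       Cod = case_sum id (\<lambda>((x, a, y, b), c). Inl (if c then y else x)),
       Idt = Inl, Comp = (\<lambda>m' m. case m of Inl _ \<Rightarrow> m' | Inr _ \<Rightarrow> m)\<rparr>"
  define FOb :: "'x + ('x \<times> 'a \<times> 'x \<times> 'a) \<Rightarrow> 'o" where "FOb = case_sum G (\<lambda>(x, a, y, b). Dom C a)"
  define F :: "('x + ('x \<times> 'a \<times> 'x \<times> 'a),
      ('x + ('x \<times> 'a \<times> 'x \<times> 'a)) + ('x \<times> 'a \<times> 'x \<times> 'a) \<times> bool, 'o, 'a) ftr" where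
    "F = \<lparr>FO = FOb,
      FA = case_sum (\<lambda>i. Idt C (FOb i)) (\<lambda>((x, a, y, b), c). if c then b else a)\<rparr>"
  have FOb: "FOb (Inl x) = G x" "FOb (Inr (x, a, y, b)) = Dom C a" for x a y b
    by (simp_all add: FOb_def)
  have "category I"
    by unfold_locales (use Q in \<open>auto simp: I_def hom_def split: if_splits\<close>)
  moreover have "is_functor I C F"
    unfolding is_functor_def
    by (auto simp: I_def F_def hom_def FOb G split: if_splits dest!: Q)
  moreover have "small \<kappa> (Obj I)" "small \<kappa> (Arr I)"
    using small_Sigma[OF sQ, of "\<lambda>_. UNIV :: bool set"]
    by (simp_all add: I_def small_Un small_image sX sQ small_finite)
  ultimately obtain Z \<iota> where Z: "is_colimit I C F Z \<iota>" using small_colimit by blast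
  have co1: "model X G Q Y (\<lambda>x. \<theta> (Inl x))" if c: "cocone I C F Y \<theta>" for Y \<theta>
  proof -
    have "\<theta> (Inl x) \<cdot> a = \<theta> (Inl y) \<cdot> b" if "(x, a, y, b) \<in> Q" for x a y b
    proof -
      have m: "Inr ((x, a, y, b), False) \<in> Arr I" "Inr ((x, a, y, b), True) \<in> Arr I"
        using that by (auto simp: I_def)
      have "\<theta> (Cod I m) \<cdot> FA F m = \<theta> (Dom I m)" if "m \<in> Arr I" for m
        using c that by (simp add: cocone_def)
      from this[OF m(1)] this[OF m(2)] show ?thesis by (simp add: I_def F_def)
    qed
    then show ?thesis
      using c unfolding cocone_def model_def by (auto simp: I_def F_def FOb hom_def)
  qed
  \<comment> \<open>A cocone also has a leg at each relation. That leg is forced to be the common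
    value of the two sides, so cocones and models carry the same information.\<close>
  have co2: "cocone I C F Y (case_sum \<tau> (\<lambda>(x, a, y, b). \<tau> x \<cdot> a))" if "model X G Q Y \<tau>" for Y \<tau>
    using that unfolding cocone_def model_def
    by (fastforce simp: I_def F_def FOb hom_def G split: if_splits dest: Q)
  have "presented X G Q Z (\<lambda>x. \<iota> (Inl x))"
    unfolding presented_def
  proof (intro conjI allI impI)
    show m: "model X G Q Z (\<lambda>x. \<iota> (Inl x))" using Z co1 by (auto simp: is_colimit_def)
    fix Y \<tau> assume t: "model X G Q Y \<tau>"
    then have "\<exists>!h. h \<in> hom C Z Y \<and> (\<forall>i\<in>Obj I. h \<cdot> \<iota> i = case_sum \<tau> (\<lambda>(x, a, y, b). \<tau> x \<cdot> a) i)"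
      using Z co2 unfolding is_colimit_def by blast
    moreover have "(\<forall>i\<in>Obj I. h \<cdot> \<iota> i = case_sum \<tau> (\<lambda>(x, a, y, b). \<tau> x \<cdot> a) i) \<longleftrightarrow>
        (\<forall>x\<in>X. h \<cdot> \<iota> (Inl x) = \<tau> x)" if h: "h \<in> hom C Z Y" for h
    proof
      assume *: "\<forall>x\<in>X. h \<cdot> \<iota> (Inl x) = \<tau> x"
      have "h \<cdot> \<iota> (Inr (x, a, y, b)) = \<tau> x \<cdot> a" if "(x, a, y, b) \<in> Q" for x a y b
      proof -
        have "Inr ((x, a, y, b), False) \<in> Arr I" using that by (auto simp: I_def)
        then have "\<iota> (Cod I (Inr ((x, a, y, b), False))) \<cdot> FA F (Inr ((x, a, y, b), False)) =
            \<iota> (Dom I (Inr ((x, a, y, b), False)))"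
          using Z by (simp add: is_colimit_def cocone_def)
        then have "\<iota> (Inl x) \<cdot> a = \<iota> (Inr (x, a, y, b))" by (simp add: I_def F_def)
        then show ?thesis
          using * Q[OF that] m h Comp_assoc[of a "\<iota> (Inl x)" h]
          by (auto simp: model_def hom_def)
      qed
      then show "\<forall>i\<in>Obj I. h \<cdot> \<iota> i = case_sum \<tau> (\<lambda>(x, a, y, b). \<tau> x \<cdot> a) i"
        using * by (auto simp: I_def)
    qed (auto simp: I_def)
    ultimately show "\<exists>!h. h \<in> hom C Z Y \<and> (\<forall>x\<in>X. h \<cdot> \<iota> (Inl x) = \<tau> x)"
      by (metis (no_types, lifting))
  qed
  then show ?thesis by blast
qed

lemma presented_ext:
  assumes "presented X G Q Z \<theta>" "h \<in> Arr C" "h' \<in> Arr C" "Dom C h = Z" "Dom C h' = Z"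
    "Cod C h = Cod C h'" "\<And>x. x \<in> X \<Longrightarrow> h \<cdot> \<theta> x = h' \<cdot> \<theta> x"
    and Q: "\<And>x a y b. (x, a, y, b) \<in> Q \<Longrightarrow> x \<in> X \<and> y \<in> X \<and> a \<in> Arr C \<and> b \<in> Arr C \<and>
       Cod C a = G x \<and> Cod C b = G y"
  shows "h = h'"
proof -
  have m: "model X G Q Z \<theta>" using assms(1) by (simp add: presented_def)
  have "h \<cdot> \<theta> x \<cdot> a = h \<cdot> \<theta> y \<cdot> b" if "(x, a, y, b) \<in> Q" for x a y b
    using m that by (auto simp: model_def)
  then have "(h \<cdot> \<theta> x) \<cdot> a = (h \<cdot> \<theta> y) \<cdot> b" if "(x, a, y, b) \<in> Q" for x a y b
    using m Q[OF that] that assms(2,4) by (simp add: model_def Comp_assoc)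
  then have "model X G Q (Cod C h) (\<lambda>x. h \<cdot> \<theta> x)"
    using m assms(2-6) by (auto simp: model_def)
  then have "\<exists>!k. k \<in> hom C Z (Cod C h) \<and> (\<forall>x\<in>X. k \<cdot> \<theta> x = h \<cdot> \<theta> x)"
    using assms(1) unfolding presented_def by blast
  moreover have "h \<in> hom C Z (Cod C h)" "h' \<in> hom C Z (Cod C h)"
    using assms(2-6) by (auto simp: hom_def)
  moreover have "\<forall>x\<in>X. h \<cdot> \<theta> x = h \<cdot> \<theta> x" "\<forall>x\<in>X. h' \<cdot> \<theta> x = h \<cdot> \<theta> x"
    using assms(7) by simp_all
  ultimately show ?thesis by blast
qed

end

section \<open>The transfinite construction of a free lifting operation\<close>

text \<open>
  The generators of the \<open>n\<close>-th stage: the domain of the arrow to be factored, the earlier stages,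
  and a filler for each lifting problem in an earlier stage.
\<close>

datatype ('i, 'j, 'a) gen = Base | Old 'i | Fill 'i 'j 'a 'a

locale lifting_chain = lifting_shape C J U + cocomplete_category C \<kappa>
  for C :: "('o, 'a) cat" (structure) and J :: "('p, 'g, 'w, 't) dbl_cat"
    and U :: "('p, 'g, 'w, 't, 'o, 'a, 'a, ('a, 'a) sq) dbl_ftr" and \<kappa> :: "'k rel" +
  fixes f :: 'a
  assumes small_J: "small_double_category \<kappa> J" and f_arr [simp]: "f \<in> Arr C"
begin

section \<open>The strict order of the indices\<close>

definition lt :: "'k \<Rightarrow> 'k \<Rightarrow> bool" where "lt m n \<longleftrightarrow> (m, n) \<in> \<kappa> \<and> m \<noteq> n"

lemma Well_order: "Well_order \<kappa>"
  using Card_order by (simp add: card_order_on_def)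

lemma wf_lt: "wf {(m, n). lt m n}"
proof -
  have "{(m, n). lt m n} = \<kappa> - Id" by (auto simp: lt_def)
  then show ?thesis using Well_order by (simp add: well_order_on_def)
qed

lemma lt_trans: "lt l m \<Longrightarrow> lt m n \<Longrightarrow> lt l n"
  using Well_order unfolding order_on_defs trans_def antisym_def lt_def by blast

lemma lt_total: "m \<in> Field \<kappa> \<Longrightarrow> n \<in> Field \<kappa> \<Longrightarrow> m = n \<or> lt m n \<or> lt n m"
  using Well_order unfolding order_on_defs total_on_def lt_def by blast

lemma lt_irrefl: "\<not> lt m m"
  by (simp add: lt_def)

lemma lt_Field: "lt m n \<Longrightarrow> m \<in> Field \<kappa>" "lt m n \<Longrightarrow> n \<in> Field \<kappa>"
  by (auto simp: Field_def lt_def)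

text \<open>A proper initial segment of a cardinal has smaller cardinality; this keeps every stage a
  small colimit although the whole sequence is not small.\<close>

lemma small_lt: "small \<kappa> {m. lt m n}"
proof (cases "n \<in> Field \<kappa>")
  case True
  have "{m. lt m n} \<subseteq> underS \<kappa> n" by (auto simp: underS_def lt_def)
  then show ?thesis
    using small_subset card_of_underS[OF Card_order True] by (auto simp: small_def)
next
  case False
  then have "{m. lt m n} = {}" using lt_Field by auto
  then show ?thesis by (simp add: small_finite)
qed

text \<open>The first component of a stage is its arrow to the codomain of \<open>f\<close>, whose
  domain is the object of the stage; the second component sends each generator to its map into that
  object.\<close>

type_synonym ('kk, 'ww, 'aa) stages = "'kk \<Rightarrow> 'aa \<times> (('kk, 'ww, 'aa) gen \<Rightarrow> 'aa)"

section \<open>Generators, relations and the choice of stages\<close>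

definition gens :: "('k, 'w, 'a) stages \<Rightarrow> 'k \<Rightarrow> ('k, 'w, 'a) gen set" where
  "gens D n = {x. case x of Base \<Rightarrow> True | Old m \<Rightarrow> lt m n
     | Fill m j u v \<Rightarrow> lt m n \<and> problem (fst (D m)) j u v}"

lemma gens_simps [simp]:
  "Base \<in> gens D n" "Old m \<in> gens D n \<longleftrightarrow> lt m n"
  "Fill m j u v \<in> gens D n \<longleftrightarrow> lt m n \<and> problem (fst (D m)) j u v"
  by (auto simp: gens_def)

fun gdom :: "('k, 'w, 'a) stages \<Rightarrow> ('k, 'w, 'a) gen \<Rightarrow> 'o" where
  "gdom D Base = Dom C f"
| "gdom D (Old m) = Dom C (fst (D m))"
| "gdom D (Fill m j u v) = Cod C (DV U j)"

fun target :: "('k, 'w, 'a) stages \<Rightarrow> ('k, 'w, 'a) gen \<Rightarrow> 'a" where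
  "target D Base = f"
| "target D (Old m) = fst (D m)"
| "target D (Fill m j u v) = v"

text \<open>The rules \<open>rel_base\<close>, \<open>rel_old\<close> and
  \<open>rel_old_fill\<close> make the maps from earlier stages compatible with everything those
  stages contain. By \<open>rel_fill\<close> a filler satisfies the upper triangle, the lower one
  being taken care of by \<open>target\<close>; by \<open>rel_move\<close> it does not depend on the
  stage at which its problem is posed. The last two rules are the horizontal and vertical
  compatibilities. In \<open>rel_vertical\<close> the filler for \<open>i\<close> is a map into the
  later stage \<open>m\<close>, so the problem for \<open>j\<close> is posed at \<open>m\<close>
  although the given one is posed at \<open>l\<close>.\<close>

inductive rel :: "('k, 'w, 'a) stages \<Rightarrow> 'k \<Rightarrow> ('k, 'w, 'a) gen \<Rightarrow> 'a \<Rightarrow> ('k, 'w, 'a) gen \<Rightarrow> 'a \<Rightarrow> bool"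
  for D n where
  rel_base: "lt m n \<Longrightarrow> rel D n (Old m) (snd (D m) Base) Base (Idt C (Dom C f))"
| rel_old: "lt l m \<Longrightarrow> lt m n \<Longrightarrow>
    rel D n (Old m) (snd (D m) (Old l)) (Old l) (Idt C (Dom C (fst (D l))))"
| rel_fill: "lt m n \<Longrightarrow> problem (fst (D m)) j u v \<Longrightarrow> rel D n (Fill m j u v) (DV U j) (Old m) u"
| rel_move: "lt l m \<Longrightarrow> lt m n \<Longrightarrow> problem (fst (D l)) j u v \<Longrightarrow>
    rel D n (Fill m j (snd (D m) (Old l) \<cdot> u) v) (Idt C (Cod C (DV U j)))
      (Fill l j u v) (Idt C (Cod C (DV U j)))"
| rel_old_fill: "lt l m \<Longrightarrow> lt m n \<Longrightarrow> problem (fst (D l)) j u v \<Longrightarrow>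
    rel D n (Old m) (snd (D m) (Fill l j u v)) (Fill l j u v) (Idt C (Cod C (DV U j)))"
| rel_horizontal: "lt m n \<Longrightarrow> r \<in> Arr (SqH J) \<Longrightarrow> problem (fst (D m)) (Cod (SqH J) r) s t \<Longrightarrow>
    rel D n (Fill m (Cod (SqH J) r) s t) (DH U (Cod (SqV J) r))
      (Fill m (Dom (SqH J) r) (s \<cdot> DH U (Dom (SqV J) r)) (t \<cdot> DH U (Cod (SqV J) r)))
      (Idt C (Cod C (DV U (Dom (SqH J) r))))"
| rel_vertical: "lt l m \<Longrightarrow> lt m n \<Longrightarrow> i \<in> Arr (Ver J) \<Longrightarrow> j \<in> Arr (Ver J) \<Longrightarrow>
    Cod (Ver J) i = Dom (Ver J) j \<Longrightarrow> problem (fst (D l)) (j \<cdot>\<^bsub>Ver J\<^esub> i) s t \<Longrightarrow>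
    rel D n (Fill l (j \<cdot>\<^bsub>Ver J\<^esub> i) s t) (Idt C (Cod C (DV U j)))
      (Fill m j (snd (D m) (Fill l i s (t \<cdot> DV U j))) t) (Idt C (Cod C (DV U j)))"

definition rels :: "('k, 'w, 'a) stages \<Rightarrow> 'k \<Rightarrow>
    (('k, 'w, 'a) gen \<times> 'a \<times> ('k, 'w, 'a) gen \<times> 'a) set" where
  "rels D n = {(x, a, y, b). rel D n x a y b}"

definition stage :: "('k, 'w, 'a) stages \<Rightarrow> 'k \<Rightarrow> 'a \<times> (('k, 'w, 'a) gen \<Rightarrow> 'a) \<Rightarrow> bool" where
  "stage D n s \<longleftrightarrow> fst s \<in> Arr C \<and> Cod C (fst s) = Cod C f \<and>
     presented (gens D n) (gdom D) (rels D n) (Dom C (fst s)) (snd s) \<and>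
     (\<forall>x\<in>gens D n. fst s \<cdot> snd s x = target D x)"

lemma stage_arr:
  assumes "stage D n s"
  shows "fst s \<in> Arr C" "Cod C (fst s) = Cod C f"
    "x \<in> gens D n \<Longrightarrow> snd s x \<in> Arr C"
    "x \<in> gens D n \<Longrightarrow> Dom C (snd s x) = gdom D x"
    "x \<in> gens D n \<Longrightarrow> Cod C (snd s x) = Dom C (fst s)"
    "x \<in> gens D n \<Longrightarrow> fst s \<cdot> snd s x = target D x"
    "rel D n x a y b \<Longrightarrow> snd s x \<cdot> a = snd s y \<cdot> b"
  using assms by (auto simp: stage_def presented_def model_def rels_def)

lemma problem_old:
  assumes st: "stage D m (D m)" and l: "stage D l (D l)" "lt l m" and p: "problem (fst (D l)) j u v"
  shows "problem (fst (D m)) j (snd (D m) (Old l) \<cdot> u) v"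
proof -
  note P = problemD[OF p] and S = stage_arr[OF st] and T = stage_arr[OF l(1)]
  have "fst (D m) \<cdot> snd (D m) (Old l) = fst (D l)" using S(6)[of "Old l"] l by simp
  from Comp_reassoc[OF _ _ _ _ _ this, of u] show ?thesis
    using P S(1-5) T(1-2) l by (simp add: problem_iff)
qed

lemma problem_fill:
  assumes st: "stage D m (D m)" and l: "stage D l (D l)" "lt l m"
    and ij: "i \<in> Arr (Ver J)" "j \<in> Arr (Ver J)" "Cod (Ver J) i = Dom (Ver J) j"
    and p: "problem (fst (D l)) (j \<cdot>\<^bsub>Ver J\<^esub> i) s t"
  shows "problem (fst (D m)) j (snd (D m) (Fill l i s (t \<cdot> DV U j))) t"
proof -
  note P = problemD[OF p] and S = stage_arr[OF st] and T = stage_arr[OF l(1)]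
  have q: "Fill l i s (t \<cdot> DV U j) \<in> gens D m"
    using problem_vertical_upper[OF ij p] l by simp
  show ?thesis using S(1,2) S(3-6)[OF q] T(1,2) P ij by (simp add: problem_iff)
qed

text \<open>Local smallness bounds the arrows between two given objects only, so the set of
  relations is shown small by confining the domains of their arrows to this small set.\<close>

definition rel_domains :: "('k, 'w, 'a) stages \<Rightarrow> 'k \<Rightarrow> 'o set" where
  "rel_domains D n = insert (Dom C f) ((\<lambda>m. Dom C (fst (D m))) ` {m. lt m n} \<union>
     (\<lambda>j. Dom C (DV U j)) ` Arr (Ver J) \<union> (\<lambda>j. Cod C (DV U j)) ` Arr (Ver J))"

text \<open>Agreement of the two sides on \<open>target\<close> makes \<open>target\<close> a model
  of the presentation, and this is what provides the arrow from the new stage to the codomain of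
  \<open>f\<close>.\<close>

lemma rel_typed:
  assumes st: "\<And>m. lt m n \<Longrightarrow> stage D m (D m)" and "rel D n x a y b"
  shows "x \<in> gens D n \<and> y \<in> gens D n \<and> a \<in> Arr C \<and> b \<in> Arr C \<and> Dom C a = Dom C b \<and>
    Cod C a = gdom D x \<and> Cod C b = gdom D y \<and> target D x \<cdot> a = target D y \<cdot> b \<and>
    Dom C a \<in> rel_domains D n"
  using assms(2)
proof (induct rule: rel.induct)
  case (rel_base m)
  then show ?case
    using stage_arr(1,2)[OF st[of m]] stage_arr(3-6)[OF st[of m], of Base] by (simp add: rel_domains_def)
next
  case (rel_old l m)
  then show ?case
    using stage_arr(1,2)[OF st[of m]] stage_arr(3-6)[OF st[of m], of "Old l"] stage_arr(1,2)[OF st[of l]] lt_trans[of l m n]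
    by (auto simp: rel_domains_def)
next
  case (rel_fill m j u v)
  then show ?case
    using stage_arr(1,2)[OF st[of m]] problemD[OF rel_fill(2)] by (auto simp: rel_domains_def)
next
  case (rel_move l m j u v)
  have ln: "lt l n" using rel_move lt_trans by blast
  show ?case
    using rel_move ln problem_old[OF st[of m] st[of l], of j u v] problemD[OF rel_move(3)]
    by (auto simp: rel_domains_def)
next
  case (rel_old_fill l m j u v)
  have ln: "lt l n" using rel_old_fill lt_trans by blast
  show ?case
    using rel_old_fill ln stage_arr(1,2)[OF st[of m]] stage_arr(3-6)[OF st[of m], of "Fill l j u v"] problemD[OF rel_old_fill(3)]
    by (auto simp: rel_domains_def)
next
  case (rel_horizontal m r s t)
  then show ?case
    using problem_square[of r "fst (D m)" s t] problemD[OF rel_horizontal(3)]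
    by (auto simp: rel_domains_def)
next
  case (rel_vertical l m i j s t)
  have ln: "lt l n" using rel_vertical lt_trans by blast
  show ?case
    using rel_vertical ln problem_fill[OF st[of m] st[of l], of i j s t] problemD[OF rel_vertical(6)]
    by (auto simp: rel_domains_def)
qed

lemma rel_cong:
  assumes "rel D n x a y b" and eq: "\<And>m. lt m n \<Longrightarrow> D m = D' m"
  shows "rel D' n x a y b"
  using assms(1)
proof (induct rule: rel.induct)
  case (rel_move l m j u v)
  then show ?case using rel.rel_move[of l m n D' j u v] eq lt_trans[of l m n] by metis
next
  case (rel_vertical l m i j s t)
  then show ?case using rel.rel_vertical[of l m n i j D' s t] eq lt_trans[of l m n] by metis
next
  case (rel_old l m)
  then show ?case using rel.rel_old[of l m n D'] eq lt_trans[of l m n] by metis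
next
  case (rel_old_fill l m j u v)
  then show ?case using rel.rel_old_fill[of l m n D' j u v] eq lt_trans[of l m n] by metis
next
  case (rel_base m)
  then show ?case using rel.rel_base[of m n D'] eq[of m] by metis
next
  case (rel_fill m j u v)
  then show ?case using rel.rel_fill[of m n D' j u v] eq[of m] by metis
next
  case (rel_horizontal m r s t)
  then show ?case using rel.rel_horizontal[of m n r D' s t] eq[of m] by metis
qed

text \<open>Choice along a well-founded relation needs the condition on the value at
  \<open>n\<close> to depend only on the values at earlier indices.\<close>

lemma stage_cong:
  assumes eq: "\<And>m. lt m n \<Longrightarrow> D m = D' m"
  shows "stage D n s = stage D' n s"
proof -
  have g: "gens D n = gens D' n" using eq by (auto simp: gens_def split: gen.splits)
  have gd: "gdom D x = gdom D' x" "target D x = target D' x" if "x \<in> gens D n" for x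
    using that eq by (cases x; simp)+
  have r: "rels D n = rels D' n"
  proof -
    have "rel D n x a y b \<longleftrightarrow> rel D' n x a y b" for x a y b
      using rel_cong[of D n x a y b D'] rel_cong[of D' n x a y b D] eq by auto
    then show ?thesis by (simp add: rels_def)
  qed
  have m: "model (gens D n) (gdom D) Q Z \<tau> = model (gens D n) (gdom D') Q Z \<tau>" for Q Z \<tau>
    using gd by (auto simp: model_def)
  show ?thesis
    unfolding stage_def presented_def g[symmetric] r[symmetric] m using gd by auto
qed

lemma small_gens: "small \<kappa> (gens D n)"
proof -
  have V: "small \<kappa> (Arr (Ver J))" using small_J by (simp add: small_double_category_def)
  let ?F = "\<lambda>m j. hom C (Dom C (DV U j)) (Dom C (fst (D m))) \<times> hom C (Cod C (DV U j)) (Cod C (fst (D m)))"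
  let ?S = "Sigma {m. lt m n} (\<lambda>m. Sigma (Arr (Ver J)) (?F m))"
  have "small \<kappa> ?S"
    by (intro small_Sigma small_lt V small_hom)
  then have "small \<kappa> ((\<lambda>(m, j, u, v). Fill m j u v) ` ?S)" by (rule small_image)
  moreover have "small \<kappa> (insert Base (Old ` {m. lt m n}))"
    using small_Un[OF small_finite[of "{Base}"] small_image[OF small_lt[of n], of Old]] by simp
  ultimately have "small \<kappa> (insert Base (Old ` {m. lt m n}) \<union> (\<lambda>(m, j, u, v). Fill m j u v) ` ?S)"
    by (rule small_Un[rotated])
  moreover have "gens D n \<subseteq> insert Base (Old ` {m. lt m n}) \<union> (\<lambda>(m, j, u, v). Fill m j u v) ` ?S"
  proof
    fix x assume x: "x \<in> gens D n"
    show "x \<in> insert Base (Old ` {m. lt m n}) \<union> (\<lambda>(m, j, u, v). Fill m j u v) ` ?S"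
    proof (cases x)
      case (Fill m j u v)
      then have "(m, j, u, v) \<in> ?S" using x by (auto simp: hom_def problem_iff)
      then show ?thesis using Fill by force
    qed (use x in auto)
  qed
  ultimately show ?thesis by (rule small_subset)
qed

lemma small_rels:
  assumes st: "\<And>m. lt m n \<Longrightarrow> stage D m (D m)"
  shows "small \<kappa> (rels D n)"
proof -
  have V: "small \<kappa> (Arr (Ver J))" using small_J by (simp add: small_double_category_def)
  have "small \<kappa> (rel_domains D n)"
    unfolding rel_domains_def
    by (subst insert_is_Un) (intro small_Un small_image small_lt V small_finite, simp)
  then have A: "small \<kappa> (\<Union>d\<in>rel_domains D n. \<Union>x\<in>gens D n. hom C d (gdom D x))" (is "small \<kappa> ?A")
    by (intro small_UN small_gens small_hom)
  have "rels D n \<subseteq> gens D n \<times> ?A \<times> gens D n \<times> ?A"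
  proof
    fix p assume "p \<in> rels D n"
    then obtain x a y b where p: "p = (x, a, y, b)" "rel D n x a y b" by (auto simp: rels_def)
    show "p \<in> gens D n \<times> ?A \<times> gens D n \<times> ?A"
      using rel_typed[OF st p(2)] p(1) by (auto simp: hom_def)
  qed
  moreover have "small \<kappa> (gens D n \<times> ?A \<times> gens D n \<times> ?A)"
    by (intro small_Sigma small_gens A)
  ultimately show ?thesis by (rule small_subset[rotated])
qed

lemma rels_typed:
  assumes st: "\<And>m. lt m n \<Longrightarrow> stage D m (D m)" and "(x, a, y, b) \<in> rels D n"
  shows "x \<in> gens D n \<and> y \<in> gens D n \<and> a \<in> Arr C \<and> b \<in> Arr C \<and> Dom C a = Dom C b \<and>
    Cod C a = gdom D x \<and> Cod C b = gdom D y"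
  using rel_typed[OF st, of n x a y b] assms(2) unfolding rels_def by blast

lemma gens_typed:
  assumes st: "\<And>m. lt m n \<Longrightarrow> stage D m (D m)" and "x \<in> gens D n"
  shows "gdom D x \<in> Obj C" "target D x \<in> Arr C" "Dom C (target D x) = gdom D x"
    "Cod C (target D x) = Cod C f"
proof -
  have "gdom D x \<in> Obj C \<and> target D x \<in> Arr C \<and> Dom C (target D x) = gdom D x \<and>
    Cod C (target D x) = Cod C f"
  proof (cases x)
    case (Old m)
    then have "stage D m (D m)" using assms by simp
    from stage_arr(1,2)[OF this] show ?thesis using Old by simp
  next
    case (Fill m j u v)
    then have "stage D m (D m)" "problem (fst (D m)) j u v" using assms by auto
    from stage_arr(1,2)[OF this(1)] problemD[OF this(2)] show ?thesis using Fill by simp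
  qed simp
  then show "gdom D x \<in> Obj C" "target D x \<in> Arr C" "Dom C (target D x) = gdom D x"
    "Cod C (target D x) = Cod C f" by auto
qed

lemma stage_exists:
  assumes st: "\<And>m. lt m n \<Longrightarrow> stage D m (D m)"
  shows "\<exists>s. stage D n s"
proof -
  have "small \<kappa> (rels D n)" by (rule small_rels) (rule st)
  moreover have t: "gdom D x \<in> Obj C" "target D x \<in> Arr C" "Dom C (target D x) = gdom D x"
    "Cod C (target D x) = Cod C f" if "x \<in> gens D n" for x
    using gens_typed[of n D x] st that by blast+
  moreover have "x \<in> gens D n \<and> y \<in> gens D n \<and> a \<in> Arr C \<and> b \<in> Arr C \<and> Dom C a = Dom C b \<and>
    Cod C a = gdom D x \<and> Cod C b = gdom D y" if "(x, a, y, b) \<in> rels D n" for x a y b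
    using rels_typed[of n D x a y b] st that by blast
  ultimately obtain Z \<theta> where Z: "presented (gens D n) (gdom D) (rels D n) Z \<theta>"
    using presented_exists[OF small_gens, of "rels D n" D n "gdom D"] by blast
  have "target D x \<cdot> a = target D y \<cdot> b" if "(x, a, y, b) \<in> rels D n" for x a y b
    using rel_typed[of n D x a y b] st that unfolding rels_def by blast
  then have "model (gens D n) (gdom D) (rels D n) (Cod C f) (target D)"
    using t by (auto simp: model_def)
  then obtain r where r: "r \<in> hom C Z (Cod C f)" "\<forall>x\<in>gens D n. r \<cdot> \<theta> x = target D x"
    using Z unfolding presented_def by blast
  then have "stage D n (r, \<theta>)" using Z by (auto simp: stage_def hom_def)
  then show ?thesis by blast
qed

text \<open>Presented objects are unique only up to isomorphism, hence the choice. An index outside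
  \<open>Field \<kappa>\<close> has no predecessors and gets the stage generated by
  \<open>Base\<close> alone, so the family is defined on the whole type and the equations for it
  carry no membership condition.\<close>

definition D :: "('k, 'w, 'a) stages" where "D = (SOME D. \<forall>n. stage D n (D n))"

lemma stage_D: "stage D n (D n)"
proof -
  have "\<exists>D. \<forall>n. stage D n (D n)"
  proof (rule dependent_wf_choice[OF wf_lt, of stage])
    fix D g :: "('k, 'w, 'a) stages" and n s
    assume "\<And>z. (z, n) \<in> {(m, n). lt m n} \<Longrightarrow> D z = g z"
    then show "stage D n s = stage g n s" by (intro stage_cong) simp
  next
    fix n and D :: "('k, 'w, 'a) stages"
    assume "\<And>y. (y, n) \<in> {(m, n). lt m n} \<Longrightarrow> stage D y (D y)"
    then show "\<exists>s. stage D n s" by (intro stage_exists) simp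
  qed
  from someI_ex[OF this] show ?thesis unfolding D_def by blast
qed

section \<open>The structure of the chosen stages\<close>

abbreviation "rho n \<equiv> fst (D n)"
abbreviation "ob n \<equiv> Dom C (rho n)"
abbreviation "base n \<equiv> snd (D n) Base"
abbreviation "con m n \<equiv> snd (D n) (Old m)"
abbreviation "fill m n j u v \<equiv> snd (D n) (Fill m j u v)"

lemma rho [simp]: "rho n \<in> Arr C" "Cod C (rho n) = Cod C f"
  using stage_arr(1,2)[OF stage_D] by auto

lemma base [simp]: "base n \<in> Arr C" "Dom C (base n) = Dom C f" "Cod C (base n) = ob n"
    "rho n \<cdot> base n = f"
  using stage_arr(3-6)[OF stage_D, of Base n] by auto

lemma con [simp]: "lt m n \<Longrightarrow> con m n \<in> Arr C" "lt m n \<Longrightarrow> Dom C (con m n) = ob m"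
    "lt m n \<Longrightarrow> Cod C (con m n) = ob n" "lt m n \<Longrightarrow> rho n \<cdot> con m n = rho m"
  using stage_arr(3-6)[OF stage_D, of "Old m" n] by auto

lemma fill:
  assumes "lt m n" "problem (rho m) j u v"
  shows "fill m n j u v \<in> Arr C" "Dom C (fill m n j u v) = Cod C (DV U j)"
    "Cod C (fill m n j u v) = ob n" "rho n \<cdot> fill m n j u v = v"
    "fill m n j u v \<cdot> DV U j = con m n \<cdot> u"
  using stage_arr(3-6)[OF stage_D, of "Fill m j u v" n] assms
    stage_arr(7)[OF stage_D rel_fill[of m n D j u v]] by auto

lemma con_base [simp]: "lt m n \<Longrightarrow> con m n \<cdot> base m = base n"
  using stage_arr(7)[OF stage_D rel_base[of m n D]] by simp

lemma con_con: "lt l m \<Longrightarrow> lt m n \<Longrightarrow> con m n \<cdot> con l m = con l n"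
  using stage_arr(7)[OF stage_D rel_old[of l m n D]] lt_trans[of l m n] by simp

lemma fill_con:
  assumes "lt l m" "lt m n" "problem (rho l) j u v"
  shows "fill m n j (con l m \<cdot> u) v = fill l n j u v"
proof -
  have "lt l n" using assms lt_trans by blast
  with stage_arr(7)[OF stage_D rel_move[where D = D, OF assms]] fill[OF _ assms(3), of n]
    fill[OF assms(2) problem_old[OF stage_D stage_D assms(1,3)]]
  show ?thesis by simp
qed

lemma con_fill:
  assumes "lt l m" "lt m n" "problem (rho l) j u v"
  shows "con m n \<cdot> fill l m j u v = fill l n j u v"
proof -
  have "lt l n" using assms lt_trans by blast
  with stage_arr(7)[OF stage_D rel_old_fill[where D = D, OF assms]] fill[OF _ assms(3), of n]
  show ?thesis by simp
qed

lemma fill_horizontal: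
  assumes "lt m n" "r \<in> Arr (SqH J)" "problem (rho m) (Cod (SqH J) r) s t"
  shows "fill m n (Cod (SqH J) r) s t \<cdot> DH U (Cod (SqV J) r) =
    fill m n (Dom (SqH J) r) (s \<cdot> DH U (Dom (SqV J) r)) (t \<cdot> DH U (Cod (SqV J) r))"
  using stage_arr(7)[OF stage_D rel_horizontal[where D = D, OF assms]]
    fill[OF assms(1) problem_square[OF assms(2,3)]] by simp

lemma fill_vertical:
  assumes "lt l m" "lt m n" "i \<in> Arr (Ver J)" "j \<in> Arr (Ver J)" "Cod (Ver J) i = Dom (Ver J) j"
    "problem (rho l) (j \<cdot>\<^bsub>Ver J\<^esub> i) s t"
  shows "fill l n (j \<cdot>\<^bsub>Ver J\<^esub> i) s t = fill m n j (fill l m i s (t \<cdot> DV U j)) t"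
proof -
  have "lt l n" using assms lt_trans by blast
  with stage_arr(7)[OF stage_D rel_vertical[where D = D, OF assms]] fill[OF _ assms(6), of n]
    fill[OF assms(2) problem_fill[OF stage_D stage_D assms(1,3-6)]] assms(3-5)
  show ?thesis by simp
qed

lemma stage_presented: "presented (gens D n) (gdom D) (rels D n) (ob n) (snd (D n))"
  using stage_D[of n] by (simp add: stage_def)

lemma stage_ext:
  assumes "h \<in> Arr C" "h' \<in> Arr C" "Dom C h = ob n" "Dom C h' = ob n" "Cod C h = Cod C h'"
    "\<And>x. x \<in> gens D n \<Longrightarrow> h \<cdot> snd (D n) x = h' \<cdot> snd (D n) x"
  shows "h = h'"
  by (rule presented_ext[OF stage_presented assms]) (use rels_typed[OF stage_D] in blast)+

text \<open>A stage need not have a lifting operation, so a map from it to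
  \<open>(g, \<psi>)\<close> is only asked to respect the fillers of problems posed earlier. At a
  stage of convergence this becomes the notion of morphism of lifting operations.\<close>

definition partial_mor :: "'a \<Rightarrow> ('w \<Rightarrow> 'a \<Rightarrow> 'a \<Rightarrow> 'a) \<Rightarrow> 'a \<Rightarrow> 'a \<Rightarrow> 'k \<Rightarrow> 'a \<Rightarrow> bool" where
  "partial_mor g \<psi> a b n h \<longleftrightarrow> h \<in> Arr C \<and> Dom C h = ob n \<and> Cod C h = Dom C g \<and>
     g \<cdot> h = b \<cdot> rho n \<and> h \<cdot> base n = a \<and>
     (\<forall>m j u v. lt m n \<longrightarrow> problem (rho m) j u v \<longrightarrow>
        h \<cdot> fill m n j u v = \<psi> j (h \<cdot> con m n \<cdot> u) (b \<cdot> v))"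

lemma partial_mor_restrict:
  assumes h: "partial_mor g \<psi> a b n h" and m: "lt m n" and b: "b \<in> Arr C" "Dom C b = Cod C f"
    and g: "g \<in> Arr C"
  shows "partial_mor g \<psi> a b m (h \<cdot> con m n)"
proof -
  have h': "h \<in> Arr C" "Dom C h = ob n" "Cod C h = Dom C g" "g \<cdot> h = b \<cdot> rho n" "h \<cdot> base n = a"
    using h by (auto simp: partial_mor_def)
  have "(h \<cdot> con m n) \<cdot> fill l m j u v = \<psi> j ((h \<cdot> con m n) \<cdot> con l m \<cdot> u) (b \<cdot> v)"
    if l: "lt l m" and p: "problem (rho l) j u v" for l j u v
  proof -
    have ln: "lt l n" using l m lt_trans by blast
    note P = problemD[OF p]
    have "(h \<cdot> con m n) \<cdot> con l m \<cdot> u = h \<cdot> con l n \<cdot> u"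
      using h' l m P Comp_reassoc[OF _ _ _ _ _ con_con[OF l m], of u] by (simp add: Comp_assoc)
    moreover have "(h \<cdot> con m n) \<cdot> fill l m j u v = h \<cdot> fill l n j u v"
      using h' l m fill[OF l p] con_fill[OF l m p] by (simp add: Comp_assoc)
    ultimately show ?thesis using h ln p by (simp add: partial_mor_def)
  qed
  moreover have "g \<cdot> h \<cdot> con m n = b \<cdot> rho m"
    using h' m b g Comp_reassoc[OF _ _ _ _ _ h'(4), of "con m n"] by (simp add: Comp_assoc)
  moreover have "(h \<cdot> con m n) \<cdot> base m = a"
    using h' m by (simp add: Comp_assoc)
  ultimately show ?thesis using h' m by (simp add: partial_mor_def)
qed

text \<open>By induction there are unique partial morphisms \<open>k m\<close> from all earlier
  stages. Together with \<open>a\<close> and the lifts prescribed by \<open>\<psi>\<close> they form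
  a model of the presentation of stage \<open>n\<close>, because each relation expresses a law valid
  for \<open>\<psi>\<close> or a compatibility of the \<open>k m\<close>. The induced map is the
  required one, and it is unique because every partial morphism takes these same values on the
  generators.\<close>

lemma partial_mor_unique_exists:
  assumes g: "lifts g \<psi>" and sq: "Sq f g a b \<in> csquares C"
  shows "\<exists>!h. partial_mor g \<psi> a b n h"
  using wf_lt
proof (induct n rule: wf_induct_rule)
  case (less n)
  have arr: "g \<in> Arr C" "a \<in> Arr C" "b \<in> Arr C" "Dom C a = Dom C f" "Cod C a = Dom C g"
    "Dom C b = Cod C f" "Cod C b = Cod C g" "g \<cdot> a = b \<cdot> f"
    using sq by (auto simp: csquares_iff)
  let ?H = "partial_mor g \<psi> a b"
  define k where "k m = (THE h. ?H m h)" for m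
  have kH: "?H m (k m)" if "lt m n" for m
    using theI'[OF less[of m]] that by (simp add: k_def)
  have kU: "h = k m" if "lt m n" "?H m h" for m h
    using less[of m] kH that by auto
  \<comment> \<open>Restricting \<open>k m\<close> to stage \<open>l\<close> gives a partial
    morphism there, so uniqueness at \<open>l\<close> makes the family compatible with the
    connecting maps.\<close>
  have kk: "k m \<cdot> con l m = k l" if "lt l m" "lt m n" for l m
    using kU[of l] partial_mor_restrict[OF kH that(1)] that lt_trans arr by blast
  have k: "k m \<in> Arr C" "Dom C (k m) = ob m" "Cod C (k m) = Dom C g" "g \<cdot> k m = b \<cdot> rho m"
    "k m \<cdot> base m = a" if "lt m n" for m
    using kH[OF that] by (auto simp: partial_mor_def)
  have kp: "problem g j (k m \<cdot> u) (b \<cdot> v)" if "lt m n" "problem (rho m) j u v" for m j u v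
    by (rule problem_map[OF that(2)]) (use k[OF that(1)] arr in \<open>simp add: csquares_iff\<close>)
  note psi = lifts_problem[OF g kp]
  have kf: "k m \<cdot> fill l m j u v = \<psi> j (k l \<cdot> u) (b \<cdot> v)"
    if "lt l m" "lt m n" "problem (rho l) j u v" for l m j u v
  proof -
    have "k m \<cdot> con l m \<cdot> u = k l \<cdot> u"
      using Comp_reassoc[OF _ _ _ _ _ kk[OF that(1,2)], of u] problemD[OF that(3)] k[OF that(2)]
        that(1) by simp
    then show ?thesis using kH[OF that(2)] that(1,3) by (simp add: partial_mor_def)
  qed
  define \<tau> where "\<tau> x = (case x of Base \<Rightarrow> a | Old m \<Rightarrow> k m | Fill m j u v \<Rightarrow> \<psi> j (k m \<cdot> u) (b \<cdot> v))"
    for x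
  have \<tau> [simp]: "\<tau> Base = a" "\<tau> (Old m) = k m" "\<tau> (Fill m j u v) = \<psi> j (k m \<cdot> u) (b \<cdot> v)" for m j u v
    by (simp_all add: \<tau>_def)
  have \<tau>_arr: "\<tau> x \<in> Arr C" "Dom C (\<tau> x) = gdom D x" "Cod C (\<tau> x) = Dom C g"
    "g \<cdot> \<tau> x = b \<cdot> target D x" if "x \<in> gens D n" for x
    using that arr k psi by (cases x; simp)+
  have rel: "\<tau> x \<cdot> c = \<tau> y \<cdot> d" if "rel D n x c y d" for x c y d
    using that
  proof (induct rule: rel.induct)
    case (rel_base m)
    then show ?case using k arr by simp
  next
    case (rel_old l m)
    then have "lt l n" using lt_trans by blast
    then show ?case using rel_old kk k[of l] by simp
  next
    case (rel_fill m j u v)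
    then show ?case using psi by simp
  next
    case (rel_move l m j u v)
    then have ln: "lt l n" using lt_trans by blast
    have "k m \<cdot> con l m \<cdot> u = k l \<cdot> u"
      using Comp_reassoc[OF _ _ _ _ _ kk[OF rel_move(1,2)], of u] problemD[OF rel_move(3)]
        k[OF rel_move(2)] rel_move(1) by simp
    then show ?case by simp
  next
    case (rel_old_fill l m j u v)
    then have "lt l n" using lt_trans by blast
    then show ?case using psi[of l j u v] kf rel_old_fill by simp
  next
    case (rel_horizontal m r s t)
    note P = problemD[OF rel_horizontal(3)] and K = k[OF rel_horizontal(1)]
    show ?case
      using psi[OF rel_horizontal(1) problem_square[OF rel_horizontal(2,3)]]
        lifts_horizontal[OF g rel_horizontal(2) kp[OF rel_horizontal(1,3)]] P K arr rel_horizontal(2)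
      by (simp add: Comp_assoc)
  next
    case (rel_vertical l m i j s t)
    then have ln: "lt l n" using lt_trans by blast
    note P = problemD[OF rel_vertical(6)] and Q = problem_vertical_upper[OF rel_vertical(3-6)]
    have "\<psi> (j \<cdot>\<^bsub>Ver J\<^esub> i) (k l \<cdot> s) (b \<cdot> t) = \<psi> j (\<psi> i (k l \<cdot> s) ((b \<cdot> t) \<cdot> DV U j)) (b \<cdot> t)"
      by (rule lifts_vertical[OF g rel_vertical(3-5) kp[OF ln rel_vertical(6)]])
    moreover have "(b \<cdot> t) \<cdot> DV U j = b \<cdot> t \<cdot> DV U j"
      using P arr rel_vertical(3-5) by (simp add: Comp_assoc)
    ultimately show ?case
      by (simp add: kf[OF rel_vertical(1,2) Q])
  qed
  have "model (gens D n) (gdom D) (rels D n) (Dom C g) \<tau>"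
    using \<tau>_arr rel arr by (auto simp: model_def rels_def)
  then obtain h where "h \<in> hom C (ob n) (Dom C g)" and h\<tau>: "\<forall>x\<in>gens D n. h \<cdot> snd (D n) x = \<tau> x"
    using stage_presented[of n] unfolding presented_def by blast
  then have h: "h \<in> Arr C" "Dom C h = ob n" "Cod C h = Dom C g" by (auto simp: hom_def)
  have th: "snd (D n) x \<in> Arr C" "Dom C (snd (D n) x) = gdom D x" "Cod C (snd (D n) x) = ob n"
    "rho n \<cdot> snd (D n) x = target D x" if "x \<in> gens D n" for x
    using stage_arr(3-6)[OF stage_D that] by auto
  have gh: "g \<cdot> h = b \<cdot> rho n"
  proof (rule stage_ext)
    fix x assume x: "x \<in> gens D n"
    show "(g \<cdot> h) \<cdot> snd (D n) x = (b \<cdot> rho n) \<cdot> snd (D n) x"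
      using h h\<tau> x th[OF x] \<tau>_arr[OF x] arr by (simp add: Comp_assoc)
  qed (use h arr in simp_all)
  have hk: "h \<cdot> con m n = k m" if "lt m n" for m
    using h\<tau> that by (metis \<tau>(2) gens_simps(2))
  have hH: "?H n h"
    unfolding partial_mor_def
  proof (intro conjI allI impI h gh)
    show "h \<cdot> base n = a" using h\<tau> by (metis \<tau>(1) gens_simps(1))
    fix m j u v assume m: "lt m n" and p: "problem (rho m) j u v"
    have "h \<cdot> con m n \<cdot> u = k m \<cdot> u"
      using Comp_reassoc[OF _ _ _ _ _ hk[OF m], of u] problemD[OF p] h m by simp
    moreover have "h \<cdot> fill m n j u v = \<tau> (Fill m j u v)" using h\<tau> m p by (metis gens_simps(3))
    ultimately show "h \<cdot> fill m n j u v = \<psi> j (h \<cdot> con m n \<cdot> u) (b \<cdot> v)" by simp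
  qed
  moreover have "h' = h" if h': "?H n h'" for h'
  proof (rule stage_ext)
    have H: "h' \<in> Arr C" "Dom C h' = ob n" "Cod C h' = Dom C g" using h' by (auto simp: partial_mor_def)
    then show "h' \<in> Arr C" "h \<in> Arr C" "Dom C h' = ob n" "Dom C h = ob n" "Cod C h' = Cod C h"
      using h by auto
    fix x assume x: "x \<in> gens D n"
    have hk': "h' \<cdot> con m n = k m" if "lt m n" for m
      using kU[OF that] partial_mor_restrict[OF h' that] arr by blast
    have "h' \<cdot> snd (D n) x = \<tau> x"
    proof (cases x)
      case (Fill m j u v)
      then have m: "lt m n" and p: "problem (rho m) j u v" using x by auto
      have "h' \<cdot> con m n \<cdot> u = k m \<cdot> u"
        using Comp_reassoc[OF _ _ _ _ _ hk'[OF m], of u] problemD[OF p] H m by simp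
      then show ?thesis using Fill h' m p by (simp add: partial_mor_def)
    qed (use x h' hk' in \<open>auto simp: partial_mor_def\<close>)
    then show "h' \<cdot> snd (D n) x = h \<cdot> snd (D n) x" using h\<tau> x by simp
  qed
  ultimately show ?case by blast
qed

end

section \<open>Lifting operations on stages of convergence\<close>

context lifting_chain begin

lemma con_con_comp:
  "lt l m \<Longrightarrow> lt m n \<Longrightarrow> u \<in> Arr C \<Longrightarrow> Cod C u = ob l \<Longrightarrow> con m n \<cdot> con l m \<cdot> u = con l n \<cdot> u"
  using Comp_reassoc[OF _ _ _ _ _ con_con, of u] by simp

text \<open>This says in terms of elements that homs out of each \<open>DO U A\<close> see stage
  \<open>n\<close> as the colimit of the earlier stages: maps into it come from earlier stages, and
  maps that become equal in it are equal before it. The first clause leaves room for the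
  intermediate stage that vertical compatibility requires.\<close>

definition converges :: "'k \<Rightarrow> bool" where
  "converges n \<longleftrightarrow>
     (\<forall>m. lt m n \<longrightarrow> (\<exists>p. lt m p \<and> lt p n)) \<and>
     (\<forall>A\<in>Obj (Hor J).
        (\<forall>u\<in>hom C (DO U A) (ob n). \<exists>m u'. lt m n \<and> u' \<in> hom C (DO U A) (ob m) \<and> con m n \<cdot> u' = u) \<and>
        (\<forall>m u u'. lt m n \<longrightarrow> u \<in> hom C (DO U A) (ob m) \<longrightarrow> u' \<in> hom C (DO U A) (ob m) \<longrightarrow>
           con m n \<cdot> u = con m n \<cdot> u' \<longrightarrow> (\<exists>p. lt m p \<and> lt p n \<and> con m p \<cdot> u = con m p \<cdot> u')))"

lemma Dom_Ver: "j \<in> Arr (Ver J) \<Longrightarrow> Dom (Ver J) j \<in> Obj (Hor J)"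
  using category.Dom_in[OF J.categories(2)] by (simp add: J.sorts)

context
  fixes n assumes conv: "converges n"
begin

lemma converges_limit: "lt m n \<Longrightarrow> \<exists>p. lt m p \<and> lt p n"
  using conv by (simp add: converges_def)

lemma converges_factor:
  assumes "j \<in> Arr (Ver J)" "u \<in> Arr C" "Dom C u = Dom C (DV U j)" "Cod C u = ob n"
  shows "\<exists>m u'. lt m n \<and> u' \<in> Arr C \<and> Dom C u' = Dom C (DV U j) \<and> Cod C u' = ob m \<and> con m n \<cdot> u' = u"
  using conv assms Dom_Ver[OF assms(1)] unfolding converges_def by (fastforce simp: hom_def)

lemma converges_equal:
  assumes "j \<in> Arr (Ver J)" "u \<in> Arr C" "Dom C u = Dom C (DV U j)" "Cod C u = ob m"
    "u' \<in> Arr C" "Dom C u' = Dom C (DV U j)" "Cod C u' = ob m" "lt m n" "con m n \<cdot> u = con m n \<cdot> u'"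
  shows "\<exists>p. lt m p \<and> lt p n \<and> con m p \<cdot> u = con m p \<cdot> u'"
proof -
  have "u \<in> hom C (DO U (Dom (Ver J) j)) (ob m)" "u' \<in> hom C (DO U (Dom (Ver J) j)) (ob m)"
    using assms by (auto simp: hom_def)
  then show ?thesis using conv assms(8,9) Dom_Ver[OF assms(1)] unfolding converges_def by blast
qed

text \<open>A problem at stage \<open>n\<close> is solved by the filler of an earlier problem from
  which it comes; \<open>fill_welldefined\<close> makes the choice harmless.\<close>

definition free_lift :: "'w \<Rightarrow> 'a \<Rightarrow> 'a \<Rightarrow> 'a" where
  "free_lift j u v = (let (m, u') = SOME (m, u'). lt m n \<and> u' \<in> Arr C \<and> Dom C u' = Dom C (DV U j) \<and>
     Cod C u' = ob m \<and> con m n \<cdot> u' = u in fill m n j u' v)"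

lemma problem_con:
  assumes "problem (rho n) j (con m n \<cdot> u) v" "lt m n" "u \<in> Arr C" "Cod C u = ob m"
  shows "problem (rho m) j u v"
proof -
  have "rho n \<cdot> con m n \<cdot> u = rho m \<cdot> u"
    using Comp_reassoc[OF _ _ _ _ _ con(4), of u] assms(2-4) by simp
  then show ?thesis using assms by (simp add: problem_iff)
qed

lemma con_problem:
  assumes "problem (rho m) j u v" "lt m n"
  shows "problem (rho n) j (con m n \<cdot> u) v"
  by (rule problem_old[OF stage_D stage_D assms(2,1)])

text \<open>Two representatives are moved to a common stage and then to a later one, still below
  \<open>n\<close>, at which they coincide. By \<open>fill_con\<close> neither move changes the
  filler in stage \<open>n\<close>.\<close>

lemma fill_welldefined:
  assumes p: "problem (rho m) j u v" "problem (rho m') j u' v" and lt: "lt m n" "lt m' n"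
    and eq: "con m n \<cdot> u = con m' n \<cdot> u'"
  shows "fill m n j u v = fill m' n j u' v"
proof -
  have same: "fill m n j u v = fill m n j u' v"
    if p: "problem (rho m) j u v" "problem (rho m) j u' v" and lt: "lt m n"
      and eq: "con m n \<cdot> u = con m n \<cdot> u'" for m u u'
  proof -
    obtain q where q: "lt m q" "lt q n" "con m q \<cdot> u = con m q \<cdot> u'"
      using converges_equal[of j u m u'] problemD[OF p(1)] problemD[OF p(2)] lt eq by auto
    from fill_con[OF q(1,2) p(1)] fill_con[OF q(1,2) p(2)] q(3) show ?thesis by simp
  qed
  have less: "fill m n j u v = fill m' n j u' v"
    if p: "problem (rho m) j u v" "problem (rho m') j u' v" and lt: "lt m m'" "lt m' n"
      and eq: "con m n \<cdot> u = con m' n \<cdot> u'" for m m' u u'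
  proof -
    have "con m' n \<cdot> con m m' \<cdot> u = con m' n \<cdot> u'"
      using con_con_comp[OF lt] problemD[OF p(1)] eq by simp
    from same[OF problem_old[OF stage_D stage_D lt(1) p(1)] p(2) lt(2) this] fill_con[OF lt p(1)]
    show ?thesis by simp
  qed
  consider "m = m'" | "lt m m'" | "lt m' m"
    using lt_total[OF lt_Field(1)[OF lt(1)] lt_Field(1)[OF lt(2)]] by blast
  then show ?thesis
  proof cases
    case 1
    then show ?thesis using same[OF p(1) p(2)[folded 1] lt(1) eq[folded 1]] by simp
  next
    case 2
    then show ?thesis by (rule less[OF p _ lt(2) eq])
  next
    case 3
    then show ?thesis by (rule less[OF p(2,1) _ lt(1) eq[symmetric], symmetric])
  qed
qed

lemma free_lift_eq:
  assumes "problem (rho m) j u v" "lt m n"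
  shows "free_lift j (con m n \<cdot> u) v = fill m n j u v"
proof -
  note p = con_problem[OF assms]
  let ?P = "\<lambda>(m', u'). lt m' n \<and> u' \<in> Arr C \<and> Dom C u' = Dom C (DV U j) \<and>
     Cod C u' = ob m' \<and> con m' n \<cdot> u' = con m n \<cdot> u"
  have "?P (m, u)" using problemD[OF assms(1)] assms(2) by simp
  then have "?P (SOME x. ?P x)" by (rule someI[of ?P])
  then obtain m' u' where s: "(SOME x. ?P x) = (m', u')" and
    m': "lt m' n" "u' \<in> Arr C" "Cod C u' = ob m'" "con m' n \<cdot> u' = con m n \<cdot> u"
    by (cases "SOME x. ?P x") auto
  have "problem (rho m') j u' v" using problem_con[of j m' u' v] p m' by simp
  from fill_welldefined[OF this assms(1) m'(1) assms(2) m'(4)] show ?thesis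
    unfolding free_lift_def s by simp
qed

lemma problem_factor:
  assumes "problem (rho n) j u v"
  obtains m u' where "lt m n" "problem (rho m) j u' v" "u = con m n \<cdot> u'"
    "free_lift j u v = fill m n j u' v"
proof -
  note P = problemD[OF assms]
  obtain m u' where m: "lt m n" "u' \<in> Arr C" "Cod C u' = ob m" "con m n \<cdot> u' = u"
    using converges_factor[of j u] P by auto
  then have "problem (rho m) j u' v" using problem_con[of j m u' v] assms by simp
  with free_lift_eq[OF this m(1)] m that show ?thesis by blast
qed

lemma lifts_free_lift: "lifts (rho n) free_lift"
  unfolding lifts_def
proof (intro conjI allI impI ballI)
  fix j u v assume "problem (rho n) j u v"
  then obtain m u' where m: "lt m n" "problem (rho m) j u' v" "u = con m n \<cdot> u'"
    "free_lift j u v = fill m n j u' v" by (rule problem_factor)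
  from fill[OF m(1,2)] m(3) show "free_lift j u v \<in> Arr C"
    "Dom C (free_lift j u v) = Cod C (DV U j)" "Cod C (free_lift j u v) = ob n"
    "free_lift j u v \<cdot> DV U j = u" "rho n \<cdot> free_lift j u v = v"
    unfolding m(4) by simp_all
next
  fix r u v assume r: "r \<in> Arr (SqH J)" and "problem (rho n) (Cod (SqH J) r) u v"
  then obtain m u' where m: "lt m n" "problem (rho m) (Cod (SqH J) r) u' v" "u = con m n \<cdot> u'"
    "free_lift (Cod (SqH J) r) u v = fill m n (Cod (SqH J) r) u' v" by (auto elim: problem_factor)
  have "u \<cdot> DH U (Dom (SqV J) r) = con m n \<cdot> u' \<cdot> DH U (Dom (SqV J) r)"
    using m(1,3) problemD[OF m(2)] r by (simp add: Comp_assoc)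
  then show "free_lift (Cod (SqH J) r) u v \<cdot> DH U (Cod (SqV J) r) =
       free_lift (Dom (SqH J) r) (u \<cdot> DH U (Dom (SqV J) r)) (v \<cdot> DH U (Cod (SqV J) r))"
    unfolding m(4) using free_lift_eq[OF problem_square[OF r m(2)] m(1)]
      fill_horizontal[OF m(1) r m(2)] by simp
next
  fix i j u v
  assume ij: "i \<in> Arr (Ver J)" "j \<in> Arr (Ver J)" "Cod (Ver J) i = Dom (Ver J) j"
    and "problem (rho n) (j \<cdot>\<^bsub>Ver J\<^esub> i) u v"
  then obtain m u' where m: "lt m n" "problem (rho m) (j \<cdot>\<^bsub>Ver J\<^esub> i) u' v" "u = con m n \<cdot> u'"
    "free_lift (j \<cdot>\<^bsub>Ver J\<^esub> i) u v = fill m n (j \<cdot>\<^bsub>Ver J\<^esub> i) u' v" by (auto elim: problem_factor)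
  note q = problem_vertical_upper[OF ij m(2)]
  \<comment> \<open>The filler for \<open>i\<close> has to live at some stage between
    \<open>m\<close> and \<open>n\<close> in order to serve as the top of a problem for
    \<open>j\<close> whose filler is available at \<open>n\<close>.\<close>
  obtain p where p: "lt m p" "lt p n" using converges_limit m(1) by blast
  have "free_lift i u (v \<cdot> DV U j) = con p n \<cdot> fill m p i u' (v \<cdot> DV U j)"
    using free_lift_eq[OF q m(1)] m(3) con_fill[OF p q] by simp
  then show "free_lift (j \<cdot>\<^bsub>Ver J\<^esub> i) u v = free_lift j (free_lift i u (v \<cdot> DV U j)) v"
    using free_lift_eq[OF problem_fill[OF stage_D stage_D p(1) ij m(2)] p(2)]
      fill_vertical[OF p ij m(2)] m(4) by simp
qed simp

text \<open>Every problem at \<open>n\<close> comes from an earlier one, and every earlier one maps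
  to a problem at \<open>n\<close> with the same filler, so the two conditions quantify over the
  same solutions.\<close>

lemma free_lift_mor_iff:
  assumes "g \<in> Arr C"
  shows "partial_mor g \<psi> a b n h \<longleftrightarrow> h \<in> Arr C \<and> Dom C h = ob n \<and> Cod C h = Dom C g \<and>
     g \<cdot> h = b \<cdot> rho n \<and> h \<cdot> base n = a \<and>
     (\<forall>j u v. problem (rho n) j u v \<longrightarrow> h \<cdot> free_lift j u v = \<psi> j (h \<cdot> u) (b \<cdot> v))"
proof -
  have "(\<forall>m j u v. lt m n \<longrightarrow> problem (rho m) j u v \<longrightarrow>
        h \<cdot> fill m n j u v = \<psi> j (h \<cdot> con m n \<cdot> u) (b \<cdot> v)) \<longleftrightarrow>
     (\<forall>j u v. problem (rho n) j u v \<longrightarrow> h \<cdot> free_lift j u v = \<psi> j (h \<cdot> u) (b \<cdot> v))"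
    (is "?A \<longleftrightarrow> ?B")
  proof
    assume A: ?A
    show ?B
    proof (intro allI impI)
      fix j u v assume "problem (rho n) j u v"
      then obtain m u' where "lt m n" "problem (rho m) j u' v" "u = con m n \<cdot> u'"
        "free_lift j u v = fill m n j u' v" by (rule problem_factor)
      then show "h \<cdot> free_lift j u v = \<psi> j (h \<cdot> u) (b \<cdot> v)" using A by simp
    qed
  next
    assume B: ?B
    show ?A
    proof (intro allI impI)
      fix m j u v assume m: "lt m n" "problem (rho m) j u v"
      show "h \<cdot> fill m n j u v = \<psi> j (h \<cdot> con m n \<cdot> u) (b \<cdot> v)"
        using B con_problem[OF m(2,1)] unfolding free_lift_eq[OF m(2,1), symmetric] by blast
    qed
  qed
  then show ?thesis by (simp add: partial_mor_def)
qed

lemma free_lift_universal: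
  assumes "lifts g \<psi>" "Sq f g a b \<in> csquares C"
  shows "\<exists>!h. h \<in> Arr C \<and> Dom C h = ob n \<and> Cod C h = Dom C g \<and>
     g \<cdot> h = b \<cdot> rho n \<and> h \<cdot> base n = a \<and>
     (\<forall>j u v. problem (rho n) j u v \<longrightarrow> h \<cdot> free_lift j u v = \<psi> j (h \<cdot> u) (b \<cdot> v))"
  using partial_mor_unique_exists[OF assms, of n] assms(2)
  by (subst (asm) free_lift_mor_iff) (auto simp: csquares_iff)

end

lemma free_liftV:
  assumes "converges n"
  shows "\<exists>x\<in>liftV. \<exists>l\<in>Arr C. Dom C l = Dom C f \<and> Cod C l = Dom C (fst x) \<and> Cod C (fst x) = Cod C f \<and>
    fst x \<cdot> l = f \<and>
    (\<forall>y\<in>liftV. \<forall>a b. Sq f (fst y) a b \<in> csquares C \<longrightarrow> (\<exists>!h. lift.mor x y h b \<and> h \<cdot> l = a))"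
proof (intro bexI[where x = "(rho n, lift_restrict C J U (rho n) (free_lift n))"] bexI[where x = "base n"]
    conjI ballI allI impI)
  show V: "(rho n, lift_restrict C J U (rho n) (free_lift n)) \<in> liftV"
    by (rule restrict_liftV[OF lifts_free_lift[OF assms]])
  fix y a b assume y: "y \<in> liftV" and sq: "Sq f (fst y) a b \<in> csquares C"
  have "lift.mor (rho n, lift_restrict C J U (rho n) (free_lift n)) y h b \<and> h \<cdot> base n = a \<longleftrightarrow>
    h \<in> Arr C \<and> Dom C h = ob n \<and> Cod C h = Dom C (fst y) \<and>
     fst y \<cdot> h = b \<cdot> rho n \<and> h \<cdot> base n = a \<and>
     (\<forall>j u v. problem (rho n) j u v \<longrightarrow> h \<cdot> free_lift n j u v = snd y j (h \<cdot> u) (b \<cdot> v))" for h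
    using V y sq by (auto simp: lift.mor_iff csquares_iff lift_square_iff')
  with free_lift_universal[OF assms liftV_lifts'[OF y] sq]
  show "\<exists>!h. lift.mor (rho n, lift_restrict C J U (rho n) (free_lift n)) y h b \<and> h \<cdot> base n = a"
    by simp
qed simp_all

end

section \<open>Convergence of the construction\<close>

context universe begin

lemma Field_limit: "a \<in> Field \<kappa> \<Longrightarrow> \<exists>b\<in>Field \<kappa>. a \<noteq> b \<and> (a, b) \<in> \<kappa>"
  using infinite_Card_order_limit[OF Card_order infinite_Field] .

text \<open>An unbounded set would be cofinal and so, by regularity, have the cardinality of
  \<kappa>. Cofinality asks for strictly larger elements, hence the passage from \<open>a\<close> to
  a strictly larger \<open>a'\<close>.\<close>

lemma small_bounded:
  assumes B: "small \<kappa> B" "B \<subseteq> Field \<kappa>"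
  shows "\<exists>p\<in>Field \<kappa>. \<forall>b\<in>B. (b, p) \<in> \<kappa> \<and> b \<noteq> p"
proof (rule ccontr)
  assume neg: "\<not> ?thesis"
  have wo: "Well_order \<kappa>" using Card_order by (simp add: card_order_on_def)
  then interpret wo_rel \<kappa> by (simp add: wo_rel_def)
  have tot: "(a, b) \<in> \<kappa> \<or> (b, a) \<in> \<kappa>" if "a \<in> Field \<kappa>" "b \<in> Field \<kappa>" for a b
    using TOTALS that by blast
  have tr: "(a, c) \<in> \<kappa>" if "(a, b) \<in> \<kappa>" "(b, c) \<in> \<kappa>" for a b c
    using TRANS that by (rule transD)
  have asym: "a = b" if "(a, b) \<in> \<kappa>" "(b, a) \<in> \<kappa>" for a b
    using ANTISYM that by (rule antisymD)
  have "cofinal B \<kappa>"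
    unfolding cofinal_def
  proof
    fix a assume "a \<in> Field \<kappa>"
    then obtain a' where a': "a' \<in> Field \<kappa>" "a \<noteq> a'" "(a, a') \<in> \<kappa>" using Field_limit by blast
    then obtain b where b: "b \<in> B" "\<not> ((b, a') \<in> \<kappa> \<and> b \<noteq> a')" using neg by blast
    then have "(a', b) \<in> \<kappa>" using tot[of a' b] a' B(2) by blast
    then have "(a, b) \<in> \<kappa>" "a \<noteq> b" using tr[OF a'(3)] asym[OF a'(3)] a'(2) by auto
    then show "\<exists>b\<in>B. a \<noteq> b \<and> (a, b) \<in> \<kappa>" using b(1) by blast
  qed
  then have "|B| =o \<kappa>" using regular B(2) by (simp add: regularCard_def)
  then show False using B(1) unfolding small_def by (simp add: not_ordLess_ordIso)
qed

end

section \<open>Closure properties of orthogonality\<close>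

context category begin

lemma orthogonalD:
  assumes "orthogonal C e m" "Sq e m u v \<in> csquares C"
  shows "\<exists>!d. d \<in> Arr C \<and> Dom C d = Cod C e \<and> Cod C d = Dom C m \<and> d \<cdot> e = u \<and> m \<cdot> d = v"
  using assms by (simp add: orthogonal_def hom_def conj_assoc)

lemma orthogonalI:
  assumes "\<And>u v. Sq e m u v \<in> csquares C \<Longrightarrow>
    \<exists>!d. d \<in> Arr C \<and> Dom C d = Cod C e \<and> Cod C d = Dom C m \<and> d \<cdot> e = u \<and> m \<cdot> d = v"
  shows "orthogonal C e m"
  using assms by (simp add: orthogonal_def hom_def conj_assoc)

lemma orthogonal_iso_right:
  assumes o: "orthogonal C e m" and m: "m \<in> Arr C" and i: "i \<in> Arr C" "Cod C i = Dom C m"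
    and k: "k \<in> Arr C" "Dom C k = Cod C i" "Cod C k = Dom C i" "i \<cdot> k = Idt C (Cod C i)" "k \<cdot> i = Idt C (Dom C i)"
  shows "orthogonal C e (m \<cdot> i)"
proof (rule orthogonalI)
  fix u v assume sq: "Sq e (m \<cdot> i) u v \<in> csquares C"
  then have a: "e \<in> Arr C" "u \<in> Arr C" "v \<in> Arr C" "Dom C u = Dom C e" "Cod C u = Dom C i"
    "Dom C v = Cod C e" "Cod C v = Cod C m" "(m \<cdot> i) \<cdot> u = v \<cdot> e"
    using m i by (auto simp: csquares_iff)
  have "Sq e m (i \<cdot> u) v \<in> csquares C"
    using a m i Comp_assoc[of u i m] by (simp add: csquares_iff)
  from orthogonalD[OF o this] obtain d where
    d: "d \<in> Arr C" "Dom C d = Cod C e" "Cod C d = Dom C m" "d \<cdot> e = i \<cdot> u" "m \<cdot> d = v"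
    and uni: "\<And>d'. d' \<in> Arr C \<Longrightarrow> Dom C d' = Cod C e \<Longrightarrow> Cod C d' = Dom C m \<Longrightarrow> d' \<cdot> e = i \<cdot> u \<Longrightarrow>
      m \<cdot> d' = v \<Longrightarrow> d' = d" by blast
  have "(k \<cdot> d) \<cdot> e = u"
    using a d k i Comp_reassoc[OF _ _ _ _ _ k(5), of u] by (simp add: Comp_assoc)
  moreover have "(m \<cdot> i) \<cdot> k \<cdot> d = v"
    using a d k i m Comp_reassoc[OF _ _ _ _ _ k(4), of d] by (simp add: Comp_assoc)
  moreover have "d' = k \<cdot> d" if d': "d' \<in> Arr C" "Dom C d' = Cod C e" "Cod C d' = Dom C (m \<cdot> i)"
    "d' \<cdot> e = u" "(m \<cdot> i) \<cdot> d' = v" for d'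
  proof -
    have "i \<cdot> d' = d" by (rule uni) (use d' i m a in \<open>simp_all add: Comp_assoc\<close>)
    then show ?thesis using Comp_reassoc[OF _ _ _ _ _ k(5), of d'] d' i m k by simp
  qed
  ultimately show "\<exists>!d. d \<in> Arr C \<and> Dom C d = Cod C e \<and> Cod C d = Dom C (m \<cdot> i) \<and> d \<cdot> e = u \<and>
      (m \<cdot> i) \<cdot> d = v"
    using d k i m by (intro ex1I[of _ "k \<cdot> d"]) auto
qed

text \<open>The diagonal \<open>d\<close> against the composite also fills the square against
  \<open>n\<close>: both \<open>n\<close> after \<open>d\<close> and \<open>v\<close> are diagonals
  of one square against \<open>m\<close>, hence equal.\<close>

lemma orthogonal_cancel:
  assumes mn: "orthogonal C e (m \<cdot> n)" and m': "orthogonal C e m"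
    and a: "m \<in> Arr C" "n \<in> Arr C" "Cod C n = Dom C m"
  shows "orthogonal C e n"
proof (rule orthogonalI)
  fix u v assume sq: "Sq e n u v \<in> csquares C"
  then have b: "e \<in> Arr C" "u \<in> Arr C" "v \<in> Arr C" "Dom C u = Dom C e" "Cod C u = Dom C n"
    "Dom C v = Cod C e" "Cod C v = Cod C n" "n \<cdot> u = v \<cdot> e"
    by (auto simp: csquares_iff)
  have "Sq e (m \<cdot> n) u (m \<cdot> v) \<in> csquares C" using a b by (simp add: csquares_iff Comp_assoc)
  moreover have "Dom C (m \<cdot> n) = Dom C n" using a by simp
  ultimately have "\<exists>!d. d \<in> Arr C \<and> Dom C d = Cod C e \<and> Cod C d = Dom C n \<and> d \<cdot> e = u \<and>
      (m \<cdot> n) \<cdot> d = m \<cdot> v"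
    using orthogonalD[OF mn] by metis
  then obtain d where
    d: "d \<in> Arr C" "Dom C d = Cod C e" "Cod C d = Dom C n" "d \<cdot> e = u" "(m \<cdot> n) \<cdot> d = m \<cdot> v"
    and uni: "\<And>d'. d' \<in> Arr C \<Longrightarrow> Dom C d' = Cod C e \<Longrightarrow> Cod C d' = Dom C n \<Longrightarrow> d' \<cdot> e = u \<Longrightarrow>
      (m \<cdot> n) \<cdot> d' = m \<cdot> v \<Longrightarrow> d' = d"
    by blast
  have "Sq e m (n \<cdot> u) (m \<cdot> v) \<in> csquares C" using a b by (simp add: csquares_iff Comp_assoc)
  moreover have "(n \<cdot> d) \<cdot> e = n \<cdot> u" "m \<cdot> n \<cdot> d = m \<cdot> v"
    using a b(1-5) d by (simp_all add: Comp_assoc)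
  ultimately have "n \<cdot> d = v"
    using orthogonalD[OF m', of "n \<cdot> u" "m \<cdot> v"] a b d by (metis Comp_arr)
  moreover have "d' = d" if d': "d' \<in> Arr C" "Dom C d' = Cod C e" "Cod C d' = Dom C n"
    "d' \<cdot> e = u" "n \<cdot> d' = v" for d'
    by (rule uni) (use d' a in \<open>simp_all add: Comp_assoc\<close>)
  ultimately show "\<exists>!d. d \<in> Arr C \<and> Dom C d = Cod C e \<and> Cod C d = Dom C n \<and> d \<cdot> e = u \<and> n \<cdot> d = v"
    using d(1-4) by blast
qed

lemma orthogonal_Idt:
  assumes "A \<in> Obj C"
  shows "orthogonal C e (Idt C A)"
proof (rule orthogonalI)
  fix u v assume "Sq e (Idt C A) u v \<in> csquares C"
  then have a: "e \<in> Arr C" "u \<in> Arr C" "v \<in> Arr C" "Dom C v = Cod C e" "Cod C v = A" "v \<cdot> e = u"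
    using assms Idt_left[of u A] by (auto simp: csquares_iff)
  show "\<exists>!d. d \<in> Arr C \<and> Dom C d = Cod C e \<and> Cod C d = Dom C (Idt C A) \<and> d \<cdot> e = u \<and> Idt C A \<cdot> d = v"
  proof (rule ex1I[of _ v])
    fix d assume "d \<in> Arr C \<and> Dom C d = Cod C e \<and> Cod C d = Dom C (Idt C A) \<and> d \<cdot> e = u \<and> Idt C A \<cdot> d = v"
    then show "d = v" using assms Idt_left[of d A] by simp
  qed (use a assms in simp)
qed

end

text \<open>Preservation of a colimit is turned into statements about elements by testing against
  two kinds of target only: a subset of the hom set itself and a set with two elements. The latter
  is always available in \<open>'a + 'k\<close>, one point from each summand.\<close>

lemma (in cocomplete_category) chain_elements:
  fixes \<alpha> :: "'k rel"
  assumes wo: "Well_order \<alpha>"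
    and F: "F \<in> chains_in C \<alpha> M" and colim: "is_colimit (poset_cat \<alpha>) C F X \<iota>"
    and sm: "ordinal_small_wrt \<kappa> C \<alpha> M A"
  shows "u \<in> hom C A X \<Longrightarrow> \<exists>i\<in>Field \<alpha>. \<exists>u'\<in>hom C A (FO F i). \<iota> i \<cdot> u' = u"
    and "i \<in> Field \<alpha> \<Longrightarrow> u \<in> hom C A (FO F i) \<Longrightarrow> u' \<in> hom C A (FO F i) \<Longrightarrow>
      \<iota> i \<cdot> u = \<iota> i \<cdot> u' \<Longrightarrow> \<exists>j. (i, j) \<in> \<alpha> \<and> FA F (i, j) \<cdot> u = FA F (i, j) \<cdot> u'"
proof -
  let ?H = "hom_functor C A :: (_, _, ('a + 'k) set, _) ftr"
  let ?P = "poset_cat \<alpha>" and ?S = "set_cat \<kappa> :: (('a + 'k) set, _) cat"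
  have colS: "is_colimit ?P ?S (ftr_comp ?H F) (FO ?H X) (\<lambda>i. FA ?H (\<iota> i))"
    using sm F colim unfolding ordinal_small_wrt_def preserves_colimits_of_def by blast
  have Ff: "is_functor ?P C F" using F by (simp add: chains_in_def chains_def)
  have P: "Obj ?P = Field \<alpha>" "Arr ?P = \<alpha>" "Dom ?P = fst" "Cod ?P = snd" "Idt ?P i = (i, i)"
    "Comp ?P q p = (fst p, snd q)" for i q p by (auto simp: poset_cat_def)
  note Fa = functor_arr[OF Ff, unfolded P]
  have co: "X \<in> Obj C" "\<iota> i \<in> Arr C" "Dom C (\<iota> i) = FO F i" "Cod C (\<iota> i) = X" if "i \<in> Field \<alpha>" for i
    using colim that unfolding is_colimit_def cocone_def P hom_def by auto
  have coc: "\<iota> j \<cdot> FA F (i, j) = \<iota> i" if "(i, j) \<in> \<alpha>" for i j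
    using colim that unfolding is_colimit_def cocone_def P by fastforce
  have hA: "small \<kappa> (Inl ` hom C A B :: ('a + 'k) set)" for B
    by (rule small_image[OF small_hom])
  have FAH: "FA ?H g = (Inl ` hom C A (Dom C g), (\<lambda>x\<in>Inl ` hom C A (Dom C g). Inl (g \<cdot> projl x)),
    Inl ` hom C A (Cod C g))" for g by (simp add: hom_functor_def)
  have FOH: "FO ?H B = Inl ` hom C A B" for B by (simp add: hom_functor_def)
  have S: "(T, h, T') \<in> hom ?S Y Y' \<longleftrightarrow> T = Y \<and> T' = Y' \<and> small \<kappa> Y \<and> small \<kappa> Y' \<and> h \<in> Y \<rightarrow>\<^sub>E Y'"
    for T h T' Y Y' by (auto simp: set_cat_def hom_def)
  have SC: "(Y, g, Z) \<cdot>\<^bsub>?S\<^esub> (T, h, Y') = (T, compose T g h, Z)" for Y g Z T h Y'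
    by (simp add: set_cat_def)
  interpret wo_rel \<alpha> using wo by (simp add: wo_rel_def)
  have refl: "(i, i) \<in> \<alpha>" if "i \<in> Field \<alpha>" for i
    using TOTALS that by blast
  have tr: "(i, l) \<in> \<alpha>" if "(i, j) \<in> \<alpha>" "(j, l) \<in> \<alpha>" for i j l
    using TRANS that by (rule transD)
  have tot: "(i, j) \<in> \<alpha> \<or> (j, i) \<in> \<alpha>" if "i \<in> Field \<alpha>" "j \<in> Field \<alpha>" for i j
    using TOTALS that by blast
  have Fi: "i \<in> Field \<alpha> \<and> j \<in> Field \<alpha>" if "(i, j) \<in> \<alpha>" for i j
    using that by (auto simp: Field_def)
  \<comment> \<open>The universal property in \<open>set_cat\<close> stripped of the tagging of
    arrows with their domains and codomains: a map from \<open>hom C A X\<close> to a small set is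
    the same as a compatible family of functions on the sets
    \<open>hom C A (FO F i)\<close>.\<close>
  have desc: "\<exists>!h :: 'a + 'k \<Rightarrow> 'a + 'k. h \<in> Inl ` hom C A X \<rightarrow>\<^sub>E T \<and>
      (\<forall>i\<in>Field \<alpha>. \<forall>w\<in>hom C A (FO F i). h (Inl (\<iota> i \<cdot> w)) = t i w)"
    if sT: "small \<kappa> (T :: ('a + 'k) set)"
      and t: "\<And>i w. i \<in> Field \<alpha> \<Longrightarrow> w \<in> hom C A (FO F i) \<Longrightarrow> t i w \<in> T"
      and tc: "\<And>i j w. (i, j) \<in> \<alpha> \<Longrightarrow> w \<in> hom C A (FO F i) \<Longrightarrow> t j (FA F (i, j) \<cdot> w) = t i w"
    for T t
  proof -
    define \<theta> :: "'k \<Rightarrow> ('a + 'k) set \<times> ('a + 'k \<Rightarrow> 'a + 'k) \<times> ('a + 'k) set" where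
      "\<theta> i = (Inl ` hom C A (FO F i), (\<lambda>x\<in>Inl ` hom C A (FO F i). t i (projl x)), T)" for i
    have FAw: "FA F (i, j) \<cdot> w \<in> hom C A (FO F j)" if "(i, j) \<in> \<alpha>" "w \<in> hom C A (FO F i)" for i j w
      using Fa(3-5)[OF that(1)] that(2) by (auto simp: hom_def)
    have "cocone ?P ?S (ftr_comp ?H F) T \<theta>"
      unfolding cocone_def P
    proof (intro conjI ballI)
      show "T \<in> Obj ?S" using sT by (simp add: set_cat_def)
      fix i assume "i \<in> Field \<alpha>"
      then show "\<theta> i \<in> hom ?S (FO (ftr_comp ?H F) i) T"
        unfolding \<theta>_def S by (auto simp: ftr_comp_def FOH hA sT t)
    next
      fix p assume p: "p \<in> \<alpha>"
      obtain i j where ij: "p = (i, j)" by (cases p)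
      have "compose (Inl ` hom C A (FO F i) :: ('a + 'k) set) (\<lambda>x\<in>Inl ` hom C A (FO F j). t j (projl x))
         (\<lambda>x\<in>Inl ` hom C A (FO F i). Inl (FA F (i, j) \<cdot> projl x)) =
         (\<lambda>x\<in>Inl ` hom C A (FO F i). t i (projl x))"
        by (rule ext) (use p ij FAw tc in \<open>auto simp: compose_def restrict_def\<close>)
      then show "\<theta> (snd p) \<cdot>\<^bsub>?S\<^esub> FA (ftr_comp ?H F) p = \<theta> (fst p)"
        using p Fa(3-5)[OF p] unfolding \<theta>_def ij by (simp add: ftr_comp_def FAH SC)
    qed
    then have ex: "\<exists>!h. h \<in> hom ?S (FO ?H X) T \<and> (\<forall>i\<in>Field \<alpha>. h \<cdot>\<^bsub>?S\<^esub> FA ?H (\<iota> i) = \<theta> i)"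
      using colS unfolding is_colimit_def P by blast
    have iff: "(Inl ` hom C A X, h, T) \<cdot>\<^bsub>?S\<^esub> FA ?H (\<iota> i) = \<theta> i \<longleftrightarrow>
        (\<forall>w\<in>hom C A (FO F i). h (Inl (\<iota> i \<cdot> w)) = t i w)" if i: "i \<in> Field \<alpha>" for h i
    proof -
      have "compose (Inl ` hom C A (FO F i) :: ('a + 'k) set) h (\<lambda>x\<in>Inl ` hom C A (FO F i). Inl (\<iota> i \<cdot> projl x)) =
          (\<lambda>x\<in>Inl ` hom C A (FO F i). t i (projl x)) \<longleftrightarrow>
          (\<forall>w\<in>hom C A (FO F i). h (Inl (\<iota> i \<cdot> w)) = t i w)" (is "?L = ?M \<longleftrightarrow> ?N")
      proof
        assume "?L = ?M"
        then have *: "?L (Inl w) = ?M (Inl w)" for w by simp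
        show ?N
        proof
          fix w assume "w \<in> hom C A (FO F i)"
          then have "(Inl w :: 'a + 'k) \<in> Inl ` hom C A (FO F i)" by (rule imageI)
          with *[of w] show "h (Inl (\<iota> i \<cdot> w)) = t i w" by (simp add: compose_def)
        qed
      next
        assume ?N
        then show "?L = ?M" by (intro ext) (auto simp: compose_def restrict_def)
      qed
      then show ?thesis using co[OF i] unfolding \<theta>_def by (simp add: FAH SC)
    qed
    have eqv: "(T0, h, T1) \<in> hom ?S (FO ?H X) T \<and> (\<forall>i\<in>Field \<alpha>. (T0, h, T1) \<cdot>\<^bsub>?S\<^esub> FA ?H (\<iota> i) = \<theta> i) \<longleftrightarrow>
        T0 = Inl ` hom C A X \<and> T1 = T \<and> h \<in> Inl ` hom C A X \<rightarrow>\<^sub>E T \<and>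
        (\<forall>i\<in>Field \<alpha>. \<forall>w\<in>hom C A (FO F i). h (Inl (\<iota> i \<cdot> w)) = t i w)" for T0 h T1
      unfolding S FOH using hA sT iff by auto
    obtain h0 where h0: "h0 \<in> hom ?S (FO ?H X) T \<and> (\<forall>i\<in>Field \<alpha>. h0 \<cdot>\<^bsub>?S\<^esub> FA ?H (\<iota> i) = \<theta> i)"
      and uni: "\<And>h. h \<in> hom ?S (FO ?H X) T \<and> (\<forall>i\<in>Field \<alpha>. h \<cdot>\<^bsub>?S\<^esub> FA ?H (\<iota> i) = \<theta> i) \<Longrightarrow> h = h0"
      using ex by blast
    obtain T0 h T1 where h0eq: "h0 = (T0, h, T1)" by (cases h0) 
    show ?thesis
    proof (rule ex1I[of _ h])
      show "h \<in> Inl ` hom C A X \<rightarrow>\<^sub>E T \<and>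
        (\<forall>i\<in>Field \<alpha>. \<forall>w\<in>hom C A (FO F i). h (Inl (\<iota> i \<cdot> w)) = t i w)"
        using h0 unfolding h0eq eqv by blast
      fix h' :: "'a + 'k \<Rightarrow> 'a + 'k"
      assume h': "h' \<in> Inl ` hom C A X \<rightarrow>\<^sub>E T \<and>
        (\<forall>i\<in>Field \<alpha>. \<forall>w\<in>hom C A (FO F i). h' (Inl (\<iota> i \<cdot> w)) = t i w)"
      have "(Inl ` hom C A X, h', T) = h0"
        by (rule uni, unfold eqv) (intro conjI HOL.refl h'[THEN conjunct1] h'[THEN conjunct2])
      then show "h' = h" by (simp add: h0eq)
    qed
  qed
  have \<iota>w: "\<iota> i \<cdot> w \<in> hom C A X" if "i \<in> Field \<alpha>" "w \<in> hom C A (FO F i)" for i w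
    using co[OF that(1)] that(2) by (auto simp: hom_def)
  have \<iota>c: "\<iota> j \<cdot> FA F (i, j) \<cdot> w = \<iota> i \<cdot> w" if "(i, j) \<in> \<alpha>" "w \<in> hom C A (FO F i)" for i j w
    using Comp_reassoc[OF _ _ _ _ _ coc[OF that(1)], of w] Fa(3-5)[OF that(1)] that(2) co Fi[OF that(1)]
    by (auto simp: hom_def)
  {
    assume u: "u \<in> hom C A X"
    text \<open>The union of the images admits a retraction from the colimit, which must be the identity.\<close>
    define T :: "('a + 'k) set" where "T = {Inl (\<iota> i \<cdot> w) | i w. i \<in> Field \<alpha> \<and> w \<in> hom C A (FO F i)}"
    have TX: "T \<subseteq> (Inl ` hom C A X :: ('a + 'k) set)" unfolding T_def using \<iota>w by auto
    then have sT: "small \<kappa> T" using hA small_subset by blast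
    have TI: "Inl (\<iota> i \<cdot> w) \<in> T" if "i \<in> Field \<alpha>" "w \<in> hom C A (FO F i)" for i w
      using that unfolding T_def by blast
    have "\<exists>!h :: 'a + 'k \<Rightarrow> 'a + 'k. h \<in> Inl ` hom C A X \<rightarrow>\<^sub>E T \<and>
        (\<forall>i\<in>Field \<alpha>. \<forall>w\<in>hom C A (FO F i). h (Inl (\<iota> i \<cdot> w)) = Inl (\<iota> i \<cdot> w))"
    proof (rule desc[OF sT])
      show "Inl (\<iota> i \<cdot> w) \<in> T" if "i \<in> Field \<alpha>" "w \<in> hom C A (FO F i)" for i w
        by (rule TI[OF that])
    qed (simp add: \<iota>c)
    then obtain h :: "'a + 'k \<Rightarrow> 'a + 'k" where h: "h \<in> (Inl ` hom C A X :: ('a + 'k) set) \<rightarrow>\<^sub>E T"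
      "\<forall>i\<in>Field \<alpha>. \<forall>w\<in>hom C A (FO F i). h (Inl (\<iota> i \<cdot> w)) = Inl (\<iota> i \<cdot> w)" by blast
    let ?X = "Inl ` hom C A X :: ('a + 'k) set"
    have "\<exists>!h. h \<in> ?X \<rightarrow>\<^sub>E ?X \<and>
        (\<forall>i\<in>Field \<alpha>. \<forall>w\<in>hom C A (FO F i). h (Inl (\<iota> i \<cdot> w)) = Inl (\<iota> i \<cdot> w))"
      by (rule desc) (use hA \<iota>w \<iota>c in auto)
    moreover have "h \<in> ?X \<rightarrow>\<^sub>E ?X" using h(1) TX by (auto simp: PiE_iff)
    moreover have "(\<lambda>x\<in>?X. x) \<in> ?X \<rightarrow>\<^sub>E ?X" by auto
    moreover have "\<forall>i\<in>Field \<alpha>. \<forall>w\<in>hom C A (FO F i). (\<lambda>x\<in>?X. x) (Inl (\<iota> i \<cdot> w)) = Inl (\<iota> i \<cdot> w)"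
      using \<iota>w by auto
    ultimately have "h = (\<lambda>x\<in>?X. x)" using h(2) by blast
    then have "Inl u \<in> T" using h(1) u by (auto simp: PiE_iff)
    then show "\<exists>i\<in>Field \<alpha>. \<exists>u'\<in>hom C A (FO F i). \<iota> i \<cdot> u' = u" unfolding T_def by blast
  next
    assume i: "i \<in> Field \<alpha>" and u: "u \<in> hom C A (FO F i)" "u' \<in> hom C A (FO F i)"
      and eq: "\<iota> i \<cdot> u = \<iota> i \<cdot> u'"
    text \<open>The elements eventually equal to \<open>u\<close> have a compatible family of indicator functions.\<close>
    define t :: "'k \<Rightarrow> 'a \<Rightarrow> 'a + 'k" where
      "t j w = (if \<exists>l. (i, l) \<in> \<alpha> \<and> (j, l) \<in> \<alpha> \<and> FA F (i, l) \<cdot> u = FA F (j, l) \<cdot> w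
         then Inl undefined else Inr undefined)" for j w
    have Fc: "FA F (j, l) \<cdot> FA F (i, j) \<cdot> w = FA F (i, l) \<cdot> w"
      if "(i, j) \<in> \<alpha>" "(j, l) \<in> \<alpha>" "w \<in> hom C A (FO F i)" for i j l w
    proof -
      have e: "FA F (j, l) \<cdot> FA F (i, j) = FA F (i, l)" using Fa(6)[OF that(1,2)] by simp
      show ?thesis
        using Comp_reassoc[OF _ _ _ _ _ e, of w] Fa(3-5)[OF that(1)] Fa(3-5)[OF that(2)] that(3)
        by (auto simp: hom_def)
    qed
    have tc: "t j' (FA F (j, j') \<cdot> w) = t j w" if jj: "(j, j') \<in> \<alpha>" and w: "w \<in> hom C A (FO F j)" for j j' w
    proof -
      have "(\<exists>l. (i, l) \<in> \<alpha> \<and> (j', l) \<in> \<alpha> \<and> FA F (i, l) \<cdot> u = FA F (j', l) \<cdot> FA F (j, j') \<cdot> w) \<longleftrightarrow>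
        (\<exists>l. (i, l) \<in> \<alpha> \<and> (j, l) \<in> \<alpha> \<and> FA F (i, l) \<cdot> u = FA F (j, l) \<cdot> w)"
      proof
        assume "\<exists>l. (i, l) \<in> \<alpha> \<and> (j', l) \<in> \<alpha> \<and> FA F (i, l) \<cdot> u = FA F (j', l) \<cdot> FA F (j, j') \<cdot> w"
        then show "\<exists>l. (i, l) \<in> \<alpha> \<and> (j, l) \<in> \<alpha> \<and> FA F (i, l) \<cdot> u = FA F (j, l) \<cdot> w"
          using tr[OF jj] Fc[OF jj _ w] by auto
      next
        assume "\<exists>l. (i, l) \<in> \<alpha> \<and> (j, l) \<in> \<alpha> \<and> FA F (i, l) \<cdot> u = FA F (j, l) \<cdot> w"
        then obtain l where l: "(i, l) \<in> \<alpha>" "(j, l) \<in> \<alpha>" "FA F (i, l) \<cdot> u = FA F (j, l) \<cdot> w" by blast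
        obtain l' where l': "(l, l') \<in> \<alpha>" "(j', l') \<in> \<alpha>"
          using tot[of l j'] refl Fi[OF l(1)] Fi[OF jj] by blast
        have "FA F (i, l') \<cdot> u = FA F (j', l') \<cdot> FA F (j, j') \<cdot> w"
          using Fc[OF l(1) l'(1) u(1)] Fc[OF l(2) l'(1) w] Fc[OF jj l'(2) w] l(3) by simp
        then show "\<exists>l. (i, l) \<in> \<alpha> \<and> (j', l) \<in> \<alpha> \<and> FA F (i, l) \<cdot> u = FA F (j', l) \<cdot> FA F (j, j') \<cdot> w"
          using tr[OF l(1) l'(1)] l'(2) by blast
      qed
      then show ?thesis by (simp add: t_def)
    qed
    have "\<exists>!h :: 'a + 'k \<Rightarrow> 'a + 'k. h \<in> Inl ` hom C A X \<rightarrow>\<^sub>E {Inl undefined, Inr undefined} \<and>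
        (\<forall>i\<in>Field \<alpha>. \<forall>w\<in>hom C A (FO F i). h (Inl (\<iota> i \<cdot> w)) = t i w)"
    proof (rule desc)
      show "small \<kappa> {Inl undefined, Inr undefined :: 'a + 'k}" by (rule small_finite) simp
      show "t j w \<in> {Inl undefined, Inr undefined}" for j w by (simp add: t_def)
    qed (rule tc)
    then obtain h :: "'a + 'k \<Rightarrow> 'a + 'k" where
      h: "\<forall>i\<in>Field \<alpha>. \<forall>w\<in>hom C A (FO F i). h (Inl (\<iota> i \<cdot> w)) = t i w" by blast
    have "t i u = t i u'" using h i u eq by metis
    moreover have "t i u = Inl undefined" unfolding t_def using refl[OF i] by auto
    ultimately have "\<exists>l. (i, l) \<in> \<alpha> \<and> (i, l) \<in> \<alpha> \<and> FA F (i, l) \<cdot> u = FA F (i, l) \<cdot> u'"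
      unfolding t_def by (auto split: if_splits)
    then show "\<exists>j. (i, j) \<in> \<alpha> \<and> FA F (i, j) \<cdot> u = FA F (i, j) \<cdot> u'" by blast
  }
qed

section \<open>Stabilisation of the \<open>E\<close>-parts\<close>

context lifting_chain begin

lemma small_bounded_lt:
  assumes "small \<kappa> B" "B \<subseteq> Field \<kappa>"
  shows "\<exists>p\<in>Field \<kappa>. \<forall>b\<in>B. lt b p"
  using small_bounded[OF assms] by (auto simp: lt_def)

context
  fixes E M
  assumes fs: "factorisation_system C E M" and epic: "\<And>e. e \<in> E \<Longrightarrow> epic C e"
    and cwp: "co_well_powered \<kappa> C E"
begin

lemma E_iff: "e \<in> E \<longleftrightarrow> e \<in> Arr C \<and> (\<forall>m\<in>M. orthogonal C e m)"
  and M_iff: "m \<in> M \<longleftrightarrow> m \<in> Arr C \<and> (\<forall>e\<in>E. orthogonal C e m)"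
  using fs unfolding factorisation_system_def by blast+

lemma E_arr: "e \<in> E \<Longrightarrow> e \<in> Arr C" and M_arr: "m \<in> M \<Longrightarrow> m \<in> Arr C"
  and EM_orthogonal: "e \<in> E \<Longrightarrow> m \<in> M \<Longrightarrow> orthogonal C e m"
  using E_iff M_iff by blast+

lemma M_cancel: "m \<cdot> n \<in> M \<Longrightarrow> m \<in> M \<Longrightarrow> n \<in> Arr C \<Longrightarrow> Cod C n = Dom C m \<Longrightarrow> n \<in> M"
  using orthogonal_cancel M_iff by blast

lemma M_Idt: "A \<in> Obj C \<Longrightarrow> Idt C A \<in> M"
  using orthogonal_Idt M_iff by simp

lemma M_iso:
  assumes "m \<in> M" "i \<in> Arr C" "Cod C i = Dom C m" "k \<in> Arr C" "Dom C k = Cod C i" "Cod C k = Dom C i"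
    "i \<cdot> k = Idt C (Cod C i)" "k \<cdot> i = Idt C (Dom C i)"
  shows "m \<cdot> i \<in> M"
  using orthogonal_iso_right[OF EM_orthogonal M_arr] assms M_arr[OF assms(1)]
  by (simp add: M_iff)

lemma epic_cancel:
  "e \<in> E \<Longrightarrow> g \<in> Arr C \<Longrightarrow> h \<in> Arr C \<Longrightarrow> Dom C g = Cod C e \<Longrightarrow> Dom C h = Cod C e \<Longrightarrow>
    Cod C g = Cod C h \<Longrightarrow> g \<cdot> e = h \<cdot> e \<Longrightarrow> g = h"
  using epic unfolding epic_def by blast

text \<open>
  Of the factorisations of the maps out of a fixed stage, those with a given \<open>E\<close>-part occur
  unboundedly often for some \<open>E\<close>-part, because there are few \<open>E\<close>-parts; from then on the
  \<open>E\<close>-part is constant.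
\<close>

lemma stabilises:
  assumes n: "n \<in> Field \<kappa>"
  shows "\<exists>s p m. s \<in> E \<and> Dom C s = ob n \<and> lt n p \<and> m \<in> M \<and> Dom C m = Cod C s \<and> Cod C m = ob p \<and>
    m \<cdot> s = con n p \<and> (\<forall>q. lt p q \<longrightarrow> con p q \<cdot> m \<in> M)"
proof -
  have "ob n \<in> Obj C" by simp
  with cwp obtain S where S1: "S \<subseteq> {e \<in> E. Dom C e = ob n} \<and> small \<kappa> S \<and>
      (\<forall>e\<in>E. Dom C e = ob n \<longrightarrow>
         (\<exists>s\<in>S. \<exists>i\<in>hom C (Cod C s) (Cod C e). is_iso C i \<and> i \<cdot> s = e))"
    unfolding co_well_powered_def by meson
  then have S: "S \<subseteq> {e \<in> E. Dom C e = ob n}" "small \<kappa> S"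
    "\<And>e. e \<in> E \<Longrightarrow> Dom C e = ob n \<Longrightarrow>
       \<exists>s\<in>S. \<exists>i\<in>hom C (Cod C s) (Cod C e). is_iso C i \<and> i \<cdot> s = e"
    by blast+
  have "\<exists>s m. s \<in> S \<and> m \<in> M \<and> Dom C m = Cod C s \<and> Cod C m = ob p \<and> m \<cdot> s = con n p" if p: "lt n p" for p
  proof -
    obtain e m where em: "e \<in> E" "m \<in> M" "Cod C e = Dom C m" "con n p = m \<cdot> e"
      using fs con(1)[OF p] unfolding factorisation_system_def by blast
    have a: "e \<in> Arr C" "m \<in> Arr C" using em E_arr M_arr by auto
    have d: "Dom C e = ob n" "Cod C m = ob p"
      using arg_cong[OF em(4), of "Dom C"] arg_cong[OF em(4), of "Cod C"] a em(3) p by simp_all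
    obtain s i where s: "s \<in> S" "i \<in> hom C (Cod C s) (Cod C e)" "is_iso C i" "i \<cdot> s = e"
      using S(3)[OF em(1) d(1)] by blast
    have i: "i \<in> Arr C" "Dom C i = Cod C s" "Cod C i = Dom C m" using s(2) em(3) by (auto simp: hom_def)
    obtain k where k: "k \<in> Arr C" "Dom C k = Cod C i" "Cod C k = Dom C i" "k \<cdot> i = Idt C (Dom C i)"
      "i \<cdot> k = Idt C (Cod C i)" using s(3) by (auto simp: is_iso_def hom_def)
    have "m \<cdot> i \<in> M" by (rule M_iso[OF em(2) i(1,3) k(1,2,3,5,4)])
    moreover have "s \<in> Arr C" using s(1) S(1) E_arr by auto
    then have "(m \<cdot> i) \<cdot> s = con n p" using a i em(4) s(4) by (simp add: Comp_assoc)
    ultimately show ?thesis using s(1) i a d by (intro exI[of _ s] exI[of _ "m \<cdot> i"]) simp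
  qed
  then obtain s m where sm: "\<And>p. lt n p \<Longrightarrow> s p \<in> S \<and> m p \<in> M \<and> Dom C (m p) = Cod C (s p) \<and>
    Cod C (m p) = ob p \<and> m p \<cdot> s p = con n p" by metis
  have sE: "s p \<in> E" "Dom C (s p) = ob n" "s p \<in> Arr C" "m p \<in> M" "m p \<in> Arr C"
    "Dom C (m p) = Cod C (s p)" "Cod C (m p) = ob p" "m p \<cdot> s p = con n p" if "lt n p" for p
    using sm[OF that] S(1) E_arr M_arr by auto
  \<comment> \<open>Otherwise each \<open>x\<close> in \<open>S\<close> stops occurring beyond some
    bound \<open>b x\<close>. The bounds form a small set, so some \<open>p\<close> lies beyond all
    of them, and \<open>s p\<close> contradicts its own bound.\<close>
  have "\<exists>x\<in>S. \<forall>b\<in>Field \<kappa>. \<exists>p. lt b p \<and> lt n p \<and> s p = x"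
  proof (rule ccontr)
    assume "\<not> ?thesis"
    then obtain b where b: "\<And>x. x \<in> S \<Longrightarrow> b x \<in> Field \<kappa>"
      "\<And>x p. x \<in> S \<Longrightarrow> lt (b x) p \<Longrightarrow> lt n p \<Longrightarrow> s p \<noteq> x" by metis
    have "small \<kappa> ({n} \<union> b ` S)" by (intro small_Un small_image S(2) small_finite) simp
    then obtain p where p: "lt n p" "\<And>x. x \<in> S \<Longrightarrow> lt (b x) p"
      using small_bounded_lt[of "{n} \<union> b ` S"] b(1) n by auto
    show False using b(2)[of "s p" p] p sm by blast
  qed
  then obtain x where x: "x \<in> S" "\<And>b. b \<in> Field \<kappa> \<Longrightarrow> \<exists>p. lt b p \<and> lt n p \<and> s p = x" by blast
  obtain p where p: "lt n p" "s p = x" using x(2)[OF n] by blast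
  have "con p q \<cdot> m p \<in> M" if q: "lt p q" for q
  proof -
    have nq: "lt n q" using p q lt_trans by blast
    \<comment> \<open>The \<open>E\<close>-part seen at \<open>p\<close> recurs at \<open>r\<close>,
      beyond \<open>q\<close>. Orthogonality gives \<open>d\<close> from the part at
      \<open>p\<close> to the one at \<open>q\<close> and \<open>k\<close> from there to the one at
      \<open>r\<close>, which is the first again; since \<open>E\<close>-maps are epic,
      \<open>d\<close> and \<open>k\<close> are mutually inverse.\<close>
    obtain r where r: "lt q r" "s r = x" using x(2)[OF lt_Field(2)[OF q]] by blast
    have nr: "lt n r" using nq r lt_trans by blast
    note P = sE[OF p(1)] and Q = sE[OF nq] and R = sE[OF nr]
    have "(con p q \<cdot> m p) \<cdot> s p = con n q"
      using P q con_con[OF p(1) q] by (simp add: Comp_assoc)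
    then have "Sq (s p) (m q) (s q) (con p q \<cdot> m p) \<in> csquares C"
      using P Q q by (simp add: csquares_iff)
    then obtain d where d: "d \<in> Arr C" "Dom C d = Cod C (s p)" "Cod C d = Cod C (s q)"
      "d \<cdot> s p = s q" "m q \<cdot> d = con p q \<cdot> m p"
      using orthogonalD[OF EM_orthogonal[OF P(1) Q(4)]] Q(6) by metis
    have "(con q r \<cdot> m q) \<cdot> s q = con n r"
      using Q r con_con[OF nq r(1)] by (simp add: Comp_assoc)
    then have "Sq (s q) (m r) (s p) (con q r \<cdot> m q) \<in> csquares C"
      using P Q R r p(2) by (simp add: csquares_iff)
    then obtain k where k: "k \<in> Arr C" "Dom C k = Cod C (s q)" "Cod C k = Cod C (s p)"
      "k \<cdot> s q = s p"
      using orthogonalD[OF EM_orthogonal[OF Q(1) R(4)]] R(6) r(2) p(2) by metis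
    have "k \<cdot> d = Idt C (Cod C (s p))"
      by (rule epic_cancel[OF P(1)]) (use P Q d k in \<open>simp_all add: Comp_assoc\<close>)
    moreover have "d \<cdot> k = Idt C (Cod C (s q))"
      by (rule epic_cancel[OF Q(1)]) (use P Q d k in \<open>simp_all add: Comp_assoc\<close>)
    ultimately have "m q \<cdot> d \<in> M" by (intro M_iso[of _ _ k]) (use Q d k in simp_all)
    then show ?thesis by (simp add: d(5))
  qed
  then show ?thesis using sE[OF p(1)] p(1) by blast
qed

section \<open>Limit stages as colimits of cofinal families of stages\<close>

lemma con_gen:
  assumes "lt m n" "x \<in> gens D m"
  shows "con m n \<cdot> snd (D m) x = snd (D n) x"
  using assms con_con con_fill by (cases x) auto

lemma gen_arr: "x \<in> gens D n \<Longrightarrow> snd (D n) x \<in> Arr C" "x \<in> gens D n \<Longrightarrow> Dom C (snd (D n) x) = gdom D x"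
  "x \<in> gens D n \<Longrightarrow> Cod C (snd (D n) x) = ob n"
  using stage_arr(3-5)[OF stage_D] by auto

text \<open>Each generator and each relation of stage \<open>n\<close> occurs already at some
  \<open>g i\<close>, so a compatible family on these stages is a model of the presentation of stage
  \<open>n\<close>. Compatibility \<open>yc\<close> concerns strictly smaller indices, and
  \<open>yeq\<close> covers coincidences of the possibly non-injective \<open>g\<close>.\<close>

lemma limit_stage_universal:
  fixes g :: "'i \<Rightarrow> 'k"
  assumes g: "\<And>i. i \<in> I \<Longrightarrow> lt (g i) n" and cof: "\<And>m. lt m n \<Longrightarrow> \<exists>i\<in>I. lt m (g i)"
    and ne: "I \<noteq> {}"
    and y: "\<And>i. i \<in> I \<Longrightarrow> y i \<in> Arr C \<and> Dom C (y i) = ob (g i) \<and> Cod C (y i) = Z" and Z: "Z \<in> Obj C"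
    and yc: "\<And>i j. i \<in> I \<Longrightarrow> j \<in> I \<Longrightarrow> lt (g i) (g j) \<Longrightarrow> y j \<cdot> con (g i) (g j) = y i"
    and yeq: "\<And>i j. i \<in> I \<Longrightarrow> j \<in> I \<Longrightarrow> g i = g j \<Longrightarrow> y i = y j"
  shows "\<exists>h. h \<in> Arr C \<and> Dom C h = ob n \<and> Cod C h = Z \<and> (\<forall>i\<in>I. h \<cdot> con (g i) n = y i)"
proof -
  have ycon: "y j \<cdot> con (g i) (g j) \<cdot> w = y i \<cdot> w"
    if "i \<in> I" "j \<in> I" "lt (g i) (g j)" "w \<in> Arr C" "Cod C w = ob (g i)" for i j w
    using Comp_reassoc[OF _ _ _ _ _ yc[OF that(1-3)], of w] y that by simp
  have indep: "y i \<cdot> snd (D (g i)) x = y j \<cdot> snd (D (g j)) x"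
    if ij: "i \<in> I" "j \<in> I" and x: "x \<in> gens D (g i)" "x \<in> gens D (g j)" for i j x
  proof -
    have *: "y i \<cdot> snd (D (g i)) x = y j \<cdot> snd (D (g j)) x"
      if "i \<in> I" "j \<in> I" "x \<in> gens D (g i)" "lt (g i) (g j)" for i j
      using ycon[OF that(1,2,4), of "snd (D (g i)) x"] gen_arr that con_gen[OF that(4,3)] by simp
    consider "g i = g j" | "lt (g i) (g j)" | "lt (g j) (g i)"
      using lt_total[OF lt_Field(1)[OF g[OF ij(1)]] lt_Field(1)[OF g[OF ij(2)]]] by blast
    then show ?thesis
    proof cases
      case 1
      then show ?thesis using yeq[OF ij 1] by simp
    next
      case 2
      then show ?thesis by (rule *[OF ij x(1)])
    next
      case 3
      then show ?thesis by (rule *[OF ij(2,1) x(2), symmetric])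
    qed
  qed
  have early: "\<exists>i\<in>I. x \<in> gens D (g i)" if "x \<in> gens D n" for x
    using that cof ne by (cases x) auto
  \<comment> \<open>A generator is evaluated at any stage of the family in which it occurs;
    \<open>indep\<close> makes the choice irrelevant.\<close>
  define \<tau> where "\<tau> x = (let i = SOME i. i \<in> I \<and> x \<in> gens D (g i) in y i \<cdot> snd (D (g i)) x)" for x
  have \<tau>: "\<tau> x = y i \<cdot> snd (D (g i)) x" if "i \<in> I" "x \<in> gens D (g i)" for x i
  proof -
    have k: "(SOME i. i \<in> I \<and> x \<in> gens D (g i)) \<in> I \<and> x \<in> gens D (g (SOME i. i \<in> I \<and> x \<in> gens D (g i)))"
      using someI[of "\<lambda>i. i \<in> I \<and> x \<in> gens D (g i)" i] that by blast
    show ?thesis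
      unfolding \<tau>_def Let_def
      by (rule indep[OF k[THEN conjunct1] that(1) k[THEN conjunct2] that(2)])
  qed
  have rel_early: "\<exists>i\<in>I. rel D (g i) x a z b" if "rel D n x a z b" for x a z b
    using that
  proof (induct rule: rel.induct)
    case (rel_base m)
    then show ?case using cof[of m] rel.rel_base[of m _ D] by blast
  next
    case (rel_old l m)
    then show ?case using cof[of m] rel.rel_old[of l m _ D] by blast
  next
    case (rel_fill m j u v)
    then show ?case using cof[of m] rel.rel_fill[of m _ D j u v] by blast
  next
    case (rel_move l m j u v)
    then show ?case using cof[of m] rel.rel_move[of l m _ D j u v] by blast
  next
    case (rel_old_fill l m j u v)
    then show ?case using cof[of m] rel.rel_old_fill[of l m _ D j u v] by blast
  next
    case (rel_horizontal m r s t)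
    then show ?case using cof[of m] rel.rel_horizontal[of m _ r D s t] by blast
  next
    case (rel_vertical l m i j s t)
    then show ?case using cof[of m] rel.rel_vertical[of l m _ i j D s t] by blast
  qed
  have "\<tau> x \<in> Arr C \<and> Dom C (\<tau> x) = gdom D x \<and> Cod C (\<tau> x) = Z" if x: "x \<in> gens D n" for x
  proof -
    obtain i where i: "i \<in> I" "x \<in> gens D (g i)" using early[OF x] by blast
    show ?thesis using \<tau>[OF i] y[OF i(1)] gen_arr[OF i(2)] by simp
  qed
  moreover have "\<tau> x \<cdot> a = \<tau> z \<cdot> b" if r: "rel D n x a z b" for x a z b
  proof -
    obtain i where i: "i \<in> I" and r: "rel D (g i) x a z b" using rel_early[OF r] by blast
    have t: "x \<in> gens D (g i) \<and> z \<in> gens D (g i) \<and> a \<in> Arr C \<and> b \<in> Arr C \<and> Cod C a = gdom D x \<and>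
      Cod C b = gdom D z" using rel_typed[OF stage_D r] by blast
    have "snd (D (g i)) x \<cdot> a = snd (D (g i)) z \<cdot> b" by (rule stage_arr(7)[OF stage_D r])
    then show ?thesis using \<tau>[OF i, of x] \<tau>[OF i, of z] t y[OF i] gen_arr by (simp add: Comp_assoc)
  qed
  ultimately have "model (gens D n) (gdom D) (rels D n) Z \<tau>"
    using Z by (auto simp: model_def rels_def)
  then obtain h where "h \<in> hom C (ob n) Z" and h\<tau>: "\<And>x. x \<in> gens D n \<Longrightarrow> h \<cdot> snd (D n) x = \<tau> x"
    using stage_presented[of n] unfolding presented_def by blast
  then have h: "h \<in> Arr C" "Dom C h = ob n" "Cod C h = Z" by (auto simp: hom_def)
  have "h \<cdot> con (g i) n = y i" if i: "i \<in> I" for i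
  proof -
    obtain j where j: "j \<in> I" "lt (g i) (g j)" using cof[OF g[OF i]] by blast
    have "h \<cdot> con (g i) n = \<tau> (Old (g i))" using h\<tau>[of "Old (g i)"] g[OF i] by simp
    also have "\<dots> = y j \<cdot> con (g i) (g j)" using \<tau>[OF j(1), of "Old (g i)"] j(2) by simp
    also have "\<dots> = y i" by (rule yc[OF i j])
    finally show ?thesis .
  qed
  with h show ?thesis by blast
qed

lemma limit_stage_ext:
  assumes g: "\<And>i. i \<in> I \<Longrightarrow> lt (g i) n" and cof: "\<And>m. lt m n \<Longrightarrow> \<exists>i\<in>I. lt m (g i)"
    and ne: "I \<noteq> {}"
    and h: "h \<in> Arr C" "h' \<in> Arr C" "Dom C h = ob n" "Dom C h' = ob n" "Cod C h = Cod C h'"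
    and eq: "\<And>i. i \<in> I \<Longrightarrow> h \<cdot> con (g i) n = h' \<cdot> con (g i) n"
  shows "h = h'"
proof (rule stage_ext[OF h])
  fix x assume x: "x \<in> gens D n"
  obtain i where i: "i \<in> I" "x \<in> gens D (g i)" using x cof ne by (cases x) auto
  have "h \<cdot> snd (D n) x = (h \<cdot> con (g i) n) \<cdot> snd (D (g i)) x"
    using con_gen[OF g[OF i(1)] i(2)] h g[OF i(1)] gen_arr[OF i(2)] by (simp add: Comp_assoc)
  also have "\<dots> = (h' \<cdot> con (g i) n) \<cdot> snd (D (g i)) x" using eq[OF i(1)] by simp
  also have "\<dots> = h' \<cdot> snd (D n) x"
    using con_gen[OF g[OF i(1)] i(2)] h g[OF i(1)] gen_arr[OF i(2)] by (simp add: Comp_assoc)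
  finally show "h \<cdot> snd (D n) x = h' \<cdot> snd (D n) x" .
qed

text \<open>With \<open>S i\<close> the stable \<open>E\<close>-part of stage \<open>g i\<close> and
  \<open>T i\<close> a stage where it has stabilised, the objects \<open>ob (g i)\<close>,
  \<open>Cod C (S i)\<close>, \<open>ob (T i)\<close>, \<open>ob (g j)\<close> follow one another
  whenever \<open>i\<close> is before \<open>j\<close>. The \<open>Cod C (S i)\<close> form a chain
  in \<open>M\<close> with colimit \<open>ob n\<close>, to which smallness applies, and the
  interleaving transfers its consequences to the stages.\<close>

lemma converges_exists:
  fixes \<alpha> :: "'k rel"
  assumes \<alpha>: "limit_ordinal \<kappa> \<alpha>"
    and sm: "\<And>A. A \<in> Obj (Hor J) \<Longrightarrow> ordinal_small_wrt \<kappa> C \<alpha> M (DO U A)"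
  shows "\<exists>n. converges n"
proof -
  have wo: "Well_order \<alpha>" and sF: "small \<kappa> (Field \<alpha>)" and neF: "Field \<alpha> \<noteq> {}"
    and lim: "\<And>i. i \<in> Field \<alpha> \<Longrightarrow> \<exists>j\<in>Field \<alpha>. i \<noteq> j \<and> (i, j) \<in> \<alpha>"
    using \<alpha> unfolding limit_ordinal_def by blast+
  interpret A: wo_rel \<alpha> using wo by (simp add: wo_rel_def)
  define la where "la i j \<longleftrightarrow> (i, j) \<in> \<alpha> \<and> i \<noteq> j" for i j
  have la_iff: "(i, j) \<in> \<alpha> \<longleftrightarrow> i \<in> Field \<alpha> \<and> j \<in> Field \<alpha> \<and> (i = j \<or> la i j)" for i j
    using A.TOTALS by (auto simp: la_def Field_def)
  have la_total: "i = j \<or> la i j \<or> la j i" if "i \<in> Field \<alpha>" "j \<in> Field \<alpha>" for i j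
    using A.TOTALS that by (auto simp: la_def)
  have la_asym: "\<not> la j i" if "la i j" for i j
    using A.ANTISYM that by (auto simp: la_def antisym_def)
  have la_Field: "i \<in> Field \<alpha>" "j \<in> Field \<alpha>" if "la i j" for i j using that by (auto simp: la_def Field_def)
  have la_lim: "\<exists>j. la i j" if "i \<in> Field \<alpha>" for i using lim[OF that] by (auto simp: la_def)
  obtain s \<sigma> m where st: "\<And>n. n \<in> Field \<kappa> \<Longrightarrow> s n \<in> E \<and> Dom C (s n) = ob n \<and> lt n (\<sigma> n) \<and> m n \<in> M \<and>
     Dom C (m n) = Cod C (s n) \<and> Cod C (m n) = ob (\<sigma> n) \<and> m n \<cdot> s n = con n (\<sigma> n) \<and>
     (\<forall>q. lt (\<sigma> n) q \<longrightarrow> con (\<sigma> n) q \<cdot> m n \<in> M)"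
    using stabilises by metis
  \<comment> \<open>Each value of \<open>g\<close> must lie beyond the stabilisation stages of all
    earlier ones; such an index exists because \<alpha> is small and \<kappa> is regular.\<close>
  have "\<exists>g. \<forall>i. g i \<in> Field \<kappa> \<and> (\<forall>j. la j i \<longrightarrow> lt (\<sigma> (g j)) (g i))"
  proof (rule dependent_wf_choice[of "\<alpha> - Id" "\<lambda>g i x. x \<in> Field \<kappa> \<and> (\<forall>j. la j i \<longrightarrow> lt (\<sigma> (g j)) x)"])
    show "wf (\<alpha> - Id)" by (rule A.WF)
    show "(r \<in> Field \<kappa> \<and> (\<forall>j. la j x \<longrightarrow> lt (\<sigma> (f j)) r)) = (r \<in> Field \<kappa> \<and> (\<forall>j. la j x \<longrightarrow> lt (\<sigma> (g j)) r))"
      if "\<And>z. (z, x) \<in> \<alpha> - Id \<Longrightarrow> f z = g z" for f g :: "'k \<Rightarrow> 'k" and x r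
      using that by (auto simp: la_def)
    fix x and g :: "'k \<Rightarrow> 'k"
    assume g: "\<And>y. (y, x) \<in> \<alpha> - Id \<Longrightarrow> g y \<in> Field \<kappa> \<and> (\<forall>j. la j y \<longrightarrow> lt (\<sigma> (g j)) (g y))"
    have "{j. la j x} \<subseteq> Field \<alpha>" using la_Field by blast
    then have 1: "small \<kappa> ((\<lambda>j. \<sigma> (g j)) ` {j. la j x})" using small_subset[OF sF] small_image by blast
    have 2: "(\<lambda>j. \<sigma> (g j)) ` {j. la j x} \<subseteq> Field \<kappa>"
      using g st lt_Field(2) by (fastforce simp: la_def)
    show "\<exists>r. r \<in> Field \<kappa> \<and> (\<forall>j. la j x \<longrightarrow> lt (\<sigma> (g j)) r)"
      using small_bounded_lt[OF 1 2] by auto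
  qed
  then obtain g where gF: "\<And>i. g i \<in> Field \<kappa>" and g\<sigma>: "\<And>i j. la i j \<Longrightarrow> lt (\<sigma> (g i)) (g j)" by blast
  note st = st[OF gF]
  define S where "S i = s (g i)" for i
  define T where "T i = \<sigma> (g i)" for i
  define N where "N i = m (g i)" for i
  have SE: "S i \<in> E" and SN [simp]: "S i \<in> Arr C" "Dom C (S i) = ob (g i)"
      "N i \<in> Arr C" "Dom C (N i) = Cod C (S i)" "Cod C (N i) = ob (T i)" "N i \<cdot> S i = con (g i) (T i)"
    and gT: "lt (g i) (T i)" and NM: "N i \<in> M" and conN: "lt (T i) q \<Longrightarrow> con (T i) q \<cdot> N i \<in> M" for i q
    using st[of i] E_arr M_arr by (auto simp: S_def T_def N_def)
  have Tg: "lt (T i) (g j)" if "la i j" for i j using g\<sigma>[OF that] by (simp add: T_def)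
  have gg: "lt (g i) (g j)" if "la i j" for i j using lt_trans[OF gT Tg[OF that]] .
  have TT: "lt (T i) (T j)" if "la i j" for i j using lt_trans[OF Tg[OF that] gT] .
  have gT': "lt (g i) (T j)" if "la i j" for i j using lt_trans[OF gg[OF that] gT] .
  \<comment> \<open>The index \<open>n\<close> is the least strict upper bound of the
    \<open>g i\<close>. Minimality and the absence of a last element in \<alpha> make the
    \<open>g i\<close> cofinal below \<open>n\<close>.\<close>
  let ?U = "{p. \<forall>i\<in>Field \<alpha>. lt (g i) p}"
  have "\<exists>p. p \<in> ?U"
    using small_bounded_lt[OF small_image[OF sF, of g]] gF by blast
  then obtain n where n: "n \<in> ?U" "\<And>p. lt p n \<Longrightarrow> p \<notin> ?U"
    using wf_lt unfolding wf_eq_minimal by (metis (mono_tags, lifting) case_prodI mem_Collect_eq)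
  have gn: "lt (g i) n" if "i \<in> Field \<alpha>" for i using n(1) that by blast
  have cof: "\<exists>i\<in>Field \<alpha>. lt p (g i)" if p: "lt p n" for p
  proof -
    obtain i where i: "i \<in> Field \<alpha>" "\<not> lt (g i) p" using n(2)[OF p] by blast
    obtain j where j: "la i j" using la_lim[OF i(1)] by blast
    have "p = g i \<or> lt p (g i)" using lt_total[OF lt_Field(1)[OF p] gF[of i]] i(2) by blast
    then have "lt p (g j)" using gg[OF j] lt_trans by blast
    then show ?thesis using la_Field(2)[OF j] by blast
  qed
  have Tn: "lt (T i) n" if i: "i \<in> Field \<alpha>" for i
  proof -
    obtain j where j: "la i j" using la_lim[OF i] by blast
    show ?thesis using lt_trans[OF Tg[OF j] gn[OF la_Field(2)[OF j]]] .
  qed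
  define Q where "Q i j = (if i = j then Idt C (Cod C (S i)) else S j \<cdot> con (T i) (g j) \<cdot> N i)" for i j
  have Q_id [simp]: "Q i i = Idt C (Cod C (S i))" for i by (simp add: Q_def)
  have Q_la: "Q i j = S j \<cdot> con (T i) (g j) \<cdot> N i" if "la i j" for i j
    using that by (auto simp: Q_def la_def)
  have Q_arr: "Q i j \<in> Arr C" "Dom C (Q i j) = Cod C (S i)" "Cod C (Q i j) = Cod C (S j)"
    if "i = j \<or> la i j" for i j
    using that Tg[of i j] by (auto simp: Q_la)
  have NQ: "N j \<cdot> Q i j = con (T i) (T j) \<cdot> N i" if ij: "la i j" for i j
  proof -
    have "N j \<cdot> Q i j = con (g j) (T j) \<cdot> con (T i) (g j) \<cdot> N i"
      unfolding Q_la[OF ij] using Tg[OF ij] Comp_reassoc[OF _ _ _ _ _ SN(6)[of j], of "con (T i) (g j) \<cdot> N i"]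
      by simp
    then show ?thesis using con_con_comp[OF Tg[OF ij] gT, of "N i"] by simp
  qed
  have QS: "Q i j \<cdot> S i = S j \<cdot> con (g i) (g j)" if ij: "la i j" for i j
    unfolding Q_la[OF ij] using Tg[OF ij] gT con_con[OF gT Tg[OF ij]] gg[OF ij] by (simp add: Comp_assoc)
  have Q_M: "Q i j \<in> M" if "i = j \<or> la i j" for i j
    using that
  proof
    assume "i = j" then show ?thesis by (simp add: M_Idt)
  next
    assume ij: "la i j"
    \<comment> \<open>Followed by \<open>N j\<close>, the map becomes \<open>N i\<close> continued
      beyond its stabilisation stage, which is in \<open>M\<close>; as \<open>N j\<close> is in
      \<open>M\<close>, it cancels.\<close>
    show ?thesis
      by (rule M_cancel[of "N j"]) (use NQ[OF ij] conN[OF TT[OF ij]] NM Q_arr ij in auto)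
  qed
  have Q_comp: "Q j k \<cdot> Q i j = Q i k" if "i = j \<or> la i j" "j = k \<or> la j k" for i j k
  proof (cases "i = j \<or> j = k")
    case True
    then show ?thesis using Q_arr[OF that(1)] Q_arr[OF that(2)] by auto
  next
    case False
    then have ij: "la i j" and jk: "la j k" using that by auto
    have ik: "la i k"
      using transD[OF A.TRANS, of i j k] ij jk la_asym[OF ij] by (auto simp: la_def)
    have "Q j k \<cdot> Q i j = S k \<cdot> con (T j) (g k) \<cdot> N j \<cdot> Q i j"
      unfolding Q_la[OF jk] using Tg[OF jk] Q_arr[OF that(1)] by (simp add: Comp_assoc)
    also have "\<dots> = Q i k"
      unfolding NQ[OF ij] Q_la[OF ik] using con_con_comp[OF TT[OF ij] Tg[OF jk], of "N i"] by simp
    finally show ?thesis .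
  qed
  define F where "F = \<lparr>FO = (\<lambda>i. Cod C (S i)), FA = (\<lambda>(i, j). Q i j)\<rparr>"
  define \<iota> where "\<iota> i = con (T i) n \<cdot> N i" for i
  have \<iota>_arr: "\<iota> i \<in> Arr C" "Dom C (\<iota> i) = Cod C (S i)" "Cod C (\<iota> i) = ob n" if "i \<in> Field \<alpha>" for i
    using Tn[OF that] by (simp_all add: \<iota>_def)
  have \<iota>Q: "\<iota> j \<cdot> Q i j = \<iota> i" if ij: "la i j" for i j
  proof -
    note j = la_Field(2)[OF ij]
    have "\<iota> j \<cdot> Q i j = con (T j) n \<cdot> N j \<cdot> Q i j"
      unfolding \<iota>_def using Tn[OF j] Q_arr[of i j] ij by (simp add: Comp_assoc)
    then show ?thesis
      unfolding NQ[OF ij] using con_con_comp[OF TT[OF ij] Tn[OF j], of "N i"] by (simp add: \<iota>_def)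
  qed
  have \<iota>S: "\<iota> i \<cdot> S i = con (g i) n" if i: "i \<in> Field \<alpha>" for i
    unfolding \<iota>_def using Tn[OF i] con_con[OF gT Tn[OF i]] by (simp add: Comp_assoc)
  have F: "F \<in> chains_in C \<alpha> M"
    unfolding chains_in_def chains_def is_functor_def
    by (auto simp: F_def poset_cat_def hom_def la_iff Q_arr Q_M Q_comp)
  have colim: "is_colimit (poset_cat \<alpha>) C F (ob n) \<iota>"
    unfolding is_colimit_def
  proof (intro conjI allI impI)
    show "cocone (poset_cat \<alpha>) C F (ob n) \<iota>"
      unfolding cocone_def
      by (auto simp: F_def poset_cat_def hom_def la_iff \<iota>_arr \<iota>Q)
    fix Z y assume "cocone (poset_cat \<alpha>) C F Z y"
    then have Z: "Z \<in> Obj C"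
      and y: "\<And>i. i \<in> Field \<alpha> \<Longrightarrow> y i \<in> Arr C \<and> Dom C (y i) = Cod C (S i) \<and> Cod C (y i) = Z"
      and yc: "\<And>i j. (i, j) \<in> \<alpha> \<Longrightarrow> y j \<cdot> Q i j = y i"
      unfolding cocone_def by (auto simp: F_def poset_cat_def hom_def)
    have yQ: "y j \<cdot> Q i j = y i" if "la i j" for i j using that yc by (simp add: la_def)
    have inj: "la i j" if "i \<in> Field \<alpha>" "j \<in> Field \<alpha>" "lt (g i) (g j)" for i j
      using la_total[OF that(1,2)] gg[of j i] lt_trans[OF that(3)] lt_irrefl that(3) by auto
    have inj': "i = j" if "i \<in> Field \<alpha>" "j \<in> Field \<alpha>" "g i = g j" for i j
      using la_total[OF that(1,2)] gg[of j i] gg[of i j] lt_irrefl that(3) by auto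
    \<comment> \<open>A cocone on the chain, restricted along the \<open>S i\<close>, is a cocone on
      the stages \<open>g i\<close>, whose colimit is stage \<open>n\<close>.\<close>
    have "\<exists>h. h \<in> Arr C \<and> Dom C h = ob n \<and> Cod C h = Z \<and> (\<forall>i\<in>Field \<alpha>. h \<cdot> con (g i) n = y i \<cdot> S i)"
    proof (rule limit_stage_universal[OF gn cof neF _ Z])
      show "y i \<cdot> S i \<in> Arr C \<and> Dom C (y i \<cdot> S i) = ob (g i) \<and> Cod C (y i \<cdot> S i) = Z"
        if "i \<in> Field \<alpha>" for i using y[OF that] by simp
      fix i j assume ij: "i \<in> Field \<alpha>" "j \<in> Field \<alpha>"
      show "y i \<cdot> S i = y j \<cdot> S j" if "g i = g j" using inj'[OF ij that] by simp
      assume "lt (g i) (g j)"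
      then have l: "la i j" by (rule inj[OF ij])
      have "(y j \<cdot> S j) \<cdot> con (g i) (g j) = y j \<cdot> Q i j \<cdot> S i"
        using y[OF ij(2)] gg[OF l] by (simp add: Comp_assoc QS[OF l])
      also have "\<dots> = y i \<cdot> S i"
        using Comp_reassoc[OF _ _ _ _ _ yQ[OF l], of "S i"] y[OF ij(2)] Q_arr[of i j] l by simp
      finally show "(y j \<cdot> S j) \<cdot> con (g i) (g j) = y i \<cdot> S i" .
    qed
    then obtain h where h: "h \<in> Arr C" "Dom C h = ob n" "Cod C h = Z"
      "\<And>i. i \<in> Field \<alpha> \<Longrightarrow> h \<cdot> con (g i) n = y i \<cdot> S i" by blast
    have h\<iota>: "h \<cdot> \<iota> i = y i" if i: "i \<in> Field \<alpha>" for i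
    proof -
      \<comment> \<open>The value at the \<open>E\<close>-part of \<open>i\<close> is read off at a
        later \<open>j\<close>, since the way to it passes through stage \<open>g j\<close>, where
        \<open>h\<close> is known.\<close>
      obtain j where j: "la i j" using la_lim[OF i] by blast
      note jF = la_Field(2)[OF j]
      have "h \<cdot> \<iota> i = h \<cdot> con (g j) n \<cdot> con (T i) (g j) \<cdot> N i"
        using con_con_comp[OF Tg[OF j] gn[OF jF], of "N i"] by (simp add: \<iota>_def)
      also have "\<dots> = (y j \<cdot> S j) \<cdot> con (T i) (g j) \<cdot> N i"
        using Comp_reassoc[OF _ _ _ _ _ h(4)[OF jF], of "con (T i) (g j) \<cdot> N i"] h(1-3) gn[OF jF] Tg[OF j]
        by simp
      also have "\<dots> = y j \<cdot> Q i j"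
        unfolding Q_la[OF j] using y[OF jF] Tg[OF j] by (simp add: Comp_assoc)
      finally show ?thesis using yQ[OF j] by simp
    qed
    show "\<exists>!h. h \<in> hom C (ob n) Z \<and> (\<forall>i\<in>Obj (poset_cat \<alpha>). h \<cdot> \<iota> i = y i)"
    proof (rule ex1I[of _ h])
      show "h \<in> hom C (ob n) Z \<and> (\<forall>i\<in>Obj (poset_cat \<alpha>). h \<cdot> \<iota> i = y i)"
        using h(1-3) h\<iota> by (simp add: hom_def poset_cat_def)
      fix h' assume "h' \<in> hom C (ob n) Z \<and> (\<forall>i\<in>Obj (poset_cat \<alpha>). h' \<cdot> \<iota> i = y i)"
      then have h': "h' \<in> Arr C" "Dom C h' = ob n" "Cod C h' = Z" "\<And>i. i \<in> Field \<alpha> \<Longrightarrow> h' \<cdot> \<iota> i = y i"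
        by (auto simp: hom_def poset_cat_def)
      show "h' = h"
      proof (rule limit_stage_ext[OF gn cof neF])
        fix i assume i: "i \<in> Field \<alpha>"
        have "h' \<cdot> con (g i) n = y i \<cdot> S i"
          using Comp_reassoc[OF _ _ _ _ _ h'(4)[OF i], of "S i"] h'(1-3) \<iota>_arr[OF i] \<iota>S[OF i] by simp
        then show "h' \<cdot> con (g i) n = h \<cdot> con (g i) n" using h(4)[OF i] by simp
      qed (use h h' in auto)
    qed
  qed
  have "converges n"
    unfolding converges_def
  proof (intro conjI allI impI ballI)
    fix p assume "lt p n"
    then obtain i where "i \<in> Field \<alpha>" "lt p (g i)" using cof by blast
    then show "\<exists>q. lt p q \<and> lt q n" using gn by blast
  next
    fix A u assume A: "A \<in> Obj (Hor J)" and u: "u \<in> hom C (DO U A) (ob n)"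
    obtain i u' where i: "i \<in> Field \<alpha>" and u': "u' \<in> hom C (DO U A) (FO F i)" "\<iota> i \<cdot> u' = u"
      using chain_elements(1)[OF wo F colim sm[OF A] u] by blast
    have a: "u' \<in> Arr C" "Dom C u' = DO U A" "Cod C u' = Cod C (S i)"
      using u'(1) by (auto simp: F_def hom_def)
    \<comment> \<open>Smallness gives a factorisation through an \<open>E\<close>-part, and
      \<open>N i\<close> carries it into the stage \<open>T i\<close>.\<close>
    have "N i \<cdot> u' \<in> hom C (DO U A) (ob (T i))" using a by (simp add: hom_def)
    moreover have "con (T i) n \<cdot> N i \<cdot> u' = u"
      using u'(2) a Tn[OF i] by (simp add: \<iota>_def Comp_assoc)
    ultimately show "\<exists>m u'. lt m n \<and> u' \<in> hom C (DO U A) (ob m) \<and> con m n \<cdot> u' = u"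
      using Tn[OF i] by blast
  next
    fix A p u u'
    assume A: "A \<in> Obj (Hor J)" and p: "lt p n" and u: "u \<in> hom C (DO U A) (ob p)"
      "u' \<in> hom C (DO U A) (ob p)" and eq: "con p n \<cdot> u = con p n \<cdot> u'"
    have a: "u \<in> Arr C" "Dom C u = DO U A" "Cod C u = ob p" "u' \<in> Arr C" "Dom C u' = DO U A" "Cod C u' = ob p"
      using u by (auto simp: hom_def)
    obtain i where i: "i \<in> Field \<alpha>" "lt p (g i)" using cof[OF p] by blast
    \<comment> \<open>The two maps enter the chain through a stage \<open>g i\<close> beyond
      \<open>p\<close>. Smallness equates them at some later \<open>j\<close>, and
      \<open>N j\<close> brings the equation back to the stage \<open>T j\<close>.\<close>
    let ?w = "\<lambda>u. S i \<cdot> con p (g i) \<cdot> u"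
    have \<iota>w: "\<iota> i \<cdot> ?w v = con p n \<cdot> v" if v: "v \<in> Arr C" "Cod C v = ob p" for v
      using Comp_reassoc[OF _ _ _ _ _ \<iota>S[OF i(1)], of "con p (g i) \<cdot> v"] \<iota>_arr[OF i(1)] i v
        con_con_comp[OF i(2) gn[OF i(1)] v] by simp
    have "?w u \<in> hom C (DO U A) (FO F i)" "?w u' \<in> hom C (DO U A) (FO F i)"
      using a i by (simp_all add: F_def hom_def)
    then obtain j where j: "(i, j) \<in> \<alpha>" "FA F (i, j) \<cdot> ?w u = FA F (i, j) \<cdot> ?w u'"
      using chain_elements(2)[OF wo F colim sm[OF A] i(1), of "?w u" "?w u'"] \<iota>w eq a by auto
    have jF: "j \<in> Field \<alpha>" and ij: "i = j \<or> la i j" using j(1) la_iff by auto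
    have NQw: "N j \<cdot> Q i j \<cdot> ?w v = con p (T j) \<cdot> v" if v: "v \<in> Arr C" "Cod C v = ob p" for v
    proof -
      have pT: "lt p (T i)" using lt_trans[OF i(2) gT] .
      have Nw: "N i \<cdot> ?w v = con p (T i) \<cdot> v"
        using Comp_reassoc[OF _ _ _ _ _ SN(6)[of i], of "con p (g i) \<cdot> v"] i v
          con_con_comp[OF i(2) gT v] by simp
      show ?thesis
        using ij
      proof
        assume "i = j" then show ?thesis using Nw i v by simp
      next
        assume l: "la i j"
        have "N j \<cdot> Q i j \<cdot> ?w v = (con (T i) (T j) \<cdot> N i) \<cdot> ?w v"
          using Comp_reassoc[OF _ _ _ _ _ NQ[OF l], of "?w v"] Q_arr[of i j] l i v by simp
        also have "\<dots> = con (T i) (T j) \<cdot> con p (T i) \<cdot> v"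
          using TT[OF l] i v Nw by (simp add: Comp_assoc)
        also have "\<dots> = con p (T j) \<cdot> v" by (rule con_con_comp[OF pT TT[OF l] v])
        finally show ?thesis .
      qed
    qed
    have "lt p (T j)" using ij lt_trans[OF i(2) gT] TT[of i j] lt_trans by blast
    moreover have "con p (T j) \<cdot> u = con p (T j) \<cdot> u'"
      using j(2) NQw[of u] NQw[of u'] a by (simp add: F_def)
    ultimately show "\<exists>q. lt p q \<and> lt q n \<and> con p q \<cdot> u = con p q \<cdot> u'"
      using Tn[OF jF] by blast
  qed
  then show ?thesis by blast
qed

end

end

section \<open>The factorisation system of isomorphisms and all arrows\<close>

context category begin

lemma iso_orthogonal:
  assumes "is_iso C e" and m: "m \<in> Arr C"
  shows "orthogonal C e m"
proof (rule orthogonalI)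
  fix u v assume "Sq e m u v \<in> csquares C"
  then have a: "e \<in> Arr C" "u \<in> Arr C" "v \<in> Arr C" "Dom C u = Dom C e" "Cod C u = Dom C m"
    "Dom C v = Cod C e" "Cod C v = Cod C m" "m \<cdot> u = v \<cdot> e"
    by (auto simp: csquares_iff)
  obtain k where k: "k \<in> Arr C" "Dom C k = Cod C e" "Cod C k = Dom C e" "k \<cdot> e = Idt C (Dom C e)"
    "e \<cdot> k = Idt C (Cod C e)" using assms by (auto simp: is_iso_def hom_def)
  have 1: "(u \<cdot> k) \<cdot> e = u" using a(1-7) k by (simp add: Comp_assoc)
  have 2: "m \<cdot> u \<cdot> k = v"
    using a k m Comp_assoc[of k e v] Comp_assoc[of k u m] by simp
  show "\<exists>!d. d \<in> Arr C \<and> Dom C d = Cod C e \<and> Cod C d = Dom C m \<and> d \<cdot> e = u \<and> m \<cdot> d = v"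
  proof (rule ex1I[of _ "u \<cdot> k"])
    show "u \<cdot> k \<in> Arr C \<and> Dom C (u \<cdot> k) = Cod C e \<and> Cod C (u \<cdot> k) = Dom C m \<and> (u \<cdot> k) \<cdot> e = u \<and> m \<cdot> u \<cdot> k = v"
      using a(1-7) k 1 2 by simp
    fix d assume d: "d \<in> Arr C \<and> Dom C d = Cod C e \<and> Cod C d = Dom C m \<and> d \<cdot> e = u \<and> m \<cdot> d = v"
    then show "d = u \<cdot> k" using a(1) k Comp_assoc[of k e d] by simp
  qed
qed

text \<open>The diagonal of the identity square on \<open>e\<close> is an inverse of
  \<open>e\<close>.\<close>

lemma orthogonal_self_iso:
  assumes e: "e \<in> Arr C" and o: "orthogonal C e e"
  shows "is_iso C e"
proof -
  have "Sq e e (Idt C (Dom C e)) (Idt C (Cod C e)) \<in> csquares C" using e by (simp add: csquares_iff)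
  from orthogonalD[OF o this] show ?thesis using e unfolding is_iso_def hom_def by blast
qed

lemma is_iso_Idt: "A \<in> Obj C \<Longrightarrow> is_iso C (Idt C A)"
  unfolding is_iso_def by (intro conjI bexI[of _ "Idt C A"]) (simp_all add: hom_def)

lemma factorisation_system_iso: "factorisation_system C {e. is_iso C e} (Arr C)"
  unfolding factorisation_system_def
proof (intro conjI ballI)
  show "{e. is_iso C e} = {e \<in> Arr C. \<forall>m\<in>Arr C. orthogonal C e m}"
    using iso_orthogonal orthogonal_self_iso by (auto simp: is_iso_def)
  show "Arr C = {m \<in> Arr C. \<forall>e\<in>{e. is_iso C e}. orthogonal C e m}"
    using iso_orthogonal by auto
  fix f assume f: "f \<in> Arr C"
  have "is_iso C (Idt C (Dom C f))"
    using f by (simp add: is_iso_Idt)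
  then show "\<exists>e\<in>{e. is_iso C e}. \<exists>m\<in>Arr C. Cod C e = Dom C m \<and> f = m \<cdot> e"
    using f by (intro bexI[of _ "Idt C (Dom C f)"] bexI[of _ f]) auto
qed

lemma iso_epic:
  assumes "is_iso C e"
  shows "epic C e"
proof -
  obtain k where k: "e \<in> Arr C" "k \<in> Arr C" "Dom C k = Cod C e" "Cod C k = Dom C e"
    "e \<cdot> k = Idt C (Cod C e)" using assms by (auto simp: is_iso_def hom_def)
  have "g = h" if "g \<in> Arr C" "h \<in> Arr C" "Dom C g = Cod C e" "Dom C h = Cod C e" "g \<cdot> e = h \<cdot> e" for g h
    using arg_cong[OF that(5), of "\<lambda>x. x \<cdot> k"] that(1-4) k by (simp add: Comp_assoc)
  then show ?thesis using k by (auto simp: epic_def)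
qed

end

text \<open>An isomorphism out of \<open>X\<close> is itself the isomorphism comparing it with the
  identity, so one representative suffices.\<close>

lemma (in universe) co_well_powered_iso:
  assumes "category C"
  shows "co_well_powered \<kappa> C {e. is_iso C e}"
  unfolding co_well_powered_def
proof (intro ballI exI[of _ "{Idt C X}" for X] conjI impI)
  interpret category C by (rule assms)
  fix X assume X: "X \<in> Obj C"
  show "{Idt C X} \<subseteq> {e \<in> {e. is_iso C e}. Dom C e = X}"
    using X by (simp add: is_iso_Idt)
  show "small \<kappa> {Idt C X}" by (simp add: small_finite)
  fix e assume e: "e \<in> {e. is_iso C e}" "Dom C e = X"
  then have "e \<in> hom C X (Cod C e)" "e \<cdot>\<^bsub>C\<^esub> Idt C X = e" by (auto simp: is_iso_def hom_def)
  then show "\<exists>s\<in>{Idt C X}. \<exists>i\<in>hom C (Cod C s) (Cod C e). is_iso C i \<and> i \<cdot>\<^bsub>C\<^esub> s = e"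
    using X e by auto
qed

section \<open>From free lifting operations to the generated factorisation system\<close>

lemma ordinal_small_imp_wrt: "ordinal_small \<kappa> C \<alpha> A \<Longrightarrow> ordinal_small_wrt \<kappa> C \<alpha> M A"
  unfolding ordinal_small_def ordinal_small_wrt_def preserves_colimits_of_def chains_in_def by blast

text \<open>The hypothesis provides free objects one arrow at a time, without naturality:
  functoriality of the factorisation is a consequence of their universal property. The transfinite
  construction can thus be run separately for each \<open>f\<close>, with an index of convergence
  that depends on \<open>f\<close>.\<close>

lemma (in lifting_shape) awfs_of_free:
  assumes "\<And>f. f \<in> Arr C \<Longrightarrow> \<exists>x\<in>liftV. \<exists>l\<in>Arr C. Dom C l = Dom C f \<and> Cod C l = Dom C (fst x) \<and>
    Cod C (fst x) = Cod C f \<and> fst x \<cdot> l = f \<and>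
    (\<forall>y\<in>liftV. \<forall>a b. Sq f (fst y) a b \<in> csquares C \<longrightarrow> (\<exists>!h. lift.mor x y h b \<and> h \<cdot> l = a))"
  shows "\<exists>W. awfs C W \<and>
    (\<exists>\<Phi>. double_iso (R_Alg C W) (Lift_dbl C J U) \<Phi> \<and>
      dbl_eq (R_Alg C W) (dbl_comp forget_dbl \<Phi>) forget_dbl)"
proof -
  obtain free L where free: "\<And>f. f \<in> Arr C \<Longrightarrow> free f \<in> liftV \<and> L f \<in> Arr C \<and> Dom C (L f) = Dom C f \<and>
    Cod C (L f) = Dom C (fst (free f)) \<and> Cod C (fst (free f)) = Cod C f \<and> fst (free f) \<cdot> L f = f \<and>
    (\<forall>y\<in>liftV. \<forall>a b. Sq f (fst y) a b \<in> csquares C \<longrightarrow>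
      (\<exists>!h. lift.mor (free f) y h b \<and> h \<cdot> L f = a))"
    using assms by metis
  interpret F: free_vertical C liftV fst "lift_id C J U" "lift_comp C J U" "lift_square C J U" free L
  proof (unfold_locales, goal_cases)
    case 1
    then show ?case by (rule lift_square_und)
  next
    case 2
    then show ?case by (rule lift_discrete)
  next
    case 3
    then show ?case by (rule lift_split)
  next
    case 4
    then show ?case by (rule lift_split_coequaliser)
  next
    case (11 x f a b)
    then show ?case using free[of f] by (auto simp: csquares_iff)
  qed (simp_all add: free)
  obtain F where F: "double_iso (R_Alg C F.W) (dbl_over C liftV fst (lift_id C J U) (lift_comp C J U)
      (lift_square C J U)) \<lparr>DO = id, DH = id, DV = F, DS = map_sq F id\<rparr>"
    "\<And>y. y \<in> R_algs C F.W \<Longrightarrow> fst (F y) = fst y"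
    using F.double_iso_R_Alg by blast
  have "dbl_eq (R_Alg C F.W)
    (dbl_comp forget_dbl \<lparr>DO = id, DH = id, DV = F, DS = map_sq F id\<rparr>) forget_dbl"
    unfolding dbl_eq_def dbl_comp_def forget_dbl_def
    by (auto simp: R_Alg_def dbl_over_def Let_def F(2))
  with F(1) F.awfs_W show ?thesis unfolding Lift_dbl_def liftV_def by blast
qed

theorem theorem18:
  fixes \<kappa> :: "'k rel"
    and C :: "('o, 'a) cat"
    and J :: "('p, 'g, 'w, 't) dbl_cat"
    and U :: "('p, 'g, 'w, 't, 'o, 'a, 'a, ('a, 'a) sq) dbl_ftr"
  assumes "inaccessible \<kappa>"
    and "category C" and "locally_small \<kappa> C" and "cocomplete \<kappa> C"
    and "double_category J" and "small_double_category \<kappa> J"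
    and "double_functor J (Sq_dbl C) U"
    and "\<exists>\<alpha> :: 'k rel. limit_ordinal \<kappa> \<alpha> \<and>
      ((\<forall>A\<in>Obj (Hor J). ordinal_small \<kappa> C \<alpha> (DO U A)) \<or>
       (\<exists>E M. factorisation_system C E M \<and> proper C E M \<and> co_well_powered \<kappa> C E \<and>
          (\<forall>A\<in>Obj (Hor J). ordinal_small_wrt \<kappa> C \<alpha> M (DO U A))))"
  shows "\<exists>W. awfs C W \<and>
    (\<exists>\<Phi>. double_iso (R_Alg C W) (Lift_dbl C J U) \<Phi> \<and>
      dbl_eq (R_Alg C W) (dbl_comp forget_dbl \<Phi>) forget_dbl)"
proof -
  interpret category C by fact
  interpret universe \<kappa> by unfold_locales fact
  interpret S: lifting_shape C J U
    by (intro lifting_shape.intro lifting_shape_axioms.intro assms)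
  obtain \<alpha> :: "'k rel" where \<alpha>: "limit_ordinal \<kappa> \<alpha>"
    and cases: "(\<forall>A\<in>Obj (Hor J). ordinal_small \<kappa> C \<alpha> (DO U A)) \<or>
       (\<exists>E M. factorisation_system C E M \<and> proper C E M \<and> co_well_powered \<kappa> C E \<and>
          (\<forall>A\<in>Obj (Hor J). ordinal_small_wrt \<kappa> C \<alpha> M (DO U A)))"
    using assms(8) by blast
  have "\<exists>E M. factorisation_system C E M \<and> (\<forall>e\<in>E. epic C e) \<and> co_well_powered \<kappa> C E \<and>
      (\<forall>A\<in>Obj (Hor J). ordinal_small_wrt \<kappa> C \<alpha> M (DO U A))"
    using cases
  proof
    assume "\<forall>A\<in>Obj (Hor J). ordinal_small \<kappa> C \<alpha> (DO U A)"
    then have "\<forall>A\<in>Obj (Hor J). ordinal_small_wrt \<kappa> C \<alpha> (Arr C) (DO U A)"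
      by (simp add: ordinal_small_imp_wrt)
    with factorisation_system_iso iso_epic co_well_powered_iso[OF assms(2)] show ?thesis by blast
  qed (auto simp: proper_def)
  then obtain E M where EM: "factorisation_system C E M" "\<And>e. e \<in> E \<Longrightarrow> epic C e"
    "co_well_powered \<kappa> C E" "\<And>A. A \<in> Obj (Hor J) \<Longrightarrow> ordinal_small_wrt \<kappa> C \<alpha> M (DO U A)"
    by blast
  show ?thesis
  proof (rule S.awfs_of_free)
    fix f assume f: "f \<in> Arr C"
    interpret lifting_chain C J U \<kappa> f
      by (intro lifting_chain.intro lifting_chain_axioms.intro cocomplete_category.intro
          cocomplete_category_axioms.intro S.lifting_shape_axioms category_axioms universe_axioms
          assms f)
    obtain n where "converges n" using converges_exists[OF EM(1-3) \<alpha> EM(4)] by blast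
    then show "\<exists>x\<in>S.liftV. \<exists>l\<in>Arr C. Dom C l = Dom C f \<and> Cod C l = Dom C (fst x) \<and>
      Cod C (fst x) = Cod C f \<and> fst x \<cdot>\<^bsub>C\<^esub> l = f \<and>
      (\<forall>y\<in>S.liftV. \<forall>a b. Sq f (fst y) a b \<in> csquares C \<longrightarrow>
        (\<exists>!h. S.lift.mor x y h b \<and> h \<cdot>\<^bsub>C\<^esub> l = a))" by (rule free_liftV)
  qed
qed

end
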